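(* Let $k\ge 1$, $n\ge k$, let $X=(X_1,\dots,X_n)$ be i.i.d. random variables in $\mathcal X$ and $Y=(Y_{i,j})_{1\le i<j\le n}$ be i.i.d. random variables in $\mathcal Y$, with $X$ and $Y$ independent. Let $f:\mathcal X^k\times\mathcal Y^{k(k-1)/2}\to\mathbb R$ be a measurable symmetric function with $\|f(X_{[k]};Y_{[k]_2})\|_4<\infty$. Let $f_1(x)=\mathbb E\{f(X_{[k]};Y_{[k]_2})\mid X_1=x\}-\mathbb E\{f(X_{[k]};Y_{[k]_2})\}$ and $\sigma_1=\|f_1(X_1)\|_2$. If $\sigma_1>0$, then $$\sup_{z\in\mathbb R}\left|\mathbb P\left[\frac{S_{n,k}(f)-\mathbb E\{S_{n,k}(f)\}}{\sqrt{\operatorname{Var}\{S_{n,k}(f)\}}}\le z\right]-\Phi(z)\right|\le \frac{12k\,\|f(X_{[k]};Y_{[k]_2})\|_4^2}{\sqrt n\,\sigma_1^2}.$$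
   Context: Set $Y_{j,i}=Y_{i,j}$ for $i<j$. $[k]=\{1,\dots,k\}$, $[k]_2=\{(i,j):1\le i<j\le k\}$, $X_{[k]}=(X_1,\dots,X_k)$, $Y_{[k]_2}=(Y_{i,j})_{1\le i<j\le k}$. The function $f$ is symmetric if the value $f(X_{i_1},\dots,X_{i_k};Y_{i_1,i_2},\dots,Y_{i_{k-1},i_k})$ is unchanged under any permutation of the distinct indices $i_1,\dots,i_k$; i.e. for each permutation $\pi$ of $[k]$, $f((x_{\pi(i)})_i;(y_{\pi(i),\pi(j)})_{i<j})=f((x_i)_i;(y_{i,j})_{i<j})$ with $y_{j,i}=y_{i,j}$. The generalized $U$-statistic is $$S_{n,k}(f)=\sum_{1\le \alpha(1)<\dots<\alpha(k)\le n} f(X_{\alpha(1)},\dots,X_{\alpha(k)};Y_{\alpha(1),\alpha(2)},\dots,Y_{\alpha(k-1),\alpha(k)}).$$ $\|Z\|_p=(\mathbb E|Z|^p)^{1/p}$, and $\Phi$ is the standard normal distribution function. *)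

theory Defs
  imports "HOL-Probability.Probability"
begin

definition iid_family :: "'w measure \<Rightarrow> 'a measure \<Rightarrow> ('i \<Rightarrow> 'w \<Rightarrow> 'a) \<Rightarrow> 'i set \<Rightarrow> bool" where
  "iid_family M N Z I \<longleftrightarrow>
     prob_space.indep_vars M (\<lambda>_. N) Z I \<and>
     (\<forall>i\<in>I. \<forall>j\<in>I. distr M N (Z i) = distr M N (Z j))"

(* The library's indep_var requires both variables to take values in the same type. *)
definition indep_rv_pair ::
  "'w measure \<Rightarrow> 'a measure \<Rightarrow> ('w \<Rightarrow> 'a) \<Rightarrow> 'b measure \<Rightarrow> ('w \<Rightarrow> 'b) \<Rightarrow> bool" where
  "indep_rv_pair M A U B V \<longleftrightarrow>
     U \<in> measurable M A \<and> V \<in> measurable M B \<and>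
     prob_space.indep_set M (sets (vimage_algebra (space M) U A)) (sets (vimage_algebra (space M) V B))"

(* Bochner integral: the value is only meaningful if \<bar>Z\<bar> ^ p is integrable. *)
definition Lp_norm :: "'w measure \<Rightarrow> nat \<Rightarrow> ('w \<Rightarrow> real) \<Rightarrow> real" where
  "Lp_norm M p Z = root p (\<integral>\<omega>. \<bar>Z \<omega>\<bar> ^ p \<partial>M)"

(* g is a version of the regression function t \<mapsto> E(Z | T = t): a measurable function on the
   value space N of T such that g(T) is the conditional expectation of Z given sigma(T). *)
definition is_cond_exp_given ::
  "'w measure \<Rightarrow> 'a measure \<Rightarrow> ('w \<Rightarrow> 'a) \<Rightarrow> ('w \<Rightarrow> real) \<Rightarrow> ('a \<Rightarrow> real) \<Rightarrow> bool" where
  "is_cond_exp_given M N T Z g \<longleftrightarrow>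
     g \<in> borel_measurable N \<and>
     (AE \<omega> in M. g (T \<omega>) = real_cond_exp M (vimage_algebra (space M) T N) Z \<omega>)"

definition upper_pairs :: "nat \<Rightarrow> (nat \<times> nat) set" where
  "upper_pairs k = {(i, j). 1 \<le> i \<and> i < j \<and> j \<le> k}"

definition kernel_space ::
  "nat \<Rightarrow> 'x measure \<Rightarrow> 'y measure \<Rightarrow> ((nat \<Rightarrow> 'x) \<times> (nat \<times> nat \<Rightarrow> 'y)) measure" where
  "kernel_space k A B = PiM {1..k} (\<lambda>_. A) \<Otimes>\<^sub>M PiM (upper_pairs k) (\<lambda>_. B)"

(* The pair (min, max) implements the convention y_{j,i} = y_{i,j} for i < j. *)
definition symmetric_kernel ::
  "nat \<Rightarrow> 'x measure \<Rightarrow> 'y measure \<Rightarrow> ((nat \<Rightarrow> 'x) \<times> (nat \<times> nat \<Rightarrow> 'y) \<Rightarrow> real) \<Rightarrow> bool" where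
  "symmetric_kernel k A B f \<longleftrightarrow>
     (\<forall>\<pi>. \<pi> permutes {1..k} \<longrightarrow>
       (\<forall>(x, y) \<in> space (kernel_space k A B).
          f (\<lambda>i\<in>{1..k}. x (\<pi> i),
             \<lambda>p\<in>upper_pairs k. y (min (\<pi> (fst p)) (\<pi> (snd p)), max (\<pi> (fst p)) (\<pi> (snd p))))
          = f (x, y)))"

(* f(X_{a(1)}, ..., X_{a(k)}; Y_{a(1),a(2)}, ..., Y_{a(k-1),a(k)}) for an increasing a *)
definition kernel_at ::
  "nat \<Rightarrow> ((nat \<Rightarrow> 'x) \<times> (nat \<times> nat \<Rightarrow> 'y) \<Rightarrow> real) \<Rightarrow> (nat \<Rightarrow> 'w \<Rightarrow> 'x) \<Rightarrow>
   (nat \<times> nat \<Rightarrow> 'w \<Rightarrow> 'y) \<Rightarrow> (nat \<Rightarrow> nat) \<Rightarrow> 'w \<Rightarrow> real" where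
  "kernel_at k f X Y a \<omega> =
     f (\<lambda>i\<in>{1..k}. X (a i) \<omega>, \<lambda>p\<in>upper_pairs k. Y (a (fst p), a (snd p)) \<omega>)"

definition gen_U_stat ::
  "nat \<Rightarrow> nat \<Rightarrow> ((nat \<Rightarrow> 'x) \<times> (nat \<times> nat \<Rightarrow> 'y) \<Rightarrow> real) \<Rightarrow> (nat \<Rightarrow> 'w \<Rightarrow> 'x) \<Rightarrow>
   (nat \<times> nat \<Rightarrow> 'w \<Rightarrow> 'y) \<Rightarrow> 'w \<Rightarrow> real" where
  "gen_U_stat n k f X Y \<omega> =
     (\<Sum>a \<in> {a \<in> {1..k} \<rightarrow>\<^sub>E {1..n}. strict_mono_on {1..k} a}. kernel_at k f X Y a \<omega>)"

end

theory Submission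
  imports Defs
begin

text \<open>Write \<open>S - E S = a (\<Sum>\<^sub>i f\<^sub>1(X\<^sub>i)) + U\<close> with \<open>a = (n-1 choose k-1)\<close> and
  \<open>U = \<Sum>\<^sub>\<alpha> u\<^sub>\<alpha>\<close>, where \<open>u\<^sub>\<alpha>\<close> is the centred summand minus its linear projection. Two terms \<open>u\<^sub>\<alpha>\<close>,
  \<open>u\<^sub>\<beta>\<close> whose index tuples share at most one vertex are orthogonal, so that \<open>U\<close>, and likewise the
  part of \<open>U\<close> that changes when one \<open>X\<^sub>i\<close> is resampled, is of smaller order than the linear part.
  For the normal approximation, Stein's equation is applied to the exchangeable pairs obtained by
  resampling one \<open>X\<^sub>i\<close>. The derivative of the Stein solution is a difference of two nondecreasing
  functions; hence the error of the trapezoidal rule for an increment of the solution is dominated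
  by an increment of the sum of these functions, and exchangeability turns the latter into a sum of
  independent centred variables plus a small remainder.\<close>

section \<open>Stein's equation\<close>

text \<open>The obstacle is the jump of the derivative of the Stein solution at \<open>z\<close>: a
  Taylor expansion would leave the probability that \<open>W\<close> is near \<open>z\<close>, hence
  call for a separate concentration inequality. Monotonicity avoids it. Let \<open>d\<close> be the
  change of the linear part and \<open>D\<close> that of \<open>W\<close>. The error is at most
  \<open>\<bar>d\<bar> * D\<close> times half an increment of \<open>stein_var\<close>; this weight
  is antisymmetric, so swapping the pair leaves the mean of
  \<open>\<bar>d\<bar> * D * stein_var z W\<close>. Averaging \<open>\<bar>d\<bar> * d\<close> over
  the fresh value gives a centred function of one coordinate, and a sum of these has the order of
  the root of the summed fourth moments. Only the \<open>X\<close> variables are redrawn. The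
  \<open>Y\<close> variables stay in the remainder, and a shared \<open>Y\<close> variable forces
  two shared vertices; this is why one shared vertex still allows orthogonality. Origin of 12: the
  terms add up to 7 sqrt(Y) + 10 Z, where Z is the rate without the factor 12 k and Y, a bound for
  the share of \<open>U\<close> in the variance, is at most 2 (k - 1)^2 Z^2. As 7 sqrt(2) < 10, the
  total is at most 10 k Z.\<close>

abbreviation std_normal_cdf :: "real \<Rightarrow> real" where
  "std_normal_cdf \<equiv> cdf std_normal_distribution"

section \<open>The standard normal distribution function and its density\<close>

lemma DERIV_std_normal_cdf: "(std_normal_cdf has_real_derivative std_normal_density x) (at x)"
proof -
  interpret real_distribution std_normal_distribution by (rule real_dist_normal_dist)
  \<comment> \<open>A finite base point to the left of \<open>x\<close> replaces the lower limit
    -infinity and leaves \<open>x\<close> in the interior of \<open>{a..x+1}\<close>.\<close>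
  define a where "a = x - 1"
  have cont: "continuous_on A std_normal_density" for A
    unfolding std_normal_density_def by (intro continuous_intros) auto
  have eq: "std_normal_cdf y = std_normal_cdf a + integral {a..y} std_normal_density" if "a < y" for y
  proof -
    have "std_normal_cdf y - std_normal_cdf a = measure std_normal_distribution {a<..y}"
      using that by (rule cdf_diff_eq)
    also have "\<dots> = integral\<^sup>L std_normal_distribution (indicator {a<..y})"
      by simp
    also have "\<dots> = (LINT t|lborel. std_normal_density t *\<^sub>R indicator {a<..y} t)"
      by (subst integral_density) auto
    also have "\<dots> = (LINT t:{a<..y}|lborel. std_normal_density t)"
      unfolding set_lebesgue_integral_def by (simp add: mult.commute)
    also have "\<dots> = integral {a<..y} std_normal_density"
    proof (rule set_borel_integral_eq_integral)
      have "integrable lborel std_normal_density" by simp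
      then show "set_integrable lborel {a<..y} std_normal_density"
        unfolding set_integrable_def by (rule integrable_mult_indicator[rotated]) auto
    qed
    also have "\<dots> = integral {a..y} std_normal_density"
      by (rule integral_subset_negligible)
        (auto intro: negligible_subset[of "{a}"])
    finally show ?thesis by simp
  qed
  have "((\<lambda>y. integral {a..y} std_normal_density) has_real_derivative std_normal_density x) (at x within {a..x+1})"
    by (rule integral_has_real_derivative[OF cont]) (simp add: a_def)
  then have "((\<lambda>y. integral {a..y} std_normal_density) has_real_derivative std_normal_density x) (at x)"
    by (simp add: at_within_Icc_at a_def)
  then have "((\<lambda>y. std_normal_cdf a + integral {a..y} std_normal_density) has_real_derivative std_normal_density x) (at x)"
    by (auto intro!: derivative_eq_intros)
  moreover have "eventually (\<lambda>y. std_normal_cdf y = std_normal_cdf a + integral {a..y} std_normal_density) (nhds x)"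
    using eventually_gt_at_top[of a] eq
    by (intro eventually_nhds_in_open[of "{a<..}" x, THEN eventually_mono]) (auto simp: a_def)
  ultimately show ?thesis
    by (subst DERIV_cong_ev[OF refl _ refl]) auto
qed

lemmas std_normal_cdf_derivs [derivative_intros] = DERIV_std_normal_cdf[THEN DERIV_chain2]

lemma DERIV_std_normal_density:
  "(std_normal_density has_real_derivative - x * std_normal_density x) (at x)"
  unfolding std_normal_density_def by (auto intro!: derivative_eq_intros simp: field_simps)

lemmas std_normal_density_derivs [derivative_intros] = DERIV_std_normal_density[THEN DERIV_chain2]

lemma std_normal_density_gt0: "std_normal_density x > 0"
  by (simp add: std_normal_density_def)

lemma std_normal_cdf_bounds: "0 \<le> std_normal_cdf x" "std_normal_cdf x \<le> 1"
proof -
  interpret real_distribution std_normal_distribution by (rule real_dist_normal_dist)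
  show "0 \<le> std_normal_cdf x" "std_normal_cdf x \<le> 1" by (auto simp: cdf_nonneg cdf_bounded_prob)
qed

lemma std_normal_cdf_tendsto:
  "(std_normal_cdf \<longlongrightarrow> 0) at_bot" "(std_normal_cdf \<longlongrightarrow> 1) at_top"
proof -
  interpret real_distribution std_normal_distribution by (rule real_dist_normal_dist)
  show "(std_normal_cdf \<longlongrightarrow> 0) at_bot" "(std_normal_cdf \<longlongrightarrow> 1) at_top"
    by (auto intro: cdf_lim_at_bot cdf_lim_at_top_prob)
qed

lemma std_normal_cdf_mono: "x \<le> y \<Longrightarrow> std_normal_cdf x \<le> std_normal_cdf y"
proof -
  interpret real_distribution std_normal_distribution by (rule real_dist_normal_dist)
  show "x \<le> y \<Longrightarrow> std_normal_cdf x \<le> std_normal_cdf y" by (rule cdf_nondecreasing)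
qed

text \<open>The density is even, so the sum of the values at w and -w has derivative 0; the constant
  is read off at +infinity.\<close>

lemma std_normal_cdf_minus: "std_normal_cdf (- x) = 1 - std_normal_cdf x"
proof -
  let ?c = "\<lambda>w. std_normal_cdf w + std_normal_cdf (- w)"
  have sym: "std_normal_density (- w) = std_normal_density w" for w
    by (simp add: std_normal_density_def)
  have "(?c has_real_derivative 0) (at w)" for w
    by (auto intro!: derivative_eq_intros simp: sym)
  then have const: "?c y = ?c x" for y
    using DERIV_isconst_all by blast
  have "filterlim (\<lambda>w::real. - w) at_bot at_top" by (simp add: filterlim_uminus_at_bot_at_top)
  then have "((\<lambda>w. std_normal_cdf (- w)) \<longlongrightarrow> 0) at_top"
    by (rule filterlim_compose[OF std_normal_cdf_tendsto(1)])
  then have "(?c \<longlongrightarrow> 1 + 0) at_top"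
    by (intro tendsto_add std_normal_cdf_tendsto)
  moreover have "(?c \<longlongrightarrow> ?c x) at_top"
    by (rule Lim_transform_eventually[OF tendsto_const], rule always_eventually, rule allI, rule const[symmetric])
  ultimately have "?c x = 1"
    by (metis add.right_neutral tendsto_unique trivial_limit_at_top_linorder)
  then show ?thesis by simp
qed

section \<open>Gaussian tail bounds through the Mills ratio\<close>

text \<open>Monotonicity carried in from -infinity: every earlier value is at most
  \<open>h x\<close>, and these values tend to 0. It turns a derivative computation into a tail
  bound.\<close>

lemma nonneg_of_tendsto_at_bot:
  fixes h :: "real \<Rightarrow> real"
  assumes "\<And>y. y \<le> x \<Longrightarrow> (h has_real_derivative h' y) (at y)" "\<And>y. y \<le> x \<Longrightarrow> 0 \<le> h' y"
    and "(h \<longlongrightarrow> 0) at_bot"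
  shows "0 \<le> h x"
proof (rule tendsto_le[OF _ tendsto_const assms(3)])
  show "eventually (\<lambda>y. h y \<le> h x) at_bot"
    using eventually_le_at_bot[of x]
    by eventually_elim (metis DERIV_nonneg_imp_nondecreasing assms(1,2))
qed simp

lemma std_normal_density_tendsto:
  "((\<lambda>w. std_normal_density w / w) \<longlongrightarrow> 0) at_bot"
  "((\<lambda>w. w * std_normal_density w / (1 + w\<^sup>2)) \<longlongrightarrow> 0) at_bot"
  unfolding std_normal_density_def by real_asymp+

text \<open>Mills ratio of the lower tail; at -x it is the usual (1 - Phi(x)) / phi(x).\<close>

definition mills :: "real \<Rightarrow> real" where
  "mills w = std_normal_cdf w / std_normal_density w"

lemma mills_nonneg: "0 \<le> mills w"
  by (simp add: mills_def std_normal_cdf_bounds)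

text \<open>At w = -x this is the tail bound x phi(x) / (1 + x^2) \<le> 1 - Phi(x). It is also
  exactly the sign of the derivative of \<open>w * mills w\<close>, which is what it serves
  for.\<close>

lemma mills_ge: "- w \<le> (1 + w\<^sup>2) * mills w"
proof -
  let ?h = "\<lambda>w. std_normal_cdf w + w * std_normal_density w / (1 + w\<^sup>2)"
  let ?h' = "\<lambda>w. 2 * std_normal_density w / (1 + w\<^sup>2)\<^sup>2"
  have pos: "1 + y\<^sup>2 > 0" for y :: real by (smt (verit) zero_le_power2)
  have "(?h has_real_derivative ?h' y) (at y)" for y
  proof -
    have nz: "1 + y\<^sup>2 \<noteq> 0" using pos[of y] by simp
    have "(?h has_real_derivative std_normal_density y +
       ((std_normal_density y + y * (- y * std_normal_density y)) * (1 + y\<^sup>2) - y * std_normal_density y * (2 * y))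
        / ((1 + y\<^sup>2) * (1 + y\<^sup>2))) (at y)"
      using nz by (auto intro!: derivative_eq_intros)
    also have "std_normal_density y +
       ((std_normal_density y + y * (- y * std_normal_density y)) * (1 + y\<^sup>2) - y * std_normal_density y * (2 * y))
        / ((1 + y\<^sup>2) * (1 + y\<^sup>2)) = ?h' y"
      using nz by (simp add: divide_simps power2_eq_square) (simp add: algebra_simps)
    finally show ?thesis .
  qed
  moreover have "(?h \<longlongrightarrow> 0 + 0) at_bot"
    by (intro tendsto_add std_normal_cdf_tendsto std_normal_density_tendsto)
  ultimately have "0 \<le> ?h w"
    by (intro nonneg_of_tendsto_at_bot[of w ?h ?h']) (auto simp: std_normal_density_gt0)
  then have "0 \<le> ((1 + w\<^sup>2) * std_normal_cdf w + w * std_normal_density w) / (1 + w\<^sup>2)"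
    using pos[of w] by (simp add: add_divide_distrib)
  then have "0 \<le> (1 + w\<^sup>2) * std_normal_cdf w + w * std_normal_density w"
    using pos[of w] by (simp add: zero_le_divide_iff)
  then show ?thesis
    using std_normal_density_gt0[of w] by (simp add: mills_def field_simps)
qed

text \<open>At w = -x < 0 this is the tail bound 1 - Phi(x) \<le> phi(x) / x; it is the sign of the
  derivative of \<open>mills\<close>.\<close>

lemma mult_mills_ge: "- 1 \<le> w * mills w"
proof (cases "w < 0")
  case True
  let ?h = "\<lambda>w. - (std_normal_density w / w) - std_normal_cdf w"
  let ?h' = "\<lambda>w. std_normal_density w / w\<^sup>2"
  have "(?h has_real_derivative ?h' y) (at y)" if "y \<le> w" for y
    using that True
    by (auto intro!: derivative_eq_intros simp: field_simps power2_eq_square)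
  moreover have "(?h \<longlongrightarrow> - 0 - 0) at_bot"
    by (intro tendsto_diff tendsto_minus std_normal_cdf_tendsto std_normal_density_tendsto)
  ultimately have "0 \<le> ?h w"
    by (intro nonneg_of_tendsto_at_bot[of w ?h ?h']) (auto simp: std_normal_density_gt0)
  then show ?thesis
    using std_normal_density_gt0[of w] True by (simp add: mills_def field_simps)
next
  case False
  then have "0 \<le> w * mills w"
    by (intro mult_nonneg_nonneg mills_nonneg) simp
  then show ?thesis by simp
qed

lemma DERIV_mills: "(mills has_real_derivative 1 + w * mills w) (at w)"
  unfolding mills_def using std_normal_density_gt0[of w]
  by (auto intro!: derivative_eq_intros simp: field_simps)

lemmas mills_derivs [derivative_intros] = DERIV_mills[THEN DERIV_chain2]

lemma mult_mills_mono: "x \<le> y \<Longrightarrow> x * mills x \<le> y * mills y"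
proof (rule DERIV_nonneg_imp_nondecreasing[where f = "\<lambda>w. w * mills w"])
  fix w
  have "((\<lambda>w. w * mills w) has_real_derivative mills w + w * (1 + w * mills w)) (at w)"
    by (auto intro!: derivative_eq_intros)
  moreover have "0 \<le> mills w + w * (1 + w * mills w)"
    using mills_ge[of w] by (simp add: algebra_simps power2_eq_square)
  ultimately show "\<exists>D. ((\<lambda>w. w * mills w) has_real_derivative D) (at w) \<and> 0 \<le> D"
    by blast
qed

lemma mills_mono: "x \<le> y \<Longrightarrow> mills x \<le> mills y"
proof (rule DERIV_nonneg_imp_nondecreasing[where f = mills])
  fix w
  have "0 \<le> 1 + w * mills w" using mult_mills_ge[of w] by simp
  then show "\<exists>D. (mills has_real_derivative D) (at w) \<and> 0 \<le> D"
    using DERIV_mills by blast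
qed

text \<open>Monotonicity leaves the value at 0, sqrt(2 pi) / 2, which pi < 4 rounds up generously.
  The 2 becomes the factor in front of the remainder \<open>U\<close>.\<close>

lemma mills_le_2: "w \<le> 0 \<Longrightarrow> mills w \<le> 2"
proof -
  assume "w \<le> 0"
  then have "mills w \<le> mills 0" by (rule mills_mono)
  also have "\<dots> = sqrt (2 * pi) / 2"
    using std_normal_cdf_minus[of 0] by (simp add: mills_def std_normal_density_def)
  also have "\<dots> \<le> sqrt 16 / 2"
    using pi_less_4 by (intro divide_right_mono real_sqrt_le_mono) auto
  finally show ?thesis by simp
qed

section \<open>The Stein solution for a half-line and its monotone pieces\<close>

text \<open>The bounded solution of f'(w) - w f(w) = 1{w \<le> z} - Phi(z), that is Phi(min w z) (1
  - Phi(max w z)) / phi(w), written with a Mills ratio on either side of z.\<close>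

definition stein_sol :: "real \<Rightarrow> real \<Rightarrow> real" where
  "stein_sol z w = (if w \<le> z then (1 - std_normal_cdf z) * mills w else std_normal_cdf z * mills (- w))"

text \<open>Stein's equation itself is the definition, so that integrating it later is pure algebra.
  At the kink w = z it selects the left derivative.\<close>

definition stein_deriv :: "real \<Rightarrow> real \<Rightarrow> real" where
  "stein_deriv z w = w * stein_sol z w + (if w \<le> z then 1 else 0) - std_normal_cdf z"

text \<open>The derivative of the Stein solution is the difference of a nondecreasing function and a
  nondecreasing step; the function below is their sum, centred to be bounded by \<open>1\<close>.\<close>
definition stein_var :: "real \<Rightarrow> real \<Rightarrow> real" where
  "stein_var z w = w * stein_sol z w + (if w \<le> z then 0 else 1) - std_normal_cdf z"

text \<open>The branches meet at z because the density is even. Holding for every real number, the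
  identity also trades \<open>mills w\<close> for \<open>mills (- w)\<close>.\<close>

lemma stein_sol_glue: "(1 - std_normal_cdf z) * mills z = std_normal_cdf z * mills (- z)"
  using std_normal_cdf_minus[of z] by (simp add: mills_def std_normal_density_def)

lemma stein_sol_left: "w \<le> z \<Longrightarrow> stein_sol z w = (1 - std_normal_cdf z) * mills w"
  and stein_sol_right: "z \<le> w \<Longrightarrow> stein_sol z w = std_normal_cdf z * mills (- w)"
  using stein_sol_glue[of z] by (auto simp: stein_sol_def)

text \<open>The bound on \<open>mills\<close> is available at nonpositive arguments. If the argument
  is positive, the factor in front is enlarged to its value at \<open>w\<close>, and
  \<open>stein_sol_glue\<close> at \<open>w\<close> then flips the sign of the argument.\<close>

lemma abs_stein_sol_le: "\<bar>stein_sol z w\<bar> \<le> 2"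
proof -
  note b = std_normal_cdf_bounds[of z]
  have pos: "0 \<le> stein_sol z w"
    using b by (auto simp: stein_sol_def intro!: mult_nonneg_nonneg mills_nonneg)
  have swap: "(1 - std_normal_cdf w) * mills w = std_normal_cdf w * mills (- w)" for w
    by (rule stein_sol_glue)
  have le1: "a * c \<le> 2" if "0 \<le> a" "a \<le> 1" "0 \<le> c" "c \<le> 2" for a c :: real
    using mult_mono[OF that(2,4)] that by simp
  consider "w \<le> z" "w \<le> 0" | "w \<le> z" "0 \<le> w" | "z < w" "0 \<le> w" | "z < w" "w \<le> 0" by linarith
  then have "stein_sol z w \<le> 2"
  proof cases
    case 1
    then show ?thesis using b by (simp add: stein_sol_left le1 mills_nonneg mills_le_2)
  next
    case 2
    have "stein_sol z w \<le> (1 - std_normal_cdf w) * mills w"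
      using 2 by (simp add: stein_sol_left mult_right_mono mills_nonneg std_normal_cdf_mono)
    also have "\<dots> \<le> 2"
      unfolding swap using std_normal_cdf_bounds[of w] 2 by (simp add: le1 mills_nonneg mills_le_2)
    finally show ?thesis .
  next
    case 3
    then show ?thesis using b by (simp add: stein_sol_right le1 mills_nonneg mills_le_2)
  next
    case 4
    have "stein_sol z w \<le> std_normal_cdf w * mills (- w)"
      using 4 by (simp add: stein_sol_right mult_right_mono mills_nonneg std_normal_cdf_mono)
    also have "\<dots> \<le> 2"
      unfolding swap[symmetric] using std_normal_cdf_bounds[of w] 4 by (simp add: le1 mills_nonneg mills_le_2)
    finally show ?thesis .
  qed
  with pos show ?thesis by simp
qed

lemma left_piece_mono:
  assumes "x \<le> y"
  shows "x * ((1 - std_normal_cdf z) * mills x) \<le> y * ((1 - std_normal_cdf z) * mills y)"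
  using mult_left_mono[OF mult_mills_mono[OF assms], of "1 - std_normal_cdf z"] std_normal_cdf_bounds[of z]
  by (simp add: mult.left_commute)

lemma right_piece_mono:
  assumes "x \<le> y"
  shows "x * (std_normal_cdf z * mills (- x)) \<le> y * (std_normal_cdf z * mills (- y))"
  using mult_left_mono[OF mult_mills_mono[of "- y" "- x"], of "std_normal_cdf z"] assms std_normal_cdf_bounds[of z]
  by (simp add: mult.left_commute)

text \<open>Both branches are nondecreasing and they agree at z, so a pair straddling z is compared
  through z.\<close>

lemma mult_stein_sol_mono:
  assumes "x \<le> y" shows "x * stein_sol z x \<le> y * stein_sol z y"
proof -
  consider "y \<le> z" | "z \<le> x" | "x \<le> z" "z \<le> y" using assms by linarith
  then show ?thesis
  proof cases
    case 1
    then show ?thesis using assms left_piece_mono[OF assms] by (simp add: stein_sol_left)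
  next
    case 2
    then show ?thesis using assms right_piece_mono[OF assms] by (simp add: stein_sol_right)
  next
    case 3
    have "x * stein_sol z x \<le> z * stein_sol z z"
      using left_piece_mono[OF 3(1)] 3 by (simp add: stein_sol_left)
    also have "\<dots> \<le> y * stein_sol z y"
      using right_piece_mono[OF 3(2)] 3 by (simp add: stein_sol_right)
    finally show ?thesis .
  qed
qed

text \<open>The left branch gives the lower bound, the right branch the upper one; monotonicity
  carries each across z by way of \<open>min w z\<close> and \<open>max w z\<close>.\<close>

lemma mult_stein_sol_bounds:
  "std_normal_cdf z - 1 \<le> w * stein_sol z w" "w * stein_sol z w \<le> std_normal_cdf z"
proof -
  note b = std_normal_cdf_bounds[of z]
  have left: "std_normal_cdf z - 1 \<le> y * stein_sol z y" if "y \<le> z" for y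
    using that mult_left_mono[OF mult_mills_ge[of y], of "1 - std_normal_cdf z"] b
    by (simp add: stein_sol_left mult.left_commute)
  have right: "y * stein_sol z y \<le> std_normal_cdf z" if "z \<le> y" for y
    using that mult_left_mono[OF mult_mills_ge[of "- y"], of "std_normal_cdf z"] b
    by (simp add: stein_sol_right mult.left_commute)
  show "std_normal_cdf z - 1 \<le> w * stein_sol z w"
    using left[of "min w z"] mult_stein_sol_mono[of "min w z" w z] by simp
  show "w * stein_sol z w \<le> std_normal_cdf z"
    using right[of "max w z"] mult_stein_sol_mono[of w "max w z" z] by simp
qed

text \<open>By the preceding bounds the values lie in [0, 1] for w \<le> z and in [-1, 0] beyond;
  for \<open>stein_var\<close> the two ranges are interchanged.\<close>

lemma abs_stein_deriv_le: "\<bar>stein_deriv z w\<bar> \<le> 1"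
  using mult_stein_sol_bounds[where w = w and z = z] std_normal_cdf_bounds[of z]
  unfolding stein_deriv_def abs_le_iff by (cases "w \<le> z") (simp_all only: if_True if_False, linarith+)

lemma abs_stein_var_le: "\<bar>stein_var z w\<bar> \<le> 1"
  using mult_stein_sol_bounds[where w = w and z = z] std_normal_cdf_bounds[of z]
  unfolding stein_var_def abs_le_iff by (cases "w \<le> z") (simp_all only: if_True if_False, linarith+)

text \<open>The increment is the integral of \<open>stein_deriv\<close>. On [x, y] the term
  \<open>w * stein_sol z w\<close> is smallest at x and the indicator of w \<le> z is smallest at y,
  so mixing the endpoints in this way bounds the integrand from below; the opposite mix bounds it
  from above. The mean value theorem is applied on each side of z.\<close>

lemma stein_sol_increment:
  assumes "x \<le> y"
  shows "(y - x) * (x * stein_sol z x + (if y \<le> z then 1 else 0) - std_normal_cdf z)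
           \<le> stein_sol z y - stein_sol z x"
    and "stein_sol z y - stein_sol z x
           \<le> (y - x) * (y * stein_sol z y + (if x \<le> z then 1 else 0) - std_normal_cdf z)"
proof -
  let ?P = "std_normal_cdf z" and ?g = "\<lambda>w. w * stein_sol z w"
  have left: "(y - x) * (?g x + 1 - ?P) \<le> stein_sol z y - stein_sol z x \<and>
      stein_sol z y - stein_sol z x \<le> (y - x) * (?g y + 1 - ?P)" if "x \<le> y" "y \<le> z" for x y
  proof (cases "x = y")
    case False
    then have "x < y" using that by simp
    have "((\<lambda>w. (1 - ?P) * mills w) has_real_derivative (1 - ?P) * (1 + c * mills c)) (at c)" for c
      by (rule DERIV_cmult[OF DERIV_mills])
    from MVT2[OF \<open>x < y\<close> this] obtain c where c: "x < c" "c < y"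
      "(1 - ?P) * mills y - (1 - ?P) * mills x = (y - x) * ((1 - ?P) * (1 + c * mills c))"
      by blast
    have "stein_sol z y - stein_sol z x = (y - x) * (?g c + 1 - ?P)"
      using c that by (simp add: stein_sol_left algebra_simps)
    moreover have "?g x \<le> ?g c" "?g c \<le> ?g y"
      using c by (auto intro!: mult_stein_sol_mono)
    ultimately show ?thesis using that by (auto intro!: mult_left_mono)
  qed simp
  have right: "(y - x) * (?g x - ?P) \<le> stein_sol z y - stein_sol z x \<and>
      stein_sol z y - stein_sol z x \<le> (y - x) * (?g y - ?P)" if "x \<le> y" "z \<le> x" for x y
  proof (cases "x = y")
    case False
    then have "x < y" using that by simp
    have "((\<lambda>w. ?P * mills (- w)) has_real_derivative ?P * - (1 + - c * mills (- c))) (at c)" for c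
    proof (rule DERIV_cmult)
      have "((\<lambda>w. mills (- w)) has_real_derivative (1 + - c * mills (- c)) * - 1) (at c)"
        by (rule DERIV_chain2[OF DERIV_mills]) (auto intro!: derivative_eq_intros)
      then show "((\<lambda>w. mills (- w)) has_real_derivative - (1 + - c * mills (- c))) (at c)"
        by simp
    qed
    from MVT2[OF \<open>x < y\<close> this] obtain c where c: "x < c" "c < y"
      "?P * mills (- y) - ?P * mills (- x) = (y - x) * (?P * - (1 + - c * mills (- c)))"
      by blast
    have "stein_sol z y - stein_sol z x = (y - x) * (?g c - ?P)"
      using c that by (simp add: stein_sol_right algebra_simps)
    moreover have "?g x \<le> ?g c" "?g c \<le> ?g y"
      using c by (auto intro!: mult_stein_sol_mono)
    ultimately show ?thesis using that by (auto intro!: mult_left_mono)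
  qed simp
  consider "y \<le> z" | "x \<le> z" "z < y" | "z < x" by linarith
  then have "(y - x) * (?g x + (if y \<le> z then 1 else 0) - ?P) \<le> stein_sol z y - stein_sol z x \<and>
    stein_sol z y - stein_sol z x \<le> (y - x) * (?g y + (if x \<le> z then 1 else 0) - ?P)"
  proof cases
    case 1
    then show ?thesis using left[of x y] assms by simp
  next
    case 2
    have "?g x \<le> ?g z" "?g z \<le> ?g y" using 2 by (auto intro!: mult_stein_sol_mono)
    then have m: "(y - z) * ?g x \<le> (y - z) * ?g z" "(z - x) * ?g z \<le> (z - x) * ?g y"
      using 2 by (auto intro!: mult_left_mono)
    from left[of x z] right[of z y] m 2 show ?thesis by (simp add: algebra_simps)
  next
    case 3
    then show ?thesis using right[of x y] assms by simp
  qed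
  then show "(y - x) * (?g x + (if y \<le> z then 1 else 0) - ?P) \<le> stein_sol z y - stein_sol z x"
    and "stein_sol z y - stein_sol z x \<le> (y - x) * (?g y + (if x \<le> z then 1 else 0) - ?P)"
    by auto
qed

text \<open>For x \<le> y the two bounds of \<open>stein_sol_increment\<close> lie exactly half of
  (y - x) times the increment of \<open>stein_var\<close> below and above the trapezoidal value.
  Both sides are invariant under exchanging x and y, so either order is covered.\<close>

lemma stein_trapezoid:
  "\<bar>stein_sol z x - stein_sol z y - (x - y) * (stein_deriv z x + stein_deriv z y) / 2\<bar>
     \<le> (x - y) * (stein_var z x - stein_var z y) / 2"
proof -
  have *: "\<bar>stein_sol z y - stein_sol z x - (y - x) * (stein_deriv z y + stein_deriv z x) / 2\<bar>
     \<le> (y - x) * (stein_var z y - stein_var z x) / 2" if "x \<le> y" for x y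
  proof -
    have "(y - x) * (stein_deriv z y + stein_deriv z x) / 2 - (y - x) * (stein_var z y - stein_var z x) / 2
       = (y - x) * (x * stein_sol z x + (if y \<le> z then 1 else 0) - std_normal_cdf z)"
      using that by (auto simp: stein_deriv_def stein_var_def field_simps)
    moreover have "(y - x) * (stein_deriv z y + stein_deriv z x) / 2 + (y - x) * (stein_var z y - stein_var z x) / 2
       = (y - x) * (y * stein_sol z y + (if x \<le> z then 1 else 0) - std_normal_cdf z)"
      using that by (auto simp: stein_deriv_def stein_var_def field_simps)
    ultimately show ?thesis
      using stein_sol_increment[OF that, of z] unfolding abs_le_iff by linarith
  qed
  show ?thesis
  proof (cases "x \<le> y")
    case True
    have "\<bar>stein_sol z x - stein_sol z y - (x - y) * (stein_deriv z x + stein_deriv z y) / 2\<bar>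
      = \<bar>stein_sol z y - stein_sol z x - (y - x) * (stein_deriv z y + stein_deriv z x) / 2\<bar>"
      by (simp add: abs_if field_simps)
    also have "\<dots> \<le> (y - x) * (stein_var z y - stein_var z x) / 2" by (rule *[OF True])
    finally show ?thesis by (simp add: field_simps)
  qed (use * in auto)
qed

lemma stein_measurable [measurable]:
  "stein_sol z \<in> borel_measurable borel" "stein_deriv z \<in> borel_measurable borel"
  "stein_var z \<in> borel_measurable borel"
proof -
  have "continuous_on UNIV mills"
    by (auto intro!: DERIV_continuous_on DERIV_mills)
  then have [measurable]: "mills \<in> borel_measurable borel" by (rule borel_measurable_continuous_onI)
  show [measurable]: "stein_sol z \<in> borel_measurable borel"
    unfolding stein_sol_def[abs_def] by measurable
  show "stein_deriv z \<in> borel_measurable borel" "stein_var z \<in> borel_measurable borel"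
    unfolding stein_deriv_def[abs_def] stein_var_def[abs_def] by measurable
qed

section \<open>Square-integrable functions and products\<close>

lemma power2_diff_le: "(x - y)\<^sup>2 \<le> 2 * x\<^sup>2 + 2 * y\<^sup>2" for x y :: real
  using zero_le_power2[of "x + y"] unfolding power2_sum power2_diff by linarith

lemma power4_diff_le: "(x - y) ^ 4 \<le> 8 * x ^ 4 + 8 * y ^ 4" for x y :: real
proof -
  have "((x - y)\<^sup>2)\<^sup>2 \<le> (2 * x\<^sup>2 + 2 * y\<^sup>2)\<^sup>2"
    by (intro power_mono power2_diff_le) auto
  also have "\<dots> \<le> 8 * (x\<^sup>2)\<^sup>2 + 8 * (y\<^sup>2)\<^sup>2"
    using zero_le_power2[of "x\<^sup>2 - y\<^sup>2"] unfolding power2_sum power2_diff power_mult_distrib by simp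
  finally show ?thesis by simp
qed

definition sq_integrable :: "'a measure \<Rightarrow> ('a \<Rightarrow> real) \<Rightarrow> bool" where
  "sq_integrable N f \<longleftrightarrow> f \<in> borel_measurable N \<and> integrable N (\<lambda>x. (f x)\<^sup>2)"

lemma sq_integrableD [dest]:
  assumes "sq_integrable N f"
  shows "f \<in> borel_measurable N" "integrable N (\<lambda>x. (f x)\<^sup>2)"
  using assms by (auto simp: sq_integrable_def)

lemma sq_integrable_mult:
  assumes "sq_integrable N f" "sq_integrable N g"
  shows "integrable N (\<lambda>x. f x * g x)"
proof (rule Bochner_Integration.integrable_bound)
  have [measurable]: "f \<in> borel_measurable N" "g \<in> borel_measurable N"
    using assms by auto
  show "integrable N (\<lambda>x. (f x)\<^sup>2 + (g x)\<^sup>2)"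
    using assms by (intro Bochner_Integration.integrable_add) auto
  show "(\<lambda>x. f x * g x) \<in> borel_measurable N" by measurable
  have "\<bar>a * b\<bar> \<le> a\<^sup>2 + b\<^sup>2" for a b :: real
  proof -
    have "2 * (\<bar>a\<bar> * \<bar>b\<bar>) \<le> a\<^sup>2 + b\<^sup>2"
      using zero_le_power2[of "\<bar>a\<bar> - \<bar>b\<bar>"] by (simp add: power2_diff)
    moreover have "0 \<le> \<bar>a\<bar> * \<bar>b\<bar>" by simp
    ultimately show ?thesis unfolding abs_mult by linarith
  qed
  then show "AE x in N. norm (f x * g x) \<le> norm ((f x)\<^sup>2 + (g x)\<^sup>2)"
    by (intro always_eventually allI) (metis abs_of_nonneg add_nonneg_nonneg real_norm_def zero_le_power2)
qed

lemma sq_integrable_abs: "sq_integrable N f \<Longrightarrow> sq_integrable N (\<lambda>x. \<bar>f x\<bar>)"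
  by (auto simp: sq_integrable_def)

lemma sq_integrable_abs_mult:
  "sq_integrable N f \<Longrightarrow> sq_integrable N g \<Longrightarrow> integrable N (\<lambda>x. \<bar>f x * g x\<bar>)"
  by (rule integrable_abs[OF sq_integrable_mult])

lemma sq_integrable_add:
  assumes "sq_integrable N f" "sq_integrable N g"
  shows "sq_integrable N (\<lambda>x. f x + g x)"
proof -
  have [measurable]: "f \<in> borel_measurable N" "g \<in> borel_measurable N"
    using assms by auto
  have "integrable N (\<lambda>x. (f x)\<^sup>2 + (g x)\<^sup>2 + 2 * (f x * g x))"
    using assms by (intro Bochner_Integration.integrable_add integrable_mult_right sq_integrable_mult) auto
  then show ?thesis
    unfolding sq_integrable_def by (simp add: power2_sum mult.assoc)
qed

lemma sq_integrable_cmult: "sq_integrable N f \<Longrightarrow> sq_integrable N (\<lambda>x. c * f x)"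
  by (auto simp: sq_integrable_def power_mult_distrib)

lemma sq_integrable_diff:
  assumes "sq_integrable N f" "sq_integrable N g"
  shows "sq_integrable N (\<lambda>x. f x - g x)"
  using sq_integrable_add[OF assms(1) sq_integrable_cmult[OF assms(2), of "-1"]] by simp

lemma sq_integrable_sum:
  "(\<And>i. i \<in> A \<Longrightarrow> sq_integrable N (f i)) \<Longrightarrow> sq_integrable N (\<lambda>x. \<Sum>i\<in>A. f i x)"
  by (induction A rule: infinite_finite_induct) (auto simp: sq_integrable_add, auto simp: sq_integrable_def)

lemma integrable_bounded_mult:
  fixes f g :: "'a \<Rightarrow> real"
  assumes "integrable N f" "g \<in> borel_measurable N" "\<And>x. \<bar>g x\<bar> \<le> c"
  shows "integrable N (\<lambda>x. f x * g x)"
proof (rule Bochner_Integration.integrable_bound)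
  show "integrable N (\<lambda>x. c * f x)" using assms by simp
  have "0 \<le> c" using assms(3) by (meson abs_ge_zero order_trans)
  then show "AE x in N. norm (f x * g x) \<le> norm (c * f x)"
    using assms(3) by (intro AE_I2) (simp add: abs_mult mult.commute[of c] mult_left_mono)
qed (use assms in measurable)

lemma abs_integral_mult_le:
  fixes f g :: "'a \<Rightarrow> real"
  assumes "integrable N f" "\<And>x. \<bar>g x\<bar> \<le> 1"
  shows "\<bar>\<integral>x. f x * g x \<partial>N\<bar> \<le> (\<integral>x. \<bar>f x\<bar> \<partial>N)"
proof (cases "integrable N (\<lambda>x. f x * g x)")
  case True
  have "\<bar>\<integral>x. f x * g x \<partial>N\<bar> \<le> (\<integral>x. \<bar>f x * g x\<bar> \<partial>N)" by (rule integral_abs_bound)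
  also have "\<dots> \<le> (\<integral>x. \<bar>f x\<bar> \<partial>N)"
    using assms integrable_abs[OF True]
    by (intro integral_mono) (auto simp: abs_mult intro: mult_left_le)
  finally show ?thesis .
next
  case False
  \<comment> \<open>The Bochner integral of a non-integrable product is 0 by convention.\<close>
  then show ?thesis by (simp add: not_integrable_integral_eq)
qed

lemma Cauchy_Schwarz_integral:
  assumes "sq_integrable N f" "sq_integrable N g"
  shows "(\<integral>x. \<bar>f x * g x\<bar> \<partial>N) \<le> sqrt ((\<integral>x. (f x)\<^sup>2 \<partial>N) * (\<integral>x. (g x)\<^sup>2 \<partial>N))"
proof -
  have [measurable]: "f \<in> borel_measurable N" "g \<in> borel_measurable N"
    using assms by auto
  have nn: "(\<integral>\<^sup>+x. ennreal (u x) \<partial>N) = ennreal (integral\<^sup>L N u)"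
    if "integrable N u" "\<And>x. 0 \<le> u x" for u
    using that by (intro nn_integral_eq_integral) auto
  have "(\<integral>\<^sup>+x. ennreal \<bar>f x\<bar> * ennreal \<bar>g x\<bar> \<partial>N)\<^sup>2
      \<le> (\<integral>\<^sup>+x. (ennreal \<bar>f x\<bar>)\<^sup>2 \<partial>N) * (\<integral>\<^sup>+x. (ennreal \<bar>g x\<bar>)\<^sup>2 \<partial>N)"
    by (rule Cauchy_Schwarz_nn_integral) auto
  also have "(\<integral>\<^sup>+x. ennreal \<bar>f x\<bar> * ennreal \<bar>g x\<bar> \<partial>N) = ennreal (\<integral>x. \<bar>f x * g x\<bar> \<partial>N)"
    using sq_integrable_abs_mult[OF assms] by (subst nn[symmetric]) (auto simp: abs_mult ennreal_mult)
  also have "(\<integral>\<^sup>+x. (ennreal \<bar>f x\<bar>)\<^sup>2 \<partial>N) = ennreal (\<integral>x. (f x)\<^sup>2 \<partial>N)"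
    using assms by (subst nn[symmetric]) (auto simp: ennreal_power)
  also have "(\<integral>\<^sup>+x. (ennreal \<bar>g x\<bar>)\<^sup>2 \<partial>N) = ennreal (\<integral>x. (g x)\<^sup>2 \<partial>N)"
    using assms by (subst nn[symmetric]) (auto simp: ennreal_power)
  finally have "(\<integral>x. \<bar>f x * g x\<bar> \<partial>N)\<^sup>2 \<le> (\<integral>x. (f x)\<^sup>2 \<partial>N) * (\<integral>x. (g x)\<^sup>2 \<partial>N)"
    by (simp add: ennreal_power ennreal_mult[symmetric])
  then show ?thesis by (rule real_le_rsqrt)
qed

context prob_space begin

lemma sq_integrable_const: "sq_integrable M (\<lambda>x. c)"
  by (simp add: sq_integrable_def)

lemma sq_integrable_imp_integrable: "sq_integrable M f \<Longrightarrow> integrable M f"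
  using sq_integrable_mult[OF _ sq_integrable_const[of 1]] by simp

lemma expectation_abs_le: "sq_integrable M f \<Longrightarrow> expectation (\<lambda>x. \<bar>f x\<bar>) \<le> sqrt (expectation (\<lambda>x. (f x)\<^sup>2))"
  using Cauchy_Schwarz_integral[OF _ sq_integrable_const[of 1]] by (simp add: prob_space)

lemma expectation_power2_le:
  assumes "sq_integrable M f"
  shows "(expectation f)\<^sup>2 \<le> expectation (\<lambda>x. (f x)\<^sup>2)"
proof -
  have "\<bar>expectation f\<bar> \<le> expectation (\<lambda>x. \<bar>f x\<bar>)" by (rule integral_abs_bound)
  also note expectation_abs_le[OF assms]
  finally show ?thesis
    by (metis abs_ge_zero power2_abs power_mono real_sqrt_pow2 Bochner_Integration.integral_nonneg zero_le_power2)
qed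

lemma sq_integrable_of_power4:
  assumes [measurable]: "f \<in> borel_measurable M" and "integrable M (\<lambda>x. (f x) ^ 4)"
  shows "sq_integrable M f" "sq_integrable M (\<lambda>x. (f x)\<^sup>2)"
proof -
  have eq: "((f x)\<^sup>2)\<^sup>2 = f x ^ 4" for x by simp
  \<comment> \<open>The square comes first: lying in L2 of a probability space it is integrable, and
    that is square-integrability of \<open>f\<close>.\<close>
  show sq: "sq_integrable M (\<lambda>x. (f x)\<^sup>2)"
    unfolding sq_integrable_def eq using assms by simp
  then have "integrable M (\<lambda>x. (f x)\<^sup>2)" by (rule sq_integrable_imp_integrable)
  then show "sq_integrable M f" by (simp add: sq_integrable_def)
qed

end

section \<open>Redrawing one coordinate of a product: the exchangeable pair\<close>

context finite_product_prob_space begin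

lemma measurable_resample:
  assumes "p \<in> I"
  shows "(\<lambda>(w, t). w(p := t)) \<in> PiM I M \<Otimes>\<^sub>M M p \<rightarrow>\<^sub>M PiM I M"
proof -
  have "(\<lambda>x. (fst x)(p := snd x)) \<in> PiM I M \<Otimes>\<^sub>M M p \<rightarrow>\<^sub>M PiM I M"
    using assms by (intro measurable_fun_upd[where J = I]) auto
  then show ?thesis by (simp add: case_prod_beta')
qed

text \<open>The joint law of a configuration and its copy with coordinate \<open>p\<close> redrawn
  independently. It lives on pairs of configurations, so exchangeability is invariance under the
  swap, and the fresh value is read off as coordinate \<open>p\<close> of the second
  component.\<close>

definition exch_pair :: "'a \<Rightarrow> (('a \<Rightarrow> 'b) \<times> ('a \<Rightarrow> 'b)) measure" where
  "exch_pair p = distr (PiM I M \<Otimes>\<^sub>M M p) (PiM I M \<Otimes>\<^sub>M PiM I M) (\<lambda>(w, t). (w, w(p := t)))"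

lemma measurable_exch:
  assumes "p \<in> I"
  shows "(\<lambda>(w, t). (w, w(p := t))) \<in> PiM I M \<Otimes>\<^sub>M M p \<rightarrow>\<^sub>M PiM I M \<Otimes>\<^sub>M PiM I M"
  using measurable_resample[OF assms] by (simp add: case_prod_beta' measurable_Pair)

lemma sets_exch_pair [measurable_cong, simp]: "sets (exch_pair p) = sets (PiM I M \<Otimes>\<^sub>M PiM I M)"
  by (simp add: exch_pair_def)

lemma prob_space_exch_pair: "p \<in> I \<Longrightarrow> prob_space (exch_pair p)"
  unfolding exch_pair_def
  by (rule prob_space.prob_space_distr[OF prob_space_pair[OF P.prob_space_axioms prob_space] measurable_exch])

text \<open>With the other coordinates frozen at x, the pair is given by two independent values s
  and t at \<open>p\<close>. In this form the two components play equal roles up to the order of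
  integration.\<close>

lemma emeasure_exch_pair:
  assumes p: "p \<in> I" and A [measurable]: "A \<in> sets (PiM I M \<Otimes>\<^sub>M PiM I M)"
  shows "emeasure (exch_pair p) A
    = (\<integral>\<^sup>+x. \<integral>\<^sup>+s. \<integral>\<^sup>+t. indicator A (x(p := s), x(p := t)) \<partial>M p \<partial>M p \<partial>PiM (I - {p}) M)"
proof -
  note [measurable] = measurable_exch[OF p]
  have ins: "insert p (I - {p}) = I" using p by auto
  have [measurable]: "(\<lambda>(w, t). indicator A (w, w(p := t)) :: ennreal) \<in> borel_measurable (PiM I M \<Otimes>\<^sub>M M p)"
    using measurable_compose[OF measurable_exch[OF p] borel_measurable_indicator[OF A]]
    by (simp add: case_prod_beta')
  have "emeasure (exch_pair p) A = (\<integral>\<^sup>+v. indicator A v \<partial>exch_pair p)"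
    by simp
  also have "\<dots> = (\<integral>\<^sup>+v. (case v of (w, t) \<Rightarrow> indicator A (w, w(p := t))) \<partial>(PiM I M \<Otimes>\<^sub>M M p))"
    unfolding exch_pair_def by (subst nn_integral_distr) (auto simp: case_prod_beta')
  also have "\<dots> = (\<integral>\<^sup>+w. \<integral>\<^sup>+t. indicator A (w, w(p := t)) \<partial>M p \<partial>PiM I M)"
    by (subst sigma_finite_measure.nn_integral_fst[OF sigma_finite_measures, symmetric]) auto
  also have "\<dots> = (\<integral>\<^sup>+w. \<integral>\<^sup>+t. indicator A (w, w(p := t)) \<partial>M p \<partial>PiM (insert p (I - {p})) M)"
    unfolding ins ..
  also have "\<dots> = (\<integral>\<^sup>+x. \<integral>\<^sup>+s. \<integral>\<^sup>+t. indicator A (x(p := s), x(p := t)) \<partial>M p \<partial>M p \<partial>PiM (I - {p}) M)"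
  proof (subst product_nn_integral_insert)
    show "(\<lambda>w. \<integral>\<^sup>+t. indicator A (w, w(p := t)) \<partial>M p) \<in> borel_measurable (PiM (insert p (I - {p})) M)"
      unfolding ins by (rule sigma_finite_measure.borel_measurable_nn_integral[OF sigma_finite_measures]) fact
  qed (simp_all only: finite_index finite_Diff fun_upd_upd, simp)
  finally show ?thesis .
qed

text \<open>By \<open>emeasure_exch_pair\<close> the swap merely interchanges the two inner
  integrals, which commute by Fubini.\<close>

lemma distr_exch_pair_swap:
  assumes p: "p \<in> I"
  shows "distr (exch_pair p) (PiM I M \<Otimes>\<^sub>M PiM I M) (\<lambda>(a, b). (b, a)) = exch_pair p" (is "?L = _")
proof (rule measure_eqI)
  fix A assume "A \<in> sets ?L"
  then have A [measurable]: "A \<in> sets (PiM I M \<Otimes>\<^sub>M PiM I M)" by simp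
  let ?A = "(\<lambda>(a, b). (b, a)) -` A \<inter> space (PiM I M \<Otimes>\<^sub>M PiM I M)"
  have A' [measurable]: "?A \<in> sets (PiM I M \<Otimes>\<^sub>M PiM I M)" by measurable
  interpret Mp: pair_sigma_finite "M p" "M p" by unfold_locales
  have "emeasure ?L A = emeasure (exch_pair p) ?A"
    using sets_eq_imp_space_eq[OF sets_exch_pair[of p]] by (subst emeasure_distr) auto
  also have "\<dots> = (\<integral>\<^sup>+x. \<integral>\<^sup>+s. \<integral>\<^sup>+t. indicator ?A (x(p := s), x(p := t)) \<partial>M p \<partial>M p \<partial>PiM (I - {p}) M)"
    by (rule emeasure_exch_pair[OF p A'])
  also have "\<dots> = (\<integral>\<^sup>+x. \<integral>\<^sup>+s. \<integral>\<^sup>+t. indicator A (x(p := t), x(p := s)) \<partial>M p \<partial>M p \<partial>PiM (I - {p}) M)"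
    using p
    by (intro nn_integral_cong)
      (auto simp: indicator_def space_pair_measure space_PiM PiE_def extensional_def)
  also have "\<dots> = (\<integral>\<^sup>+x. \<integral>\<^sup>+s. \<integral>\<^sup>+t. indicator A (x(p := s), x(p := t)) \<partial>M p \<partial>M p \<partial>PiM (I - {p}) M)"
  proof (rule nn_integral_cong)
    fix x assume x: "x \<in> space (PiM (I - {p}) M)"
    have "(\<lambda>s. x(p := s)) \<in> M p \<rightarrow>\<^sub>M PiM I M"
      using measurable_component_update[OF x, of p] p by (simp add: insert_absorb)
    then have [measurable]: "(\<lambda>(s, t). (x(p := s), x(p := t))) \<in> M p \<Otimes>\<^sub>M M p \<rightarrow>\<^sub>M PiM I M \<Otimes>\<^sub>M PiM I M"
      unfolding case_prod_beta' by measurable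
    have "(\<lambda>(s, t). indicator A (x(p := s), x(p := t)) :: ennreal) \<in> borel_measurable (M p \<Otimes>\<^sub>M M p)"
      using measurable_compose[OF \<open>(\<lambda>(s, t). (x(p := s), x(p := t))) \<in> _\<close> borel_measurable_indicator[OF A]]
      by (simp add: case_prod_beta')
    from Mp.Fubini'[OF this]
    show "(\<integral>\<^sup>+s. \<integral>\<^sup>+t. indicator A (x(p := t), x(p := s)) \<partial>M p \<partial>M p)
      = (\<integral>\<^sup>+s. \<integral>\<^sup>+t. indicator A (x(p := s), x(p := t)) \<partial>M p \<partial>M p)" .
  qed
  also have "\<dots> = emeasure (exch_pair p) A"
    by (rule emeasure_exch_pair[OF p A, symmetric])
  finally show "emeasure ?L A = emeasure (exch_pair p) A" .
qed simp

lemma integral_exch_pair_swap: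
  fixes H :: "_ \<Rightarrow> real"
  assumes p: "p \<in> I" and [measurable]: "H \<in> borel_measurable (PiM I M \<Otimes>\<^sub>M PiM I M)"
  shows "(\<integral>v. H (snd v, fst v) \<partial>exch_pair p) = (\<integral>v. H v \<partial>exch_pair p)"
proof -
  have "(\<integral>v. H v \<partial>exch_pair p) = (\<integral>v. H v \<partial>distr (exch_pair p) (PiM I M \<Otimes>\<^sub>M PiM I M) (\<lambda>(a, b). (b, a)))"
    by (simp only: distr_exch_pair_swap[OF p])
  also have "\<dots> = (\<integral>v. H (snd v, fst v) \<partial>exch_pair p)"
    by (subst integral_distr) (auto simp: case_prod_beta')
  finally show ?thesis ..
qed

lemma distr_exch_pair_fst: "p \<in> I \<Longrightarrow> distr (exch_pair p) (PiM I M) fst = PiM I M"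
proof -
  assume p: "p \<in> I"
  have "distr (exch_pair p) (PiM I M) fst = distr (PiM I M \<Otimes>\<^sub>M M p) (PiM I M) (fst \<circ> (\<lambda>(w, t). (w, w(p := t))))"
    unfolding exch_pair_def by (rule distr_distr) (auto intro: measurable_exch[OF p])
  also have "fst \<circ> (\<lambda>(w, t). (w, w(p := t))) = (fst :: _ \<times> 'b \<Rightarrow> _)" by auto
  also have "distr (PiM I M \<Otimes>\<^sub>M M p) (PiM I M) fst = PiM I M"
    by (rule prob_space.distr_pair_fst[OF prob_space])
  finally show ?thesis .
qed

lemma distr_exch_pair_snd:
  assumes p: "p \<in> I" shows "distr (exch_pair p) (PiM I M) snd = PiM I M"
proof -
  have swap: "snd \<circ> (\<lambda>(a, b). (b, a)) = (fst :: _ \<times> ('a \<Rightarrow> 'b) \<Rightarrow> _)" by auto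
  have "distr (exch_pair p) (PiM I M) snd
    = distr (distr (exch_pair p) (PiM I M \<Otimes>\<^sub>M PiM I M) (\<lambda>(a, b). (b, a))) (PiM I M) snd"
    by (simp only: distr_exch_pair_swap[OF p])
  also have "\<dots> = distr (exch_pair p) (PiM I M) (snd \<circ> (\<lambda>(a, b). (b, a)))"
    by (rule distr_distr) auto
  also have "\<dots> = PiM I M"
    unfolding swap by (rule distr_exch_pair_fst[OF p])
  finally show ?thesis .
qed

lemma exch_pair_marginals:
  fixes f :: "_ \<Rightarrow> real"
  assumes p: "p \<in> I" and [measurable]: "f \<in> borel_measurable (PiM I M)"
  shows "(\<integral>v. f (fst v) \<partial>exch_pair p) = integral\<^sup>L (PiM I M) f"
    and "(\<integral>v. f (snd v) \<partial>exch_pair p) = integral\<^sup>L (PiM I M) f"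
    and "integrable (exch_pair p) (\<lambda>v. f (fst v)) \<longleftrightarrow> integrable (PiM I M) f"
    and "integrable (exch_pair p) (\<lambda>v. f (snd v)) \<longleftrightarrow> integrable (PiM I M) f"
proof -
  have m: "fst \<in> exch_pair p \<rightarrow>\<^sub>M PiM I M" "snd \<in> exch_pair p \<rightarrow>\<^sub>M PiM I M" by measurable
  show "(\<integral>v. f (fst v) \<partial>exch_pair p) = integral\<^sup>L (PiM I M) f"
    "(\<integral>v. f (snd v) \<partial>exch_pair p) = integral\<^sup>L (PiM I M) f"
    using integral_distr[OF m(1), of f] integral_distr[OF m(2), of f]
    by (auto simp: distr_exch_pair_fst[OF p] distr_exch_pair_snd[OF p])
  show "integrable (exch_pair p) (\<lambda>v. f (fst v)) \<longleftrightarrow> integrable (PiM I M) f"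
    "integrable (exch_pair p) (\<lambda>v. f (snd v)) \<longleftrightarrow> integrable (PiM I M) f"
    using integrable_distr_eq[OF m(1), of f] integrable_distr_eq[OF m(2), of f]
    by (auto simp: distr_exch_pair_fst[OF p] distr_exch_pair_snd[OF p])
qed

lemma exch_pair_sq_integrable:
  assumes p: "p \<in> I" and f: "sq_integrable (PiM I M) f"
  shows "sq_integrable (exch_pair p) (\<lambda>v. f (fst v))" "sq_integrable (exch_pair p) (\<lambda>v. f (snd v))"
proof -
  have [measurable]: "f \<in> borel_measurable (PiM I M)" using f by auto
  show "sq_integrable (exch_pair p) (\<lambda>v. f (fst v))" "sq_integrable (exch_pair p) (\<lambda>v. f (snd v))"
    using f exch_pair_marginals(3,4)[OF p, of "\<lambda>x. (f x)\<^sup>2"]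
    by (auto simp: sq_integrable_def)
qed

text \<open>Conditioning on the first component: given it, the fresh value still has law
  \<open>M p\<close>, so the conditional mean is an integral over t.\<close>

lemma integral_exch_pair_fibre:
  fixes H :: "('a \<Rightarrow> 'b) \<Rightarrow> 'b \<Rightarrow> real"
  assumes p: "p \<in> I" and H [measurable]: "(\<lambda>(w, t). H w t) \<in> borel_measurable (PiM I M \<Otimes>\<^sub>M M p)"
    and int: "integrable (exch_pair p) (\<lambda>v. H (fst v) (snd v p))"
  shows "(\<integral>v. H (fst v) (snd v p) \<partial>exch_pair p) = (\<integral>w. (\<integral>t. H w t \<partial>M p) \<partial>PiM I M)"
    and "integrable (PiM I M) (\<lambda>w. \<integral>t. H w t \<partial>M p)"
proof -
  interpret Mp: pair_sigma_finite "PiM I M" "M p" by unfold_locales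
  have [measurable]: "(\<lambda>v. H (fst v) (snd v p)) \<in> borel_measurable (PiM I M \<Otimes>\<^sub>M PiM I M)"
  proof -
    have "(\<lambda>v. (fst v, snd v p)) \<in> PiM I M \<Otimes>\<^sub>M PiM I M \<rightarrow>\<^sub>M PiM I M \<Otimes>\<^sub>M M p"
      using p by measurable
    from measurable_compose[OF this H] show ?thesis by (simp add: case_prod_beta')
  qed
  have eq: "(case case v of (w, t) \<Rightarrow> (w, w(p := t)) of (a, b) \<Rightarrow> H a (b p)) = (case v of (w, t) \<Rightarrow> H w t)" for v
    by (auto split: prod.splits)
  have int': "integrable (PiM I M \<Otimes>\<^sub>M M p) (\<lambda>(w, t). H w t)"
    using int unfolding exch_pair_def
    by (subst (asm) integrable_distr_eq[OF measurable_exch[OF p]]) (auto simp: case_prod_beta')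
  have "(\<integral>v. H (fst v) (snd v p) \<partial>exch_pair p) = (\<integral>v. (case v of (w, t) \<Rightarrow> H w t) \<partial>(PiM I M \<Otimes>\<^sub>M M p))"
    unfolding exch_pair_def
    by (subst integral_distr[OF measurable_exch[OF p]]) (auto simp: case_prod_beta')
  also have "\<dots> = (\<integral>w. (\<integral>t. H w t \<partial>M p) \<partial>PiM I M)"
    using Mp.integral_fst[OF int'] by simp
  finally show "(\<integral>v. H (fst v) (snd v p) \<partial>exch_pair p) = (\<integral>w. (\<integral>t. H w t \<partial>M p) \<partial>PiM I M)" .
  show "integrable (PiM I M) (\<lambda>w. \<integral>t. H w t \<partial>M p)"
    by (rule Mp.integrable_fst[OF int'])
qed

text \<open>The law is carried by pairs that differ at most at \<open>p\<close>; identities about a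
  redraw thus become almost sure identities for the pair.\<close>

lemma AE_exch_pair:
  assumes p: "p \<in> I" and [measurable]: "Measurable.pred (PiM I M \<Otimes>\<^sub>M PiM I M) P"
    and "\<And>w t. w \<in> space (PiM I M) \<Longrightarrow> t \<in> space (M p) \<Longrightarrow> P (w, w(p := t))"
  shows "AE v in exch_pair p. P v"
  unfolding exch_pair_def
  by (subst AE_distr_iff[OF measurable_exch[OF p]]) (auto simp: assms(3) space_pair_measure intro!: AE_I2)

end

section \<open>Orthogonality of functions of few coordinates\<close>

text \<open>Dependence is stated pointwise rather than through a sub-sigma-algebra, because the
  Fubini argument below only substitutes configurations that agree on A.\<close>

definition depends_on :: "('i \<Rightarrow> 'a) measure \<Rightarrow> 'i set \<Rightarrow> (('i \<Rightarrow> 'a) \<Rightarrow> 'b) \<Rightarrow> bool" where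
  "depends_on N A F \<longleftrightarrow> (\<forall>w\<in>space N. \<forall>w'\<in>space N. (\<forall>i\<in>A. w i = w' i) \<longrightarrow> F w = F w')"

lemma depends_onD:
  "depends_on N A F \<Longrightarrow> w \<in> space N \<Longrightarrow> w' \<in> space N \<Longrightarrow> (\<And>i. i \<in> A \<Longrightarrow> w i = w' i) \<Longrightarrow> F w = F w'"
  unfolding depends_on_def by blast

context finite_product_prob_space begin

text \<open>The redrawn configuration has the law of the original one, so Fubini with t outside
  applies to F after the redraw. The inner integral is the regression of F on coordinate p.\<close>

lemma integrable_resample:
  fixes F :: "_ \<Rightarrow> real"
  assumes p: "p \<in> I" and F: "integrable (PiM I M) F"
  shows "AE t in M p. integrable (PiM I M) (\<lambda>w. F (w(p := t)))"
    and "integrable (M p) (\<lambda>t. \<integral>w. F (w(p := t)) \<partial>PiM I M)"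
    and "(\<integral>t. (\<integral>w. F (w(p := t)) \<partial>PiM I M) \<partial>M p) = integral\<^sup>L (PiM I M) F"
proof -
  interpret Mp: pair_sigma_finite "PiM I M" "M p" by unfold_locales
  have [measurable]: "F \<in> borel_measurable (PiM I M)" using F by auto
  have "integrable (exch_pair p) (\<lambda>v. F (snd v))"
    using exch_pair_marginals(4)[OF p] F by simp
  then have int: "integrable (PiM I M \<Otimes>\<^sub>M M p) (\<lambda>(w, t). F (w(p := t)))"
    unfolding exch_pair_def
    by (subst (asm) integrable_distr_eq[OF measurable_exch[OF p]]) (auto simp: case_prod_beta')
  show "AE t in M p. integrable (PiM I M) (\<lambda>w. F (w(p := t)))"
    by (rule Mp.AE_integrable_snd[OF int])
  show "integrable (M p) (\<lambda>t. \<integral>w. F (w(p := t)) \<partial>PiM I M)"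
    by (rule Mp.integrable_snd[OF int])
  have "(\<integral>t. (\<integral>w. F (w(p := t)) \<partial>PiM I M) \<partial>M p) = (\<integral>v. (case v of (w, t) \<Rightarrow> F (w(p := t))) \<partial>(PiM I M \<Otimes>\<^sub>M M p))"
    by (rule Mp.integral_snd[OF int])
  also have "\<dots> = (\<integral>v. F (snd v) \<partial>exch_pair p)"
    unfolding exch_pair_def
    by (subst integral_distr[OF measurable_exch[OF p]]) (auto simp: case_prod_beta')
  also have "\<dots> = integral\<^sup>L (PiM I M) F"
    by (rule exch_pair_marginals(2)[OF p]) simp
  finally show "(\<integral>t. (\<integral>w. F (w(p := t)) \<partial>PiM I M) \<partial>M p) = integral\<^sup>L (PiM I M) F" .
qed

text \<open>Integrating out the coordinates outside \<open>B \<union> {p}\<close> turns \<open>F\<close> into its regression on coordinate \<open>p\<close>.\<close>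
lemma integral_mult_orthogonal:
  fixes F G :: "_ \<Rightarrow> real"
  assumes p: "p \<in> I" and A: "A \<subseteq> I" and B: "B \<subseteq> I" and AB: "A \<inter> B \<subseteq> {p}"
    and F: "integrable (PiM I M) F" and FG: "integrable (PiM I M) (\<lambda>w. F w * G w)"
    and depF: "depends_on (PiM I M) A F" and depG: "depends_on (PiM I M) B G"
    and zero: "AE t in M p. (\<integral>w. F (w(p := t)) \<partial>PiM I M) = 0"
  shows "(\<integral>w. F w * G w \<partial>PiM I M) = 0"
proof -
  \<comment> \<open>G reads only D, while of D the function F reads at most p. With the coordinates
    in D frozen, G is a constant factor and F integrates to its regression at
    \<open>x p\<close>.\<close>
  define D where "D = insert p B"
  define C where "C = I - D"
  have un: "D \<union> C = I" and dis: "D \<inter> C = {}" using p B by (auto simp: D_def C_def)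
  have fin: "finite D" "finite C" using finite_index un by (metis finite_Un)+
  interpret PC: prob_space "PiM C M" by (intro prob_space_PiM prob_space)
  interpret PD: prob_space "PiM D M" by (intro prob_space_PiM prob_space)
  have merge_space: "merge D C (x, y) \<in> space (PiM I M)"
    if "x \<in> space (PiM D M)" "y \<in> space (PiM C M)" for x y
    using that dis by (auto simp: space_PiM merge_def PiE_iff un[symmetric] extensional_def)
  have "(\<integral>w. F w * G w \<partial>PiM I M)
      = (\<integral>x. (\<integral>y. F (merge D C (x, y)) * G (merge D C (x, y)) \<partial>PiM C M) \<partial>PiM D M)"
    using product_integral_fold[OF dis fin, of "\<lambda>w. F w * G w"] FG by (simp add: un)
  also have "\<dots> = (\<integral>x. 0 \<partial>PiM D M)"
  proof (rule integral_cong_AE)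
    have "AE t in M p. integrable (PiM I M) (\<lambda>w. F (w(p := t))) \<and> (\<integral>w. F (w(p := t)) \<partial>PiM I M) = 0"
      using integrable_resample(1)[OF p F] zero by eventually_elim auto
    then have "AE x in PiM D M. integrable (PiM I M) (\<lambda>w. F (w(p := x p))) \<and> (\<integral>w. F (w(p := x p)) \<partial>PiM I M) = 0"
      by (rule AE_PiM_component[where P = "\<lambda>t. integrable (PiM I M) (\<lambda>w. F (w(p := t))) \<and> (\<integral>w. F (w(p := t)) \<partial>PiM I M) = 0",
            OF prob_space, rotated]) (simp add: D_def)
    then show "AE x in PiM D M. (\<integral>y. F (merge D C (x, y)) * G (merge D C (x, y)) \<partial>PiM C M) = 0"
    proof (rule AE_mp, intro AE_I2 impI)
      fix x assume x: "x \<in> space (PiM D M)"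
        and *: "integrable (PiM I M) (\<lambda>w. F (w(p := x p))) \<and> (\<integral>w. F (w(p := x p)) \<partial>PiM I M) = 0"
      have xp: "x p \<in> space (M p)" using x by (auto simp: space_PiM D_def)
      obtain y0 where y0: "y0 \<in> space (PiM C M)" using PC.not_empty by blast
      have G_eq: "G (merge D C (x, y)) = G (merge D C (x, y0))" if "y \<in> space (PiM C M)" for y
        using merge_space[OF x that] merge_space[OF x y0]
        by (rule depends_onD[OF depG]) (auto simp: merge_def D_def)
      \<comment> \<open>Coordinate p is overwritten and A meets D at most in p, so F cannot see x';
        the outer integral below is therefore one of a constant.\<close>
      have F_eq: "F ((merge D C (x', y))(p := x p)) = F (merge D C (x, y))"
        if "x' \<in> space (PiM D M)" "y \<in> space (PiM C M)" for x' y
      proof (rule depends_onD[OF depF _ merge_space[OF x that(2)]])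
        show "(merge D C (x', y))(p := x p) \<in> space (PiM I M)"
          using merge_space[OF that] xp p by (auto simp: space_PiM PiE_iff extensional_def)
        fix i assume "i \<in> A"
        then show "((merge D C (x', y))(p := x p)) i = merge D C (x, y) i"
          using AB by (auto simp: merge_def D_def)
      qed
      have "0 = (\<integral>x'. (\<integral>y. F ((merge D C (x', y))(p := x p)) \<partial>PiM C M) \<partial>PiM D M)"
        using product_integral_fold[OF dis fin, of "\<lambda>w. F (w(p := x p))"] * by (simp add: un)
      also have "\<dots> = (\<integral>x'. (\<integral>y. F (merge D C (x, y)) \<partial>PiM C M) \<partial>PiM D M)"
        by (intro Bochner_Integration.integral_cong refl F_eq)
      also have "\<dots> = (\<integral>y. F (merge D C (x, y)) \<partial>PiM C M)"
        by (simp add: PD.prob_space)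
      finally have 0: "(\<integral>y. F (merge D C (x, y)) \<partial>PiM C M) = 0" by simp
      have "(\<integral>y. F (merge D C (x, y)) * G (merge D C (x, y)) \<partial>PiM C M)
          = (\<integral>y. F (merge D C (x, y)) * G (merge D C (x, y0)) \<partial>PiM C M)"
        by (intro Bochner_Integration.integral_cong arg_cong2[where f = "(*)"] refl G_eq)
      then show "(\<integral>y. F (merge D C (x, y)) * G (merge D C (x, y)) \<partial>PiM C M) = 0"
        by (simp add: 0)
    qed
    have [measurable]: "(\<lambda>w. F w * G w) \<in> borel_measurable (PiM (D \<union> C) M)"
      unfolding un using FG by auto
    have "(\<lambda>v. F (merge D C v) * G (merge D C v)) \<in> borel_measurable (PiM D M \<Otimes>\<^sub>M PiM C M)"
      by (rule measurable_compose[OF measurable_merge, of "\<lambda>w. F w * G w"]) simp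
    then show "(\<lambda>x. \<integral>y. F (merge D C (x, y)) * G (merge D C (x, y)) \<partial>PiM C M) \<in> borel_measurable (PiM D M)"
      by (intro PC.borel_measurable_lebesgue_integral) (simp add: case_prod_beta')
  qed simp
  finally show ?thesis by simp
qed

lemma integral_component:
  fixes v :: "'b \<Rightarrow> real"
  assumes p: "p \<in> I" and [measurable]: "v \<in> borel_measurable (M p)"
  shows "(\<integral>w. v (w p) \<partial>PiM I M) = integral\<^sup>L (M p) v"
    and "integrable (PiM I M) (\<lambda>w. v (w p)) \<longleftrightarrow> integrable (M p) v"
proof -
  have m: "(\<lambda>w. w p) \<in> PiM I M \<rightarrow>\<^sub>M M p" using p by measurable
  have d: "distr (PiM I M) (M p) (\<lambda>w. w p) = M p"
    by (rule distr_PiM_component[OF prob_space p])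
  show "(\<integral>w. v (w p) \<partial>PiM I M) = integral\<^sup>L (M p) v"
    using integral_distr[OF m, of v] by (simp add: d)
  show "integrable (PiM I M) (\<lambda>w. v (w p)) \<longleftrightarrow> integrable (M p) v"
    using integrable_distr_eq[OF m, of v] by (simp add: d)
qed

lemma sq_integrable_component:
  assumes "p \<in> I" "sq_integrable (M p) v"
  shows "sq_integrable (PiM I M) (\<lambda>w. v (w p))"
proof -
  have [measurable]: "v \<in> borel_measurable (M p)" using assms by auto
  have "(\<lambda>w. v (w p)) \<in> borel_measurable (PiM I M)"
    using assms(1) by measurable
  then show ?thesis
    using assms(2) integral_component(2)[OF assms(1), of "\<lambda>t. (v t)\<^sup>2"] by (simp add: sq_integrable_def)
qed

lemma depends_on_component: "depends_on (PiM I M) {p} (\<lambda>w. v (w p))"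
  unfolding depends_on_def by simp

text \<open>The pivot is the other coordinate q: the regression of \<open>u (w p)\<close> on it is
  the constant mean 0.\<close>

lemma integral_components_orthogonal:
  fixes u v :: "'b \<Rightarrow> real"
  assumes pq: "p \<in> I" "q \<in> I" "p \<noteq> q" and u: "sq_integrable (M p) u" and v: "sq_integrable (M q) v"
    and "integral\<^sup>L (M p) u = 0"
  shows "(\<integral>w. u (w p) * v (w q) \<partial>PiM I M) = 0"
proof (rule integral_mult_orthogonal[where A = "{p}" and B = "{q}" and p = q])
  have L: "sq_integrable (PiM I M) (\<lambda>w. u (w p))" "sq_integrable (PiM I M) (\<lambda>w. v (w q))"
    using assms by (auto intro: sq_integrable_component)
  show "integrable (PiM I M) (\<lambda>w. u (w p))"
    by (rule P.sq_integrable_imp_integrable[OF L(1)])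
  show "integrable (PiM I M) (\<lambda>w. u (w p) * v (w q))"
    by (rule sq_integrable_mult[OF L])
  have "u \<in> borel_measurable (M p)" using u by auto
  then have "(\<integral>w. u (w p) \<partial>PiM I M) = 0"
    using integral_component(1)[OF pq(1), of u] assms(6) by simp
  then show "AE t in M q. (\<integral>w. u ((w(q := t)) p) \<partial>PiM I M) = 0"
    using pq(3) by simp
  show "depends_on (PiM I M) {p} (\<lambda>w. u (w p))" "depends_on (PiM I M) {q} (\<lambda>w. v (w q))"
    by (rule depends_on_component)+
qed (use pq in blast)+

text \<open>Pythagoras: centred functions of different coordinates are orthogonal, so the diagonal
  of the double sum is all that survives.\<close>

lemma integral_sum_components_power2:
  fixes v :: "'a \<Rightarrow> 'b \<Rightarrow> real"
  assumes K: "K \<subseteq> I" and v: "\<And>p. p \<in> K \<Longrightarrow> sq_integrable (M p) (v p)"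
    and 0: "\<And>p. p \<in> K \<Longrightarrow> integral\<^sup>L (M p) (v p) = 0"
  shows "(\<integral>w. (\<Sum>p\<in>K. v p (w p))\<^sup>2 \<partial>PiM I M) = (\<Sum>p\<in>K. \<integral>t. (v p t)\<^sup>2 \<partial>M p)"
proof -
  have fin: "finite K" using K finite_index by (rule finite_subset)
  have L: "sq_integrable (PiM I M) (\<lambda>w. v p (w p))" if "p \<in> K" for p
    using that v K by (auto intro: sq_integrable_component)
  have "(\<integral>w. (\<Sum>p\<in>K. v p (w p))\<^sup>2 \<partial>PiM I M) = (\<integral>w. (\<Sum>p\<in>K. \<Sum>q\<in>K. v p (w p) * v q (w q)) \<partial>PiM I M)"
    by (simp add: power2_eq_square sum_product)
  also have "\<dots> = (\<Sum>p\<in>K. \<Sum>q\<in>K. \<integral>w. v p (w p) * v q (w q) \<partial>PiM I M)"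
  proof (subst Bochner_Integration.integral_sum)
    show "integrable (PiM I M) (\<lambda>w. \<Sum>q\<in>K. v p (w p) * v q (w q))" if "p \<in> K" for p
      using that by (intro Bochner_Integration.integrable_sum sq_integrable_mult L)
    show "(\<Sum>p\<in>K. \<integral>w. (\<Sum>q\<in>K. v p (w p) * v q (w q)) \<partial>PiM I M)
        = (\<Sum>p\<in>K. \<Sum>q\<in>K. \<integral>w. v p (w p) * v q (w q) \<partial>PiM I M)"
      by (intro sum.cong refl Bochner_Integration.integral_sum sq_integrable_mult L)
  qed
  also have "\<dots> = (\<Sum>p\<in>K. \<Sum>q\<in>K. if q = p then \<integral>t. (v p t)\<^sup>2 \<partial>M p else 0)"
  proof (intro sum.cong refl)
    fix p q assume pq: "p \<in> K" "q \<in> K"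
    have "v p \<in> borel_measurable (M p)" using v[OF pq(1)] by auto
    then show "(\<integral>w. v p (w p) * v q (w q) \<partial>PiM I M) = (if q = p then \<integral>t. (v p t)\<^sup>2 \<partial>M p else 0)"
      using pq K v 0 integral_component(1)[of p "\<lambda>t. (v p t)\<^sup>2"]
      by (auto intro!: integral_components_orthogonal simp: power2_eq_square)
  qed
  also have "\<dots> = (\<Sum>p\<in>K. \<integral>t. (v p t)\<^sup>2 \<partial>M p)"
    using fin by simp
  finally show ?thesis .
qed

end

section \<open>A Berry-Esseen bound for functions of independent coordinates\<close>

context finite_product_prob_space begin

text \<open>The conditional mean of \<open>\<bar>d\<bar> * d\<close> given the first member of the
  pair, with d = h s - h t.\<close>

definition signed_sq :: "('b \<Rightarrow> real) \<Rightarrow> 'a \<Rightarrow> 'b \<Rightarrow> real" where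
  "signed_sq h p s = (\<integral>t. \<bar>h s - h t\<bar> * (h s - h t) \<partial>M p)"

text \<open>It is centred because exchanging s and t reverses the sign. By Jensen its square is at
  most the mean of (h s - h t)^4, and (a - b)^4 \<le> 8 a^4 + 8 b^4 yields 8 + 8 = 16.\<close>

lemma signed_sq_facts:
  fixes h :: "'b \<Rightarrow> real"
  assumes h [measurable]: "h \<in> borel_measurable (M p)" and h4: "integrable (M p) (\<lambda>t. (h t) ^ 4)"
  shows "sq_integrable (M p) (signed_sq h p)" "integral\<^sup>L (M p) (signed_sq h p) = 0"
    and "(\<integral>s. (signed_sq h p s)\<^sup>2 \<partial>M p) \<le> 16 * (\<integral>t. (h t) ^ 4 \<partial>M p)"
proof -
  interpret PP: pair_sigma_finite "M p" "M p" by unfold_locales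
  let ?g = "\<lambda>s t. \<bar>h s - h t\<bar> * (h s - h t)" and ?H = "\<integral>t. (h t) ^ 4 \<partial>M p"
  have bound: "(\<bar>a - b\<bar> * (a - b))\<^sup>2 \<le> 8 * a ^ 4 + 8 * b ^ 4" for a b :: real
  proof -
    have "(\<bar>a - b\<bar> * (a - b))\<^sup>2 = (a - b) ^ 4"
      by (simp only: power_mult_distrib power2_abs power_add[symmetric]) simp
    then show ?thesis using power4_diff_le[of a b] by simp
  qed
  have meas [measurable]: "signed_sq h p \<in> borel_measurable (M p)"
    unfolding signed_sq_def[abs_def] by measurable
  have ptw: "(signed_sq h p s)\<^sup>2 \<le> 8 * h s ^ 4 + 8 * ?H" for s
  proof -
    have int: "integrable (M p) (\<lambda>t. 8 * h s ^ 4 + 8 * h t ^ 4)" using h4 by simp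
    have sqi: "sq_integrable (M p) (?g s)"
      unfolding sq_integrable_def
    proof
      show "integrable (M p) (\<lambda>t. (?g s t)\<^sup>2)"
        by (rule Bochner_Integration.integrable_bound[OF int])
          (auto intro!: AE_I2 order_trans[OF bound])
    qed measurable
    have "(signed_sq h p s)\<^sup>2 \<le> (\<integral>t. (?g s t)\<^sup>2 \<partial>M p)"
      unfolding signed_sq_def by (rule prob_space.expectation_power2_le[OF prob_space sqi])
    also have "\<dots> \<le> (\<integral>t. 8 * h s ^ 4 + 8 * h t ^ 4 \<partial>M p)"
      by (rule integral_mono[OF sq_integrableD(2)[OF sqi] int bound])
    also have "\<dots> = 8 * h s ^ 4 + 8 * ?H" using h4 by (simp add: M.prob_space)
    finally show ?thesis .
  qed
  have int: "integrable (M p) (\<lambda>s. 8 * h s ^ 4 + 8 * ?H)" using h4 by simp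
  show sqi: "sq_integrable (M p) (signed_sq h p)"
    unfolding sq_integrable_def
  proof
    show "integrable (M p) (\<lambda>t. (signed_sq h p t)\<^sup>2)"
      by (rule Bochner_Integration.integrable_bound[OF int])
        (auto intro!: AE_I2 order_trans[OF ptw])
  qed measurable
  have "(\<integral>s. (signed_sq h p s)\<^sup>2 \<partial>M p) \<le> (\<integral>s. 8 * h s ^ 4 + 8 * ?H \<partial>M p)"
    by (rule integral_mono[OF sq_integrableD(2)[OF sqi] int ptw])
  also have "\<dots> = 16 * ?H" using h4 by (simp add: M.prob_space)
  finally show "(\<integral>s. (signed_sq h p s)\<^sup>2 \<partial>M p) \<le> 16 * ?H" .
  have h2: "integrable (M p) (\<lambda>t. (h t)\<^sup>2)"
    using prob_space.sq_integrable_of_power4(1)[OF prob_space h h4] by auto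
  have i1: "integrable (M p \<Otimes>\<^sub>M M p) (\<lambda>v. (h (fst v))\<^sup>2)"
    using h2 integrable_distr_eq[of fst "M p \<Otimes>\<^sub>M M p" "M p" "\<lambda>t. (h t)\<^sup>2"]
    unfolding prob_space.distr_pair_fst[OF prob_space] by simp
  then have i2: "integrable (M p \<Otimes>\<^sub>M M p) (\<lambda>v. (h (snd v))\<^sup>2)"
    using PP.integrable_product_swap[OF i1] by (simp add: case_prod_beta')
  have "integrable (M p \<Otimes>\<^sub>M M p) (\<lambda>(s, t). ?g s t)"
  proof (rule Bochner_Integration.integrable_bound)
    show "integrable (M p \<Otimes>\<^sub>M M p) (\<lambda>v. 2 * (h (fst v))\<^sup>2 + 2 * (h (snd v))\<^sup>2)"
      by (intro Bochner_Integration.integrable_add integrable_mult_right i1 i2)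
    have "\<bar>?g s t\<bar> \<le> 2 * (h s)\<^sup>2 + 2 * (h t)\<^sup>2" for s t
      using power2_diff_le[of "h s" "h t"] by (simp add: abs_mult power2_eq_square)
    then show "AE v in M p \<Otimes>\<^sub>M M p. norm (case v of (s, t) \<Rightarrow> ?g s t) \<le> norm (2 * (h (fst v))\<^sup>2 + 2 * (h (snd v))\<^sup>2)"
      by (intro AE_I2) (simp add: case_prod_beta' del: abs_mult)
  qed measurable
  from PP.Fubini_integral[OF this]
  have "integral\<^sup>L (M p) (signed_sq h p) = (\<integral>t. (\<integral>s. ?g s t \<partial>M p) \<partial>M p)"
    unfolding signed_sq_def by simp
  also have "\<dots> = (\<integral>t. - signed_sq h p t \<partial>M p)"
  proof (rule Bochner_Integration.integral_cong[OF refl])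
    fix t
    have "(\<integral>s. ?g s t \<partial>M p) = (\<integral>s. - ?g t s \<partial>M p)"
      by (intro Bochner_Integration.integral_cong refl) (simp add: abs_minus_commute right_diff_distrib)
    then show "(\<integral>s. ?g s t \<partial>M p) = - signed_sq h p t"
      unfolding signed_sq_def by simp
  qed
  finally show "integral\<^sup>L (M p) (signed_sq h p) = 0" by simp
qed

text \<open>Swapping the pair doubles the mean of (h - h') \<phi>(W); there h' is independent of W
  and centred, so only h remains. This creates the increment of \<phi> to which the trapezoidal
  bound applies.\<close>

lemma stein_swap:
  fixes h :: "'b \<Rightarrow> real" and \<phi> W :: "_ \<Rightarrow> real"
  assumes p: "p \<in> I" and h: "sq_integrable (M p) h" and h0: "integral\<^sup>L (M p) h = 0"
    and W [measurable]: "W \<in> borel_measurable (PiM I M)"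
    and \<phi> [measurable]: "\<phi> \<in> borel_measurable borel" and bnd: "\<And>x. \<bar>\<phi> x\<bar> \<le> c"
  shows "(\<integral>v. (h (fst v p) - h (snd v p)) * (\<phi> (W (fst v)) - \<phi> (W (snd v))) \<partial>exch_pair p)
       = 2 * (\<integral>w. h (w p) * \<phi> (W w) \<partial>PiM I M)"
proof -
  interpret E: prob_space "exch_pair p" by (rule prob_space_exch_pair[OF p])
  have [measurable]: "h \<in> borel_measurable (M p)" using h by auto
  have [measurable]: "(\<lambda>w. h (w p)) \<in> borel_measurable (PiM I M)" using p by measurable
  have L: "sq_integrable (exch_pair p) (\<lambda>v. h (fst v p))" "sq_integrable (exch_pair p) (\<lambda>v. h (snd v p))"
    using exch_pair_sq_integrable[OF p sq_integrable_component[OF p h]] by auto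
  have ia: "integrable (exch_pair p) (\<lambda>v. u v * \<phi> (W (fst v)))"
    and ib: "integrable (exch_pair p) (\<lambda>v. u v * \<phi> (W (snd v)))" if "sq_integrable (exch_pair p) u" for u
  proof -
    have "integrable (exch_pair p) u" by (rule E.sq_integrable_imp_integrable[OF that])
    then show "integrable (exch_pair p) (\<lambda>v. u v * \<phi> (W (fst v)))" "integrable (exch_pair p) (\<lambda>v. u v * \<phi> (W (snd v)))"
      by (rule integrable_bounded_mult[OF _ _ bnd]; measurable)+
  qed
  have d: "sq_integrable (exch_pair p) (\<lambda>v. h (fst v p) - h (snd v p))"
    by (rule sq_integrable_diff[OF L])
  let ?D = "\<lambda>v. h (fst v p) - h (snd v p)"
  have swap: "(\<integral>v. ?D v * \<phi> (W (snd v)) \<partial>exch_pair p) = - (\<integral>v. ?D v * \<phi> (W (fst v)) \<partial>exch_pair p)"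
  proof -
    have "(\<lambda>v. ?D v * \<phi> (W (fst v))) \<in> borel_measurable (PiM I M \<Otimes>\<^sub>M PiM I M)"
      using p by measurable
    from integral_exch_pair_swap[OF p this]
    have "(\<integral>v. (h (snd v p) - h (fst v p)) * \<phi> (W (snd v)) \<partial>exch_pair p) = (\<integral>v. ?D v * \<phi> (W (fst v)) \<partial>exch_pair p)"
      by simp
    moreover have "(\<integral>v. (h (snd v p) - h (fst v p)) * \<phi> (W (snd v)) \<partial>exch_pair p) = - (\<integral>v. ?D v * \<phi> (W (snd v)) \<partial>exch_pair p)"
      by (subst Bochner_Integration.integral_minus[symmetric]) (simp add: left_diff_distrib)
    ultimately show ?thesis by simp
  qed
  have zero: "(\<integral>v. h (snd v p) * \<phi> (W (fst v)) \<partial>exch_pair p) = 0"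
  proof -
    have "(\<integral>v. h (snd v p) * \<phi> (W (fst v)) \<partial>exch_pair p) = (\<integral>w. (\<integral>t. h t * \<phi> (W w) \<partial>M p) \<partial>PiM I M)"
    proof (rule integral_exch_pair_fibre(1)[OF p, where H = "\<lambda>w t. h t * \<phi> (W w)"])
      show "(\<lambda>(w, t). h t * \<phi> (W w)) \<in> borel_measurable (PiM I M \<Otimes>\<^sub>M M p)" by measurable
      show "integrable (exch_pair p) (\<lambda>v. h (snd v p) * \<phi> (W (fst v)))" by (rule ia[OF L(2)])
    qed
    then show ?thesis by (simp add: h0)
  qed
  have "(\<integral>v. ?D v * (\<phi> (W (fst v)) - \<phi> (W (snd v))) \<partial>exch_pair p)
     = (\<integral>v. ?D v * \<phi> (W (fst v)) \<partial>exch_pair p) - (\<integral>v. ?D v * \<phi> (W (snd v)) \<partial>exch_pair p)"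
    by (subst Bochner_Integration.integral_diff[symmetric]) (auto intro: ia[OF d] ib[OF d] simp only: right_diff_distrib)
  also have "\<dots> = 2 * (\<integral>v. ?D v * \<phi> (W (fst v)) \<partial>exch_pair p)"
    unfolding swap by simp
  also have "(\<integral>v. ?D v * \<phi> (W (fst v)) \<partial>exch_pair p)
     = (\<integral>v. h (fst v p) * \<phi> (W (fst v)) \<partial>exch_pair p) - (\<integral>v. h (snd v p) * \<phi> (W (fst v)) \<partial>exch_pair p)"
    by (subst Bochner_Integration.integral_diff[symmetric]) (auto intro: ia[OF L(1)] ia[OF L(2)] simp only: left_diff_distrib)
  also have "(\<integral>v. h (fst v p) * \<phi> (W (fst v)) \<partial>exch_pair p) = (\<integral>w. h (w p) * \<phi> (W w) \<partial>PiM I M)"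
    by (rule exch_pair_marginals(1)[OF p]) measurable
  finally show ?thesis by (simp add: zero)
qed

text \<open>Swapping the pair moves everything to its first member: a symmetric weight turns an
  average of both ends into one end, an antisymmetric weight does so with half a difference.
  Conditioning on the first member is possible afterwards.\<close>

lemma integral_exch_pair_antisym:
  fixes d \<kappa> :: "_ \<Rightarrow> real"
  assumes p: "p \<in> I"
    and [measurable]: "d \<in> borel_measurable (PiM I M \<Otimes>\<^sub>M PiM I M)" "\<kappa> \<in> borel_measurable (PiM I M)"
    and int: "integrable (exch_pair p) d" and bnd: "\<And>x. \<bar>\<kappa> x\<bar> \<le> c"
  shows "(\<And>a b. d (b, a) = d (a, b)) \<Longrightarrow>
      (\<integral>v. d v * (\<kappa> (fst v) + \<kappa> (snd v)) / 2 \<partial>exch_pair p) = (\<integral>v. d v * \<kappa> (fst v) \<partial>exch_pair p)"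
    and "(\<And>a b. d (b, a) = - d (a, b)) \<Longrightarrow>
      (\<integral>v. d v * (\<kappa> (fst v) - \<kappa> (snd v)) / 2 \<partial>exch_pair p) = (\<integral>v. d v * \<kappa> (fst v) \<partial>exch_pair p)"
proof -
  have ia: "integrable (exch_pair p) (\<lambda>v. d v * \<kappa> (fst v))"
    and ib: "integrable (exch_pair p) (\<lambda>v. d v * \<kappa> (snd v))"
    by (rule integrable_bounded_mult[OF int _ bnd]; measurable)+
  have sw: "(\<integral>v. d (snd v, fst v) * \<kappa> (snd v) \<partial>exch_pair p) = (\<integral>v. d v * \<kappa> (fst v) \<partial>exch_pair p)"
    using integral_exch_pair_swap[OF p, of "\<lambda>v. d v * \<kappa> (fst v)"] by simp
  show "(\<integral>v. d v * (\<kappa> (fst v) + \<kappa> (snd v)) / 2 \<partial>exch_pair p) = (\<integral>v. d v * \<kappa> (fst v) \<partial>exch_pair p)"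
    if "\<And>a b. d (b, a) = d (a, b)"
  proof -
    have "d (snd v, fst v) = d v" for v using that[of "snd v" "fst v"] by simp
    then have "(\<integral>v. d v * \<kappa> (snd v) \<partial>exch_pair p) = (\<integral>v. d v * \<kappa> (fst v) \<partial>exch_pair p)"
      using sw by simp
    moreover have "(\<integral>v. d v * (\<kappa> (fst v) + \<kappa> (snd v)) / 2 \<partial>exch_pair p)
      = ((\<integral>v. d v * \<kappa> (fst v) \<partial>exch_pair p) + (\<integral>v. d v * \<kappa> (snd v) \<partial>exch_pair p)) / 2"
      using ia ib by (simp add: distrib_left)
    ultimately show ?thesis by simp
  qed
  show "(\<integral>v. d v * (\<kappa> (fst v) - \<kappa> (snd v)) / 2 \<partial>exch_pair p) = (\<integral>v. d v * \<kappa> (fst v) \<partial>exch_pair p)"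
    if "\<And>a b. d (b, a) = - d (a, b)"
  proof -
    have "d (snd v, fst v) = - d v" for v using that[of "snd v" "fst v"] by simp
    then have "(\<integral>v. d v * \<kappa> (snd v) \<partial>exch_pair p) = - (\<integral>v. d v * \<kappa> (fst v) \<partial>exch_pair p)"
      using sw by simp
    moreover have "(\<integral>v. d v * (\<kappa> (fst v) - \<kappa> (snd v)) / 2 \<partial>exch_pair p)
      = ((\<integral>v. d v * \<kappa> (fst v) \<partial>exch_pair p) - (\<integral>v. d v * \<kappa> (snd v) \<partial>exch_pair p)) / 2"
      using ia ib by (simp add: right_diff_distrib)
    ultimately show ?thesis by simp
  qed
qed

text \<open>Let d, D, e be the changes of h, W, A under the redraw, so D = d + e almost surely. The
  trapezoidal bound times \<open>\<bar>d\<bar>\<close> is integrated over the pair. Replacing D by d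
  costs the mean of \<open>\<bar>d * e\<bar>\<close> twice, in the main term and in the error;
  dividing by the 2 of \<open>stein_swap\<close> leaves it once.\<close>

lemma stein_coordinate:
  fixes h :: "'b \<Rightarrow> real" and W A :: "_ \<Rightarrow> real"
  assumes p: "p \<in> I" and h: "sq_integrable (M p) h" and h0: "integral\<^sup>L (M p) h = 0"
    and W: "sq_integrable (PiM I M) W" and A: "sq_integrable (PiM I M) A"
    and WA: "\<And>w t. w \<in> space (PiM I M) \<Longrightarrow> t \<in> space (M p) \<Longrightarrow>
        W w - W (w(p := t)) = (h (w p) - h t) + (A w - A (w(p := t)))"
  shows "\<bar>(\<integral>w. h (w p) * stein_sol z (W w) \<partial>PiM I M)
          - (\<integral>w. ((h (w p))\<^sup>2 + (\<integral>t. (h t)\<^sup>2 \<partial>M p)) * stein_deriv z (W w) \<partial>PiM I M) / 2\<bar>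
        \<le> (\<integral>w. signed_sq h p (w p) * stein_var z (W w) \<partial>PiM I M) / 2
          + 4 * sqrt ((\<integral>t. (h t)\<^sup>2 \<partial>M p) * (\<integral>w. (A w)\<^sup>2 \<partial>PiM I M))"
proof -
  interpret E: prob_space "exch_pair p" by (rule prob_space_exch_pair[OF p])
  have [measurable]: "h \<in> borel_measurable (M p)" "W \<in> borel_measurable (PiM I M)" "A \<in> borel_measurable (PiM I M)"
    using h W A by auto
  have [measurable]: "(\<lambda>w. h (w p)) \<in> borel_measurable (PiM I M)" using p by measurable
  let ?R = "exch_pair p"
  let ?d = "\<lambda>v. h (fst v p) - h (snd v p)" and ?D = "\<lambda>v. W (fst v) - W (snd v)"
    and ?e = "\<lambda>v. A (fst v) - A (snd v)" and ?s = "\<integral>t. (h t)\<^sup>2 \<partial>M p" and ?P = "PiM I M \<Otimes>\<^sub>M PiM I M"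
  have m [measurable]: "?d \<in> borel_measurable ?P" using p by measurable
  have Lh: "sq_integrable ?R (\<lambda>v. h (fst v p))" "sq_integrable ?R (\<lambda>v. h (snd v p))"
    using exch_pair_sq_integrable[OF p sq_integrable_component[OF p h]] by auto
  have Ld: "sq_integrable ?R ?d" by (rule sq_integrable_diff[OF Lh])
  have Lad: "sq_integrable ?R (\<lambda>v. \<bar>?d v\<bar>)" by (rule sq_integrable_abs[OF Ld])
  have LD: "sq_integrable ?R ?D" by (intro sq_integrable_diff exch_pair_sq_integrable p W)
  have Le: "sq_integrable ?R ?e" by (intro sq_integrable_diff exch_pair_sq_integrable p A)
  have AE: "AE v in ?R. ?D v = ?d v + ?e v"
    by (rule AE_exch_pair[OF p]) (use WA in auto)

  have h2: "(\<integral>w. (h (w p))\<^sup>2 \<partial>PiM I M) = ?s" by (rule integral_component(1)[OF p]) measurable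
  \<comment> \<open>One bound serves both h and A. For h the exact factor would be 2; the two
    factors 4 come out of the root as the 4 of the claim.\<close>
  have power2_bound: "(\<integral>v. (u (fst v) - u (snd v))\<^sup>2 \<partial>?R) \<le> 4 * (\<integral>w. (u w)\<^sup>2 \<partial>PiM I M)"
    if u: "sq_integrable (PiM I M) u" for u :: "_ \<Rightarrow> real"
  proof -
    have [measurable]: "u \<in> borel_measurable (PiM I M)" using u by auto
    note L = exch_pair_sq_integrable[OF p u]
    have "(\<integral>v. (u (fst v) - u (snd v))\<^sup>2 \<partial>?R) \<le> (\<integral>v. 2 * (u (fst v))\<^sup>2 + 2 * (u (snd v))\<^sup>2 \<partial>?R)"
    proof (rule integral_mono)
      show "(u (fst v) - u (snd v))\<^sup>2 \<le> 2 * (u (fst v))\<^sup>2 + 2 * (u (snd v))\<^sup>2" for v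
        by (rule power2_diff_le)
      show "integrable ?R (\<lambda>v. (u (fst v) - u (snd v))\<^sup>2)" using sq_integrable_diff[OF L] by auto
      show "integrable ?R (\<lambda>v. 2 * (u (fst v))\<^sup>2 + 2 * (u (snd v))\<^sup>2)"
        by (intro Bochner_Integration.integrable_add integrable_mult_right L[THEN sq_integrableD(2)])
    qed
    also have "\<dots> = 2 * (\<integral>v. (u (fst v))\<^sup>2 \<partial>?R) + 2 * (\<integral>v. (u (snd v))\<^sup>2 \<partial>?R)"
      using L[THEN sq_integrableD(2)] by (subst Bochner_Integration.integral_add) simp_all
    also have "\<dots> = 4 * (\<integral>w. (u w)\<^sup>2 \<partial>PiM I M)"
      using exch_pair_marginals(1,2)[OF p, of "\<lambda>w. (u w)\<^sup>2"] by simp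
    finally show ?thesis .
  qed
  define err where "err = (\<integral>v. \<bar>?d v * ?e v\<bar> \<partial>?R)"
  have err: "err \<le> 4 * sqrt (?s * (\<integral>w. (A w)\<^sup>2 \<partial>PiM I M))"
  proof -
    have "err \<le> sqrt ((\<integral>v. (?d v)\<^sup>2 \<partial>?R) * (\<integral>v. (?e v)\<^sup>2 \<partial>?R))"
      unfolding err_def by (rule Cauchy_Schwarz_integral[OF Ld Le])
    also have "\<dots> \<le> sqrt ((4 * ?s) * (4 * (\<integral>w. (A w)\<^sup>2 \<partial>PiM I M)))"
      using power2_bound[OF A] power2_bound[OF sq_integrable_component[OF p h]]
      by (intro real_sqrt_le_mono mult_mono) (auto simp: h2)
    also have "\<dots> = 4 * sqrt (?s * (\<integral>w. (A w)\<^sup>2 \<partial>PiM I M))"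
      by (simp add: real_sqrt_mult)
    finally show ?thesis .
  qed

  \<comment> \<open>Here \<open>u\<close> will be d in the main term and
    \<open>\<bar>d\<bar>\<close> in the error term.\<close>
  have split: "(\<integral>v. u v * ?D v * \<kappa> (W (fst v)) \<partial>?R)
      = (\<integral>v. u v * ?d v * \<kappa> (W (fst v)) \<partial>?R) + (\<integral>v. u v * ?e v * \<kappa> (W (fst v)) \<partial>?R)"
    if u: "sq_integrable ?R u" and [measurable]: "\<kappa> \<in> borel_measurable borel" and k: "\<And>x. \<bar>\<kappa> x\<bar> \<le> 1" for u \<kappa>
  proof -
    have [measurable]: "u \<in> borel_measurable ?R" using u by auto
    have i: "integrable ?R (\<lambda>v. u v * q v * \<kappa> (W (fst v)))" if "sq_integrable ?R q" for q
      by (rule integrable_bounded_mult[OF sq_integrable_mult[OF u that] _ k]) measurable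
    have "(\<integral>v. u v * ?D v * \<kappa> (W (fst v)) \<partial>?R)
      = (\<integral>v. u v * ?d v * \<kappa> (W (fst v)) + u v * ?e v * \<kappa> (W (fst v)) \<partial>?R)"
    proof (rule integral_cong_AE)
      show "AE v in ?R. u v * ?D v * \<kappa> (W (fst v)) = u v * ?d v * \<kappa> (W (fst v)) + u v * ?e v * \<kappa> (W (fst v))"
        using AE by eventually_elim (simp only: distrib_left distrib_right)
    qed measurable
    also have "\<dots> = (\<integral>v. u v * ?d v * \<kappa> (W (fst v)) \<partial>?R) + (\<integral>v. u v * ?e v * \<kappa> (W (fst v)) \<partial>?R)"
      by (rule Bochner_Integration.integral_add[OF i[OF Ld] i[OF Le]])
    finally show ?thesis .
  qed
  have small: "\<bar>\<integral>v. u v * ?e v * \<kappa> (W (fst v)) \<partial>?R\<bar> \<le> err"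
    if u: "sq_integrable ?R u" "\<And>v. \<bar>u v\<bar> = \<bar>?d v\<bar>" and k: "\<And>x. \<bar>\<kappa> x\<bar> \<le> 1" for u \<kappa>
  proof -
    have "\<bar>\<integral>v. u v * ?e v * \<kappa> (W (fst v)) \<partial>?R\<bar> \<le> (\<integral>v. \<bar>u v * ?e v\<bar> \<partial>?R)"
      by (rule abs_integral_mult_le) (auto intro: sq_integrable_mult u Le k)
    also have "\<dots> = err" unfolding err_def by (simp add: abs_mult u(2))
    finally show ?thesis .
  qed

  \<comment> \<open>Given w, the mean of (h - h')^2 over the fresh value is h^2 plus the second
    moment of h: the cross term vanishes as h is centred.\<close>
  have main1: "(\<integral>v. ?d v * ?d v * stein_deriv z (W (fst v)) \<partial>?R)
      = (\<integral>w. ((h (w p))\<^sup>2 + ?s) * stein_deriv z (W w) \<partial>PiM I M)"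
  proof -
    have "(\<integral>v. ?d v * ?d v * stein_deriv z (W (fst v)) \<partial>?R)
       = (\<integral>w. (\<integral>t. (h (w p) - h t) * (h (w p) - h t) * stein_deriv z (W w) \<partial>M p) \<partial>PiM I M)"
    proof (rule integral_exch_pair_fibre(1)[OF p, where H = "\<lambda>w t. (h (w p) - h t) * (h (w p) - h t) * stein_deriv z (W w)"])
      show "(\<lambda>(w, t). (h (w p) - h t) * (h (w p) - h t) * stein_deriv z (W w)) \<in> borel_measurable (PiM I M \<Otimes>\<^sub>M M p)"
        using p by measurable
      show "integrable ?R (\<lambda>v. ?d v * ?d v * stein_deriv z (W (fst v)))"
        by (rule integrable_bounded_mult[OF sq_integrable_mult[OF Ld Ld] _ abs_stein_deriv_le]) measurable
    qed
    also have "\<dots> = (\<integral>w. ((h (w p))\<^sup>2 + ?s) * stein_deriv z (W w) \<partial>PiM I M)"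
    proof (rule Bochner_Integration.integral_cong[OF refl])
      fix w
      have i: "integrable (M p) h" "integrable (M p) (\<lambda>t. (h t)\<^sup>2)"
        using h prob_space.sq_integrable_imp_integrable[OF prob_space h] by auto
      have "(\<integral>t. (h (w p) - h t) * (h (w p) - h t) \<partial>M p) = (\<integral>t. (h (w p))\<^sup>2 + (h t)\<^sup>2 - 2 * h (w p) * h t \<partial>M p)"
        by (simp add: power2_eq_square algebra_simps)
      also have "\<dots> = (h (w p))\<^sup>2 + ?s"
        using i by (simp add: h0 M.prob_space)
      finally show "(\<integral>t. (h (w p) - h t) * (h (w p) - h t) * stein_deriv z (W w) \<partial>M p)
        = ((h (w p))\<^sup>2 + ?s) * stein_deriv z (W w)" by simp
    qed
    finally show ?thesis .
  qed
  have main2: "(\<integral>v. \<bar>?d v\<bar> * ?d v * stein_var z (W (fst v)) \<partial>?R)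
      = (\<integral>w. signed_sq h p (w p) * stein_var z (W w) \<partial>PiM I M)"
  proof -
    have "(\<integral>v. \<bar>?d v\<bar> * ?d v * stein_var z (W (fst v)) \<partial>?R)
       = (\<integral>w. (\<integral>t. \<bar>h (w p) - h t\<bar> * (h (w p) - h t) * stein_var z (W w) \<partial>M p) \<partial>PiM I M)"
    proof (rule integral_exch_pair_fibre(1)[OF p, where H = "\<lambda>w t. \<bar>h (w p) - h t\<bar> * (h (w p) - h t) * stein_var z (W w)"])
      show "(\<lambda>(w, t). \<bar>h (w p) - h t\<bar> * (h (w p) - h t) * stein_var z (W w)) \<in> borel_measurable (PiM I M \<Otimes>\<^sub>M M p)"
        using p by measurable
      show "integrable ?R (\<lambda>v. \<bar>?d v\<bar> * ?d v * stein_var z (W (fst v)))"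
        by (rule integrable_bounded_mult[OF sq_integrable_mult[OF Lad Ld] _ abs_stein_var_le]) measurable
    qed
    then show ?thesis by (simp add: signed_sq_def)
  qed

  let ?T = "\<integral>v. ?d v * (stein_sol z (W (fst v)) - stein_sol z (W (snd v))) \<partial>?R"
  let ?Q = "\<integral>v. ?d v * ?D v * (stein_deriv z (W (fst v)) + stein_deriv z (W (snd v))) / 2 \<partial>?R"
  let ?V = "\<integral>v. \<bar>?d v\<bar> * ?D v * (stein_var z (W (fst v)) - stein_var z (W (snd v))) / 2 \<partial>?R"
  have T: "?T = 2 * (\<integral>w. h (w p) * stein_sol z (W w) \<partial>PiM I M)"
    by (rule stein_swap[OF p h h0 _ _ abs_stein_sol_le]) measurable
  have Q: "?Q = (\<integral>v. ?d v * ?D v * stein_deriv z (W (fst v)) \<partial>?R)"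
  proof (rule integral_exch_pair_antisym(1)[where d = "\<lambda>v. ?d v * ?D v" and \<kappa> = "\<lambda>w. stein_deriv z (W w)",
        OF p _ _ sq_integrable_mult[OF Ld LD] abs_stein_deriv_le])
    show "?d (b, a) * ?D (b, a) = ?d (a, b) * ?D (a, b)" for a b by (simp add: algebra_simps)
  qed measurable
  \<comment> \<open>D changes sign under the swap while \<open>\<bar>d\<bar>\<close> does not, so
    the weight is antisymmetric and the difference of \<open>stein_var\<close> collapses to its
    first term.\<close>
  have V: "?V = (\<integral>v. \<bar>?d v\<bar> * ?D v * stein_var z (W (fst v)) \<partial>?R)"
  proof (rule integral_exch_pair_antisym(2)[where d = "\<lambda>v. \<bar>?d v\<bar> * ?D v" and \<kappa> = "\<lambda>w. stein_var z (W w)",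
        OF p _ _ sq_integrable_mult[OF Lad LD] abs_stein_var_le])
    show "\<bar>?d (b, a)\<bar> * ?D (b, a) = - (\<bar>?d (a, b)\<bar> * ?D (a, b))" for a b
      by (simp add: abs_minus_commute[of "h (b p)"] right_diff_distrib)
  qed measurable
  have iT: "integrable ?R (\<lambda>v. ?d v * (stein_sol z (W (fst v)) - stein_sol z (W (snd v))))"
  proof (rule integrable_bounded_mult[OF E.sq_integrable_imp_integrable[OF Ld]])
    show "\<bar>stein_sol z (W (fst v)) - stein_sol z (W (snd v))\<bar> \<le> 4" for v
      using abs_stein_sol_le[of z "W (fst v)"] abs_stein_sol_le[of z "W (snd v)"] by linarith
  qed measurable
  have iQ: "integrable ?R (\<lambda>v. ?d v * ?D v * (stein_deriv z (W (fst v)) + stein_deriv z (W (snd v))) / 2)"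
  proof -
    have "integrable ?R (\<lambda>v. ?d v * ?D v * ((stein_deriv z (W (fst v)) + stein_deriv z (W (snd v))) / 2))"
    proof (rule integrable_bounded_mult[OF sq_integrable_mult[OF Ld LD]])
      show "\<bar>(stein_deriv z (W (fst v)) + stein_deriv z (W (snd v))) / 2\<bar> \<le> 1" for v
        using abs_stein_deriv_le[of z "W (fst v)"] abs_stein_deriv_le[of z "W (snd v)"] unfolding abs_le_iff by simp
    qed measurable
    then show ?thesis by simp
  qed
  have iV: "integrable ?R (\<lambda>v. \<bar>?d v\<bar> * ?D v * (stein_var z (W (fst v)) - stein_var z (W (snd v))) / 2)"
  proof -
    have "integrable ?R (\<lambda>v. \<bar>?d v\<bar> * ?D v * ((stein_var z (W (fst v)) - stein_var z (W (snd v))) / 2))"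
    proof (rule integrable_bounded_mult[OF sq_integrable_mult[OF Lad LD]])
      show "\<bar>(stein_var z (W (fst v)) - stein_var z (W (snd v))) / 2\<bar> \<le> 1" for v
        using abs_stein_var_le[of z "W (fst v)"] abs_stein_var_le[of z "W (snd v)"] unfolding abs_le_iff by simp
    qed measurable
    then show ?thesis by simp
  qed
  have "\<bar>?T - ?Q\<bar> \<le> ?V"
  proof -
    have factor: "\<bar>a * x - a * b * y / 2\<bar> = \<bar>a\<bar> * \<bar>x - b * y / 2\<bar>" for a b x y :: real
      unfolding abs_mult[symmetric] right_diff_distrib by simp
    have "\<bar>?T - ?Q\<bar> = \<bar>\<integral>v. ?d v * (stein_sol z (W (fst v)) - stein_sol z (W (snd v)))
        - ?d v * ?D v * (stein_deriv z (W (fst v)) + stein_deriv z (W (snd v))) / 2 \<partial>?R\<bar>"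
      by (simp only: Bochner_Integration.integral_diff[OF iT iQ])
    also have "\<dots> \<le> (\<integral>v. \<bar>?d v * (stein_sol z (W (fst v)) - stein_sol z (W (snd v)))
        - ?d v * ?D v * (stein_deriv z (W (fst v)) + stein_deriv z (W (snd v))) / 2\<bar> \<partial>?R)"
      by (rule integral_abs_bound)
    also have "\<dots> \<le> ?V"
    proof (rule integral_mono[OF integrable_abs[OF Bochner_Integration.integrable_diff[OF iT iQ]] iV])
      fix v
      have "\<bar>?d v * (stein_sol z (W (fst v)) - stein_sol z (W (snd v)))
        - ?d v * ?D v * (stein_deriv z (W (fst v)) + stein_deriv z (W (snd v))) / 2\<bar>
        = \<bar>?d v\<bar> * \<bar>stein_sol z (W (fst v)) - stein_sol z (W (snd v))
            - ?D v * (stein_deriv z (W (fst v)) + stein_deriv z (W (snd v))) / 2\<bar>"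
        by (rule factor)
      also have "\<dots> \<le> \<bar>?d v\<bar> * (?D v * (stein_var z (W (fst v)) - stein_var z (W (snd v))) / 2)"
        by (intro mult_left_mono stein_trapezoid abs_ge_zero)
      finally show "\<bar>?d v * (stein_sol z (W (fst v)) - stein_sol z (W (snd v)))
        - ?d v * ?D v * (stein_deriv z (W (fst v)) + stein_deriv z (W (snd v))) / 2\<bar>
        \<le> \<bar>?d v\<bar> * ?D v * (stein_var z (W (fst v)) - stein_var z (W (snd v))) / 2"
        by (simp only: mult.assoc times_divide_eq_right)
    qed
    finally show ?thesis .
  qed
  moreover have "\<bar>?Q - (\<integral>w. ((h (w p))\<^sup>2 + ?s) * stein_deriv z (W w) \<partial>PiM I M)\<bar> \<le> err"
    using split[of "?d" "stein_deriv z", OF Ld _ abs_stein_deriv_le] small[of "?d" "stein_deriv z", OF Ld refl abs_stein_deriv_le]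
    unfolding Q main1 by simp
  moreover have "?V \<le> (\<integral>w. signed_sq h p (w p) * stein_var z (W w) \<partial>PiM I M) + err"
    using split[of "\<lambda>v. \<bar>?d v\<bar>" "stein_var z", OF Lad _ abs_stein_var_le] small[of "\<lambda>v. \<bar>?d v\<bar>" "stein_var z", OF Lad abs_abs abs_stein_var_le]
    unfolding V main2 by simp
  ultimately show ?thesis
    using err unfolding T by linarith
qed

text \<open>\<open>A p\<close> holds the part of U that a redraw of coordinate p can change. The
  four terms: U against the Stein solution, bounded by 2; the defect in the variance of the linear
  part; 1/2 from the fluctuation of the squares plus 4/2 from the signed squares, together 5/2; and
  the cost of replacing the change of W by that of \<open>h p\<close>.\<close>

theorem nonlinear_berry_esseen:
  fixes K :: "'a set" and h :: "'a \<Rightarrow> 'b \<Rightarrow> real" and U :: "_ \<Rightarrow> real" and A :: "'a \<Rightarrow> _ \<Rightarrow> real"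
  defines "W \<equiv> \<lambda>w. (\<Sum>p\<in>K. h p (w p)) + U w"
  assumes K: "K \<subseteq> I"
    and h: "\<And>p. p \<in> K \<Longrightarrow> h p \<in> borel_measurable (M p)"
    and h4: "\<And>p. p \<in> K \<Longrightarrow> integrable (M p) (\<lambda>t. h p t ^ 4)"
    and h0: "\<And>p. p \<in> K \<Longrightarrow> integral\<^sup>L (M p) (h p) = 0"
    and U: "sq_integrable (PiM I M) U"
    and A: "\<And>p. p \<in> K \<Longrightarrow> sq_integrable (PiM I M) (A p)"
    and UA: "\<And>p w t. p \<in> K \<Longrightarrow> w \<in> space (PiM I M) \<Longrightarrow> t \<in> space (M p) \<Longrightarrow>
        U w - A p w = U (w(p := t)) - A p (w(p := t))"
  shows "\<bar>measure (PiM I M) {w \<in> space (PiM I M). W w \<le> z} - std_normal_cdf z\<bar>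
      \<le> 2 * sqrt (\<integral>w. (U w)\<^sup>2 \<partial>PiM I M) + \<bar>1 - (\<Sum>p\<in>K. \<integral>t. (h p t)\<^sup>2 \<partial>M p)\<bar>
        + 5 / 2 * sqrt (\<Sum>p\<in>K. \<integral>t. h p t ^ 4 \<partial>M p)
        + (\<Sum>p\<in>K. 4 * sqrt ((\<integral>t. (h p t)\<^sup>2 \<partial>M p) * (\<integral>w. (A p w)\<^sup>2 \<partial>PiM I M)))"
proof -
  let ?O = "PiM I M" and ?s = "\<lambda>p. \<integral>t. (h p t)\<^sup>2 \<partial>M p" and ?q = "\<lambda>p. \<integral>t. h p t ^ 4 \<partial>M p"
  let ?err = "\<lambda>p. 4 * sqrt (?s p * (\<integral>w. (A p w)\<^sup>2 \<partial>?O))"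
  let ?d = "\<lambda>w. stein_deriv z (W w)" and ?v = "\<lambda>w. stein_var z (W w)" and ?f = "\<lambda>w. stein_sol z (W w)"
  let ?x = "\<lambda>p w. h p (w p)"
  have fin: "finite K" using K finite_index by (rule finite_subset)
  have h_sq: "sq_integrable (M p) (h p)" "sq_integrable (M p) (\<lambda>t. (h p t)\<^sup>2)" if "p \<in> K" for p
    using prob_space.sq_integrable_of_power4[OF prob_space h[OF that] h4[OF that]] .
  have x_sq: "sq_integrable ?O (?x p)" "sq_integrable ?O (\<lambda>w. (?x p w)\<^sup>2)" if "p \<in> K" for p
    using that K h_sq[OF that] sq_integrable_component[of p "h p"] sq_integrable_component[of p "\<lambda>t. (h p t)\<^sup>2"]
    by auto
  have x2: "(\<integral>w. (?x p w)\<^sup>2 \<partial>?O) = ?s p" if "p \<in> K" for p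
    using that K h[OF that] integral_component(1)[of p "\<lambda>t. (h p t)\<^sup>2"] by auto
  have W: "sq_integrable ?O W"
    unfolding W_def by (intro sq_integrable_add sq_integrable_sum x_sq U)
  then have [measurable]: "W \<in> borel_measurable ?O" by auto
  have [measurable]: "U \<in> borel_measurable ?O" using U by auto
  have WA: "W w - W (w(p := t)) = (h p (w p) - h p t) + (A p w - A p (w(p := t)))"
    if "p \<in> K" "w \<in> space ?O" "t \<in> space (M p)" for p w t
  proof -
    have "(\<Sum>q\<in>K. h q (w q)) = h p (w p) + (\<Sum>q\<in>K - {p}. h q (w q))"
      using that fin by (simp add: sum.remove)
    moreover have "(\<Sum>q\<in>K. h q ((w(p := t)) q)) = h p t + (\<Sum>q\<in>K - {p}. h q ((w(p := t)) q))"
      using that fin by (simp add: sum.remove)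
    moreover have "(\<Sum>q\<in>K - {p}. h q ((w(p := t)) q)) = (\<Sum>q\<in>K - {p}. h q (w q))"
      by (rule sum.cong) auto
    ultimately show ?thesis
      using UA[OF that] by (simp add: W_def)
  qed
  have coord: "\<bar>(\<integral>w. ?x p w * ?f w \<partial>?O) - (\<integral>w. ((?x p w)\<^sup>2 + ?s p) * ?d w \<partial>?O) / 2\<bar>
        \<le> (\<integral>w. signed_sq (h p) p (w p) * ?v w \<partial>?O) / 2 + ?err p" if "p \<in> K" for p
    using that K by (intro stein_coordinate h_sq h0 W A WA) auto

  have int_d: "integrable ?O ?d"
    by (rule P.integrable_const_bound[where B = 1]) (auto simp: abs_stein_deriv_le)
  have int_Wf: "integrable ?O (\<lambda>w. W w * ?f w)"
    by (rule integrable_bounded_mult[OF P.sq_integrable_imp_integrable[OF W] _ abs_stein_sol_le]) measurable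
  have int_Uf: "integrable ?O (\<lambda>w. U w * ?f w)"
    by (rule integrable_bounded_mult[OF P.sq_integrable_imp_integrable[OF U] _ abs_stein_sol_le]) measurable
  have int_xf: "integrable ?O (\<lambda>w. ?x p w * ?f w)" if "p \<in> K" for p
    by (rule integrable_bounded_mult[OF P.sq_integrable_imp_integrable[OF x_sq(1)[OF that]] _ abs_stein_sol_le]) measurable
  have int_x2: "integrable ?O (\<lambda>w. (?x p w)\<^sup>2 + ?s p)" if "p \<in> K" for p
    using x_sq(1)[OF that] by auto
  have int_x2d: "integrable ?O (\<lambda>w. ((?x p w)\<^sup>2 + ?s p) * ?d w)" if "p \<in> K" for p
    by (rule integrable_bounded_mult[OF int_x2[OF that] _ abs_stein_deriv_le]) measurable

  have "measure ?O {w \<in> space ?O. W w \<le> z} = (\<integral>w. (if W w \<le> z then 1 else 0) \<partial>?O)"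
  proof -
    have "(\<integral>w. (if W w \<le> z then 1 else 0 :: real) \<partial>?O) = (\<integral>w. indicator {w \<in> space ?O. W w \<le> z} w \<partial>?O)"
      by (rule Bochner_Integration.integral_cong) auto
    moreover have "{w \<in> space ?O. W w \<le> z} \<inter> space ?O = {w \<in> space ?O. W w \<le> z}" by blast
    ultimately show ?thesis by (simp only: Bochner_Integration.integral_indicator)
  qed
  moreover have "integrable ?O (\<lambda>w. if W w \<le> z then 1 else 0 :: real)"
    by (rule P.integrable_const_bound[where B = 1]) auto
  \<comment> \<open>Stein's equation integrated along W: the definition of
    \<open>stein_deriv\<close> contributes the probability and the normal distribution
    function.\<close>
  ultimately have "(\<integral>w. ?d w \<partial>?O) = (\<integral>w. W w * ?f w \<partial>?O) + measure ?O {w \<in> space ?O. W w \<le> z} - std_normal_cdf z"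
    unfolding stein_deriv_def using int_Wf by (simp add: P.prob_space)
  moreover have "(\<integral>w. W w * ?f w \<partial>?O) = (\<Sum>p\<in>K. \<integral>w. ?x p w * ?f w \<partial>?O) + (\<integral>w. U w * ?f w \<partial>?O)"
  proof -
    have "(\<integral>w. W w * ?f w \<partial>?O) = (\<integral>w. (\<Sum>p\<in>K. ?x p w * ?f w) + U w * ?f w \<partial>?O)"
      by (rule Bochner_Integration.integral_cong[OF refl]) (subst W_def, simp add: distrib_right sum_distrib_right)
    also have "\<dots> = (\<integral>w. (\<Sum>p\<in>K. ?x p w * ?f w) \<partial>?O) + (\<integral>w. U w * ?f w \<partial>?O)"
      by (intro Bochner_Integration.integral_add Bochner_Integration.integrable_sum int_xf int_Uf)
    also have "(\<integral>w. (\<Sum>p\<in>K. ?x p w * ?f w) \<partial>?O) = (\<Sum>p\<in>K. \<integral>w. ?x p w * ?f w \<partial>?O)"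
      by (intro Bochner_Integration.integral_sum int_xf)
    finally show ?thesis .
  qed
  ultimately have key: "measure ?O {w \<in> space ?O. W w \<le> z} - std_normal_cdf z
     = (\<integral>w. ?d w \<partial>?O) - (\<Sum>p\<in>K. \<integral>w. ?x p w * ?f w \<partial>?O) - (\<integral>w. U w * ?f w \<partial>?O)"
    by simp

  have U_bound: "\<bar>\<integral>w. U w * ?f w \<partial>?O\<bar> \<le> 2 * sqrt (\<integral>w. (U w)\<^sup>2 \<partial>?O)"
  proof -
    \<comment> \<open>Halving brings the Stein solution below 1.\<close>
    have "\<bar>\<integral>w. U w * (?f w / 2) \<partial>?O\<bar> \<le> (\<integral>w. \<bar>U w\<bar> \<partial>?O)"
      using abs_stein_sol_le[of z]
      by (intro abs_integral_mult_le P.sq_integrable_imp_integrable[OF U]) (simp add: abs_divide)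
    also have "\<dots> \<le> sqrt (\<integral>w. (U w)\<^sup>2 \<partial>?O)"
      by (rule P.expectation_abs_le[OF U])
    finally show ?thesis by simp
  qed

  \<comment> \<open>Each summand, halved, has mean \<open>?s p\<close>, so the sum is a random
    approximation to the variance of the linear part, and \<open>?R\<close> is its distance from
    1.\<close>
  let ?R = "\<lambda>w. 1 - (\<Sum>p\<in>K. (?x p w)\<^sup>2 + ?s p) / 2"
  have int_R: "integrable ?O ?R"
    by (intro Bochner_Integration.integrable_diff integrable_divide Bochner_Integration.integrable_sum int_x2) simp
  have d_eq: "(\<integral>w. ?d w \<partial>?O) - (\<Sum>p\<in>K. (\<integral>w. ((?x p w)\<^sup>2 + ?s p) * ?d w \<partial>?O) / 2) = (\<integral>w. ?R w * ?d w \<partial>?O)"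
  proof -
    have "(\<integral>w. ?R w * ?d w \<partial>?O) = (\<integral>w. ?d w - (\<Sum>p\<in>K. ((?x p w)\<^sup>2 + ?s p) * ?d w / 2) \<partial>?O)"
      by (rule Bochner_Integration.integral_cong[OF refl])
        (simp only: left_diff_distrib mult_1 sum_distrib_right sum_divide_distrib times_divide_eq_left)
    also have "\<dots> = (\<integral>w. ?d w \<partial>?O) - (\<integral>w. (\<Sum>p\<in>K. ((?x p w)\<^sup>2 + ?s p) * ?d w / 2) \<partial>?O)"
      by (intro Bochner_Integration.integral_diff int_d Bochner_Integration.integrable_sum integrable_divide int_x2d)
    also have "(\<integral>w. (\<Sum>p\<in>K. ((?x p w)\<^sup>2 + ?s p) * ?d w / 2) \<partial>?O) = (\<Sum>p\<in>K. \<integral>w. ((?x p w)\<^sup>2 + ?s p) * ?d w / 2 \<partial>?O)"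
      by (intro Bochner_Integration.integral_sum integrable_divide int_x2d)
    finally show ?thesis by simp
  qed
  have R_bound: "\<bar>\<integral>w. ?R w * ?d w \<partial>?O\<bar> \<le> \<bar>1 - (\<Sum>p\<in>K. ?s p)\<bar> + sqrt (\<Sum>p\<in>K. ?q p) / 2"
  proof -
    \<comment> \<open>Centred squares of different coordinates are orthogonal, and the variance of a
      square is at most the fourth moment.\<close>
    let ?c = "\<lambda>p t. (h p t)\<^sup>2 - ?s p"
    have c_sq: "sq_integrable (M p) (?c p)" if "p \<in> K" for p
      by (intro sq_integrable_diff h_sq that prob_space.sq_integrable_const[OF prob_space])
    have c0: "integral\<^sup>L (M p) (?c p) = 0" if "p \<in> K" for p
      using h_sq(1)[OF that] by (subst Bochner_Integration.integral_diff) (auto simp: M.prob_space)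
    have c2: "(\<integral>t. (?c p t)\<^sup>2 \<partial>M p) \<le> ?q p" if "p \<in> K" for p
    proof -
      have i: "integrable (M p) (\<lambda>t. (h p t)\<^sup>2)" "integrable (M p) (\<lambda>t. h p t ^ 4)"
        using h_sq(1)[OF that] h4[OF that] by auto
      have "(\<integral>t. (?c p t)\<^sup>2 \<partial>M p) = (\<integral>t. h p t ^ 4 - 2 * ?s p * (h p t)\<^sup>2 + (?s p)\<^sup>2 \<partial>M p)"
        by (rule Bochner_Integration.integral_cong[OF refl]) (simp add: power2_diff)
      also have "\<dots> = ?q p - (?s p)\<^sup>2"
        using i by (simp add: M.prob_space power2_eq_square)
      finally show ?thesis by simp
    qed
    have C_sq: "sq_integrable ?O (\<lambda>w. \<Sum>p\<in>K. ?c p (w p))"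
      using K by (intro sq_integrable_sum sq_integrable_component c_sq) auto
    have "\<bar>\<integral>w. ?R w * ?d w \<partial>?O\<bar> \<le> (\<integral>w. \<bar>?R w\<bar> \<partial>?O)"
      by (rule abs_integral_mult_le[OF int_R abs_stein_deriv_le])
    also have "\<dots> \<le> (\<integral>w. \<bar>1 - (\<Sum>p\<in>K. ?s p)\<bar> + \<bar>\<Sum>p\<in>K. ?c p (w p)\<bar> / 2 \<partial>?O)"
    proof (rule integral_mono[OF integrable_abs[OF int_R]])
      show "integrable ?O (\<lambda>w. \<bar>1 - (\<Sum>p\<in>K. ?s p)\<bar> + \<bar>\<Sum>p\<in>K. ?c p (w p)\<bar> / 2)"
        by (intro Bochner_Integration.integrable_add integrable_divide integrable_abs P.sq_integrable_imp_integrable[OF C_sq]) simp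
      fix w
      have "?R w = (1 - (\<Sum>p\<in>K. ?s p)) - (\<Sum>p\<in>K. ?c p (w p)) / 2"
        by (simp add: sum.distrib sum_subtractf field_simps)
      then show "\<bar>?R w\<bar> \<le> \<bar>1 - (\<Sum>p\<in>K. ?s p)\<bar> + \<bar>\<Sum>p\<in>K. ?c p (w p)\<bar> / 2"
        using abs_triangle_ineq4[of "1 - (\<Sum>p\<in>K. ?s p)" "(\<Sum>p\<in>K. ?c p (w p)) / 2"]
        by (simp only: abs_divide abs_numeral)
    qed
    also have "\<dots> = \<bar>1 - (\<Sum>p\<in>K. ?s p)\<bar> + (\<integral>w. \<bar>\<Sum>p\<in>K. ?c p (w p)\<bar> \<partial>?O) / 2"
      using integrable_abs[OF P.sq_integrable_imp_integrable[OF C_sq]]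
      by (subst Bochner_Integration.integral_add) (simp_all add: P.prob_space)
    also have "(\<integral>w. \<bar>\<Sum>p\<in>K. ?c p (w p)\<bar> \<partial>?O) \<le> sqrt (\<integral>w. (\<Sum>p\<in>K. ?c p (w p))\<^sup>2 \<partial>?O)"
      by (rule P.expectation_abs_le[OF C_sq])
    also have "(\<integral>w. (\<Sum>p\<in>K. ?c p (w p))\<^sup>2 \<partial>?O) = (\<Sum>p\<in>K. \<integral>t. (?c p t)\<^sup>2 \<partial>M p)"
      by (rule integral_sum_components_power2[OF K c_sq c0])
    also have "sqrt (\<Sum>p\<in>K. \<integral>t. (?c p t)\<^sup>2 \<partial>M p) \<le> sqrt (\<Sum>p\<in>K. ?q p)"
      by (intro real_sqrt_le_mono sum_mono c2)
    finally show ?thesis by simp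
  qed

  \<comment> \<open>The dependence on W is discarded by the bound 1 on \<open>stein_var\<close>.
    What remains is the first absolute moment of a sum of independent centred terms, estimated by
    its L2 norm.\<close>
  let ?S = "\<lambda>w. \<Sum>p\<in>K. signed_sq (h p) p (w p)"
  note sgn = signed_sq_facts[OF h h4]
  have S_sq: "sq_integrable ?O (\<lambda>w. signed_sq (h p) p (w p))" if "p \<in> K" for p
    using K that by (intro sq_integrable_component sgn) auto
  have "(\<Sum>p\<in>K. \<integral>w. signed_sq (h p) p (w p) * ?v w \<partial>?O) = (\<integral>w. (\<Sum>p\<in>K. signed_sq (h p) p (w p) * ?v w) \<partial>?O)"
    by (intro Bochner_Integration.integral_sum[symmetric] integrable_bounded_mult[OF P.sq_integrable_imp_integrable[OF S_sq] _ abs_stein_var_le])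
      measurable
  also have "\<dots> = (\<integral>w. ?S w * ?v w \<partial>?O)" by (simp only: sum_distrib_right)
  also have "\<dots> \<le> \<bar>\<integral>w. ?S w * ?v w \<partial>?O\<bar>" by simp
  also have "\<dots> \<le> (\<integral>w. \<bar>?S w\<bar> \<partial>?O)"
    by (rule abs_integral_mult_le[OF P.sq_integrable_imp_integrable abs_stein_var_le]) (intro sq_integrable_sum S_sq)
  also have "\<dots> \<le> sqrt (\<integral>w. (?S w)\<^sup>2 \<partial>?O)"
    by (rule P.expectation_abs_le) (intro sq_integrable_sum S_sq)
  also have "(\<integral>w. (?S w)\<^sup>2 \<partial>?O) = (\<Sum>p\<in>K. \<integral>t. (signed_sq (h p) p t)\<^sup>2 \<partial>M p)"
    by (rule integral_sum_components_power2[OF K sgn(1,2)])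
  also have "sqrt (\<Sum>p\<in>K. \<integral>t. (signed_sq (h p) p t)\<^sup>2 \<partial>M p) \<le> sqrt (\<Sum>p\<in>K. 16 * ?q p)"
    by (intro real_sqrt_le_mono sum_mono sgn(3))
  also have "\<dots> = 4 * sqrt (\<Sum>p\<in>K. ?q p)"
    by (simp add: sum_distrib_left[symmetric] real_sqrt_mult)
  finally have S_bound: "(\<Sum>p\<in>K. \<integral>w. signed_sq (h p) p (w p) * ?v w \<partial>?O) \<le> 4 * sqrt (\<Sum>p\<in>K. ?q p)" .

  have "\<bar>(\<Sum>p\<in>K. \<integral>w. ?x p w * ?f w \<partial>?O) - (\<Sum>p\<in>K. (\<integral>w. ((?x p w)\<^sup>2 + ?s p) * ?d w \<partial>?O) / 2)\<bar>
      \<le> (\<Sum>p\<in>K. (\<integral>w. signed_sq (h p) p (w p) * ?v w \<partial>?O) / 2 + ?err p)"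
    unfolding sum_subtractf[symmetric] by (rule order_trans[OF sum_abs]) (intro sum_mono coord)
  also have "\<dots> = (\<Sum>p\<in>K. \<integral>w. signed_sq (h p) p (w p) * ?v w \<partial>?O) / 2 + (\<Sum>p\<in>K. ?err p)"
    by (simp only: sum.distrib sum_divide_distrib)
  finally have lin: "\<bar>(\<Sum>p\<in>K. \<integral>w. ?x p w * ?f w \<partial>?O) - (\<Sum>p\<in>K. (\<integral>w. ((?x p w)\<^sup>2 + ?s p) * ?d w \<partial>?O) / 2)\<bar>
      \<le> 2 * sqrt (\<Sum>p\<in>K. ?q p) + (\<Sum>p\<in>K. ?err p)"
    using S_bound by linarith
  show ?thesis
    unfolding key using U_bound R_bound[folded d_eq] lin by linarith
qed

end

section \<open>U-statistics on a product space\<close>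

text \<open>One index set for the whole sample: the diagonal entry (i, i) stands for X_i, an entry i
  < j for Y_{i,j}.\<close>

definition pairs :: "nat \<Rightarrow> (nat \<times> nat) set" where
  "pairs n = {(i, j). 1 \<le> i \<and> i \<le> j \<and> j \<le> n}"

text \<open>The convention Y_{j,i} = Y_{i,j}, for tuples that are injective without being
  increasing.\<close>

definition sort_pair :: "(nat \<Rightarrow> nat) \<Rightarrow> nat \<times> nat \<Rightarrow> nat \<times> nat" where
  "sort_pair a p = (min (a (fst p)) (a (snd p)), max (a (fst p)) (a (snd p)))"

text \<open>The coordinates a summand with vertex set V can read: the complete graph on V with its
  loops.\<close>

definition block :: "nat \<Rightarrow> nat set \<Rightarrow> (nat \<times> nat) set" where
  "block n V = {p \<in> pairs n. fst p \<in> V \<and> snd p \<in> V}"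

lemma finite_pairs: "finite (pairs n)"
  by (rule finite_subset[of _ "{1..n} \<times> {1..n}"]) (auto simp: pairs_def)

text \<open>The argument of the kernel at the tuple \<open>a\<close>, extracted from a
  configuration. For a permutation \<open>a\<close> of \<open>{1..k}\<close> it is the relabelling
  under which the kernel is symmetric.\<close>

definition pull :: "nat \<Rightarrow> (nat \<Rightarrow> nat) \<Rightarrow> (nat \<times> nat \<Rightarrow> 'a) \<Rightarrow> nat \<times> nat \<Rightarrow> 'a" where
  "pull k a w = (\<lambda>p\<in>pairs k. w (sort_pair a p))"

lemma sort_pair_in_pairs:
  assumes "p \<in> pairs k" "a \<in> {1..k} \<rightarrow> V" "V \<subseteq> {1..n}"
  shows "sort_pair a p \<in> block n V"
proof -
  have "a (fst p) \<in> V" "a (snd p) \<in> V" using assms by (auto simp: pairs_def)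
  with assms(3) show ?thesis
    by (auto simp: block_def sort_pair_def pairs_def min_def max_def)
qed

lemma sort_pair_mem:
  assumes "p \<in> pairs k" "a \<in> {1..k} \<rightarrow> {1..n}"
  shows "sort_pair a p \<in> pairs n"
  using sort_pair_in_pairs[OF assms order_refl] unfolding block_def by blast

text \<open>Loops come only from loops, so redrawing one X variable of the sample alters exactly one
  argument of the kernel.\<close>

lemma sort_pair_eq_diag:
  assumes "p \<in> pairs k" "inj_on a {1..k}" "i \<in> {1..k}"
  shows "sort_pair a p = (a i, a i) \<longleftrightarrow> p = (i, i)"
proof
  assume "sort_pair a p = (a i, a i)"
  then have "a (fst p) = a i" "a (snd p) = a i"
    by (auto simp: sort_pair_def min_def max_def split: if_splits)
  moreover have "fst p \<in> {1..k}" "snd p \<in> {1..k}" using assms(1) by (auto simp: pairs_def)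
  ultimately have "fst p = i" "snd p = i" using inj_onD[OF assms(2)] assms(3) by blast+
  then show "p = (i, i)" by (simp add: prod_eq_iff)
qed (simp add: sort_pair_def)

text \<open>An unordered pair of values determines the unordered pair of indices, and entries of
  \<open>pairs k\<close> are already sorted. Injectivity is what makes reindexing preserve product
  measures.\<close>

lemma inj_on_sort_pair:
  assumes "inj_on a {1..k}" shows "inj_on (sort_pair a) (pairs k)"
proof (rule inj_onI)
  fix p q assume p: "p \<in> pairs k" and q: "q \<in> pairs k" and eq: "sort_pair a p = sort_pair a q"
  have inj: "a x = a y \<longleftrightarrow> x = y" if "x \<in> {1..k}" "y \<in> {1..k}" for x y
    by (rule inj_on_eq_iff[OF assms that])
  have mem: "fst p \<in> {1..k}" "snd p \<in> {1..k}" "fst q \<in> {1..k}" "snd q \<in> {1..k}"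
    using p q by (auto simp: pairs_def)
  have "(a (fst p) = a (fst q) \<and> a (snd p) = a (snd q)) \<or> (a (fst p) = a (snd q) \<and> a (snd p) = a (fst q))"
    using eq by (auto simp: sort_pair_def min_def max_def split: if_splits)
  then have "(fst p = fst q \<and> snd p = snd q) \<or> (fst p = snd q \<and> snd p = fst q)"
    using inj mem by metis
  then show "p = q" using p q by (auto simp: pairs_def prod_eq_iff)
qed

lemma sort_pair_comp: "sort_pair (a \<circ> b) p = sort_pair a (sort_pair b p)"
  by (cases "b (fst p) \<le> b (snd p)"; simp add: sort_pair_def min.commute max.commute)

text \<open>The U-statistic on a product space: a single value type, one law along the diagonal, one
  law above it, and a kernel of a whole block of coordinates.\<close>

locale ustat_product =
  fixes n k :: nat and Q :: "nat \<times> nat \<Rightarrow> 'a measure" and K :: "(nat \<times> nat \<Rightarrow> 'a) \<Rightarrow> real"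
  assumes k_ge: "1 \<le> k" and k_le: "k \<le> n"
    and prob_Q: "\<And>p. prob_space (Q p)"
    and Q_diag: "\<And>i. i \<in> {1..n} \<Longrightarrow> Q (i, i) = Q (1, 1)"
    and Q_upper: "\<And>i j. 1 \<le> i \<Longrightarrow> i < j \<Longrightarrow> j \<le> n \<Longrightarrow> Q (i, j) = Q (1, 2)"
    and K_meas: "K \<in> borel_measurable (PiM (pairs k) Q)"
    and K4: "integrable (PiM (pairs k) Q) (\<lambda>w. K w ^ 4)"
    and K_sym: "\<And>\<pi> w. \<pi> permutes {1..k} \<Longrightarrow> w \<in> space (PiM (pairs k) Q) \<Longrightarrow> K (pull k \<pi> w) = K w"
begin

abbreviation "\<Omega> \<equiv> PiM (pairs n) Q"
abbreviation "\<Omega>k \<equiv> PiM (pairs k) Q"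

lemma finite_product_prob_space_Q: "finite I \<Longrightarrow> finite_product_prob_space Q I"
proof -
  assume "finite I"
  interpret q: prob_space "Q p" for p by (rule prob_Q)
  show ?thesis by standard fact
qed

sublocale N: finite_product_prob_space Q "pairs n"
  by (rule finite_product_prob_space_Q[OF finite_pairs])

sublocale Nk: finite_product_prob_space Q "pairs k"
  by (rule finite_product_prob_space_Q[OF finite_pairs])

lemma Q_sort_pair:
  assumes a: "inj_on a {1..k}" "a \<in> {1..k} \<rightarrow> {1..n}" and p: "p \<in> pairs k"
  shows "Q (sort_pair a p) = Q p"
proof -
  have mem: "fst p \<in> {1..k}" "snd p \<in> {1..k}" and le: "fst p \<le> snd p"
    using p by (auto simp: pairs_def)
  have an: "a (fst p) \<in> {1..n}" "a (snd p) \<in> {1..n}" using a(2) mem by auto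
  show ?thesis
  proof (cases "fst p = snd p")
    case True
    define i where "i = fst p"
    have i: "i \<in> {1..n}" "a i \<in> {1..n}" using an mem k_le by (auto simp: i_def)
    have "p = (i, i)" "sort_pair a p = (a i, a i)" using True by (simp_all add: i_def prod_eq_iff sort_pair_def)
    then show ?thesis using Q_diag[OF i(1)] Q_diag[OF i(2)] by (simp only:)
  next
    case False
    then have "a (fst p) \<noteq> a (snd p)" using inj_on_eq_iff[OF a(1) mem] by simp
    then have "Q (sort_pair a p) = Q (1, 2)"
      unfolding sort_pair_def using an by (intro Q_upper) (auto simp: min_def max_def)
    moreover have "Q (fst p, snd p) = Q (1, 2)"
      using mem False le k_le by (intro Q_upper) auto
    ultimately show ?thesis by (simp only: prod.collapse)
  qed
qed

text \<open>Distinct vertices select distinct coordinates of matching laws, so every summand is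
  distributed as the kernel at the first k vertices. Tuples are merely injective here because
  \<open>relabel\<close> destroys the order.\<close>

lemma distr_pull:
  assumes a: "inj_on a {1..k}" "a \<in> {1..k} \<rightarrow> {1..n}"
  shows "distr \<Omega> \<Omega>k (pull k a) = \<Omega>k"
proof -
  have eq: "(\<Pi>\<^sub>M p\<in>pairs k. Q (sort_pair a p)) = \<Omega>k"
    by (intro PiM_cong refl Q_sort_pair a)
  have "distr \<Omega> (\<Pi>\<^sub>M p\<in>pairs k. Q (sort_pair a p)) (\<lambda>w. \<lambda>p\<in>pairs k. w (sort_pair a p))
      = (\<Pi>\<^sub>M p\<in>pairs k. Q (sort_pair a p))"
  proof (rule distr_PiM_reindex[where M = Q and f = "sort_pair a" and I = "pairs k" and K = "pairs n",
      OF prob_Q inj_on_sort_pair[OF a(1)]])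
    show "sort_pair a \<in> pairs k \<rightarrow> pairs n"
      using sort_pair_mem[OF _ a(2)] by (intro Pi_I)
  qed
  then show ?thesis by (simp add: eq pull_def[abs_def])
qed

lemma measurable_pull:
  assumes a: "inj_on a {1..k}" "a \<in> {1..k} \<rightarrow> {1..n}"
  shows "pull k a \<in> \<Omega> \<rightarrow>\<^sub>M \<Omega>k"
  unfolding pull_def[abs_def]
proof (rule measurable_restrict)
  fix p assume p: "p \<in> pairs k"
  have "(\<lambda>w. w (sort_pair a p)) \<in> \<Omega> \<rightarrow>\<^sub>M Q (sort_pair a p)"
    by (intro measurable_component_singleton sort_pair_mem[OF p a(2)])
  then show "(\<lambda>w. w (sort_pair a p)) \<in> \<Omega> \<rightarrow>\<^sub>M Q p" by (simp only: Q_sort_pair[OF a p])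
qed

lemma integral_pull:
  fixes F :: "_ \<Rightarrow> real"
  assumes a: "inj_on a {1..k}" "a \<in> {1..k} \<rightarrow> {1..n}" and F: "F \<in> borel_measurable \<Omega>k"
  shows "(\<integral>w. F (pull k a w) \<partial>\<Omega>) = integral\<^sup>L \<Omega>k F"
    and "integrable \<Omega> (\<lambda>w. F (pull k a w)) \<longleftrightarrow> integrable \<Omega>k F"
proof -
  note m = measurable_pull[OF a]
  show "(\<integral>w. F (pull k a w) \<partial>\<Omega>) = integral\<^sup>L \<Omega>k F"
    by (rule trans[OF integral_distr[OF m F, symmetric]]) (simp only: distr_pull[OF a])
  show "integrable \<Omega> (\<lambda>w. F (pull k a w)) \<longleftrightarrow> integrable \<Omega>k F"
    by (rule trans[OF integrable_distr_eq[OF m F, symmetric]]) (simp only: distr_pull[OF a])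
qed

lemma pull_fun_upd:
  assumes "inj_on a {1..k}" "i \<in> {1..k}"
  shows "pull k a (w((a i, a i) := t)) = (pull k a w)((i, i) := t)"
proof
  fix p
  show "pull k a (w((a i, a i) := t)) p = ((pull k a w)((i, i) := t)) p"
  proof (cases "p \<in> pairs k")
    case True
    then show ?thesis
      using sort_pair_eq_diag[OF True assms] by (simp add: pull_def)
  next
    case False
    then have "p \<noteq> (i, i)" using assms(2) by (auto simp: pairs_def)
    with False show ?thesis by (simp add: pull_def)
  qed
qed

section \<open>First Hoeffding projection of the kernel\<close>

definition mean :: real where "mean = integral\<^sup>L \<Omega>k K"
text \<open>A fixed version of f_1, obtained by freezing the first vertex variable. Where the
  integrand fails to be integrable the Bochner integral is 0; this happens on a null set.\<close>

definition hfun :: "'a \<Rightarrow> real" where "hfun t = (\<integral>w. K (w((1, 1) := t)) \<partial>\<Omega>k) - mean"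
definition vari :: real where "vari = (\<integral>w. (K w - mean)\<^sup>2 \<partial>\<Omega>k)"
definition s1sq :: real where "s1sq = (\<integral>t. (hfun t)\<^sup>2 \<partial>Q (1, 1))"

lemma one_in: "(1, 1) \<in> pairs k" using k_ge by (auto simp: pairs_def)

lemma K_sq: "sq_integrable \<Omega>k K" "sq_integrable \<Omega>k (\<lambda>w. (K w)\<^sup>2)"
  using Nk.P.sq_integrable_of_power4[OF K_meas K4] .

lemma K_int: "integrable \<Omega>k K"
  by (rule Nk.P.sq_integrable_imp_integrable[OF K_sq(1)])

lemma hfun_int: "integrable (Q (1, 1)) hfun" and hfun_zero: "integral\<^sup>L (Q (1, 1)) hfun = 0"
proof -
  note r = Nk.integrable_resample[OF one_in K_int]
  show "integrable (Q (1, 1)) hfun"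
    unfolding hfun_def[abs_def] using r(2) by simp
  show "integral\<^sup>L (Q (1, 1)) hfun = 0"
    unfolding hfun_def[abs_def] using r(2,3) by (simp add: N.M.prob_space mean_def)
qed

lemma hfun_meas: "hfun \<in> borel_measurable (Q (1, 1))" using hfun_int by auto

text \<open>Jensen bounds the fourth power of the regression by the corresponding partial integral
  of K^4, and that of the mean by the full integral; \<open>power4_diff_le\<close> contributes 8 + 8
  = 16.\<close>

lemma hfun4: "integrable (Q (1, 1)) (\<lambda>t. hfun t ^ 4)"
  and hfun4_le: "(\<integral>t. hfun t ^ 4 \<partial>Q (1, 1)) \<le> 16 * (\<integral>w. K w ^ 4 \<partial>\<Omega>k)"
proof -
  let ?e = "\<lambda>t. \<integral>w. K (w((1, 1) := t)) \<partial>\<Omega>k" and ?q = "\<integral>w. K w ^ 4 \<partial>\<Omega>k"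
  let ?G = "\<lambda>t. \<integral>w. K (w((1, 1) := t)) ^ 4 \<partial>\<Omega>k"
  note [measurable] = K_meas hfun_meas
  note r4 = Nk.integrable_resample[OF one_in K4]
  have pow: "(integral\<^sup>L \<Omega>k F) ^ 4 \<le> (\<integral>w. F w ^ 4 \<partial>\<Omega>k)"
    if [measurable]: "F \<in> borel_measurable \<Omega>k" and F4: "integrable \<Omega>k (\<lambda>w. F w ^ 4)" for F :: "_ \<Rightarrow> real"
  proof -
    note sq = Nk.P.sq_integrable_of_power4[OF that]
    have "(integral\<^sup>L \<Omega>k F) ^ 4 = ((integral\<^sup>L \<Omega>k F)\<^sup>2)\<^sup>2" by simp
    also have "\<dots> \<le> (\<integral>w. (F w)\<^sup>2 \<partial>\<Omega>k)\<^sup>2"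
      by (intro power_mono Nk.P.expectation_power2_le sq) simp
    also have "\<dots> \<le> (\<integral>w. ((F w)\<^sup>2)\<^sup>2 \<partial>\<Omega>k)"
      by (intro Nk.P.expectation_power2_le sq)
    finally show ?thesis by simp
  qed
  have mean4: "mean ^ 4 \<le> ?q" unfolding mean_def by (rule pow[OF K_meas K4])
  have upd: "(\<lambda>w. w((1, 1) := t)) \<in> \<Omega>k \<rightarrow>\<^sub>M \<Omega>k" if "t \<in> space (Q (1, 1))" for t
    using that one_in by (intro measurable_fun_upd[where J = "pairs k"]) auto
  have bnd: "AE t in Q (1, 1). hfun t ^ 4 \<le> 8 * ?G t + 8 * ?q"
    using r4(1) AE_space
  proof eventually_elim
    case (elim t)
    have "?e t ^ 4 \<le> ?G t"
      using measurable_compose[OF upd[OF elim(2)] K_meas] elim(1) by (intro pow) auto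
    then show ?case
      using power4_diff_le[of "?e t" mean] mean4 by (simp add: hfun_def)
  qed
  have int: "integrable (Q (1, 1)) (\<lambda>t. 8 * ?G t + 8 * ?q)" using r4(2) by simp
  show h4: "integrable (Q (1, 1)) (\<lambda>t. hfun t ^ 4)"
  proof (rule Bochner_Integration.integrable_bound[OF int])
    show "AE t in Q (1, 1). norm (hfun t ^ 4) \<le> norm (8 * ?G t + 8 * ?q)"
      using bnd by eventually_elim (simp add: abs_le_iff)
  qed measurable
  have "(\<integral>t. hfun t ^ 4 \<partial>Q (1, 1)) \<le> (\<integral>t. 8 * ?G t + 8 * ?q \<partial>Q (1, 1))"
    by (rule integral_mono_AE[OF h4 int bnd])
  also have "\<dots> = 16 * ?q" using r4(2,3) by (simp add: N.M.prob_space)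
  finally show "(\<integral>t. hfun t ^ 4 \<partial>Q (1, 1)) \<le> 16 * ?q" .
qed

lemma hfun_sq: "sq_integrable (Q (1, 1)) hfun"
  using prob_space.sq_integrable_of_power4(1)[OF prob_Q hfun_meas hfun4] .

lemma hfun_component:
  assumes i: "i \<in> {1..n}"
  shows "(i, i) \<in> pairs n" "sq_integrable (Q (i, i)) hfun" "integral\<^sup>L (Q (i, i)) hfun = 0"
    "sq_integrable \<Omega> (\<lambda>w. hfun (w (i, i)))" "(\<integral>w. hfun (w (i, i)) \<partial>\<Omega>) = 0"
    "(\<integral>w. (hfun (w (i, i)))\<^sup>2 \<partial>\<Omega>) = s1sq"
proof -
  show ii: "(i, i) \<in> pairs n" using i by (auto simp: pairs_def)
  show s: "sq_integrable (Q (i, i)) hfun" "integral\<^sup>L (Q (i, i)) hfun = 0"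
    using Q_diag[OF i] hfun_sq hfun_zero by auto
  show "sq_integrable \<Omega> (\<lambda>w. hfun (w (i, i)))" by (rule N.sq_integrable_component[OF ii s(1)])
  have m [measurable]: "hfun \<in> borel_measurable (Q (i, i))" using s(1) by auto
  show "(\<integral>w. hfun (w (i, i)) \<partial>\<Omega>) = 0" using N.integral_component(1)[OF ii m] s(2) by simp
  show "(\<integral>w. (hfun (w (i, i)))\<^sup>2 \<partial>\<Omega>) = s1sq"
    unfolding s1sq_def Q_diag[OF i, symmetric] by (rule N.integral_component(1)[OF ii]) measurable
qed

end

lemma transpose_first_permutes:
  "i \<in> {1..k} \<Longrightarrow> Transposition.transpose 1 i permutes {1..k::nat}"
  by (rule permutes_swap_id) auto

section \<open>Increasing tuples and their degenerate remainders\<close>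

context ustat_product begin

definition incr :: "(nat \<Rightarrow> nat) set" where
  "incr = {\<alpha> \<in> {1..k} \<rightarrow>\<^sub>E {1..n}. strict_mono_on {1..k} \<alpha>}"

definition img :: "(nat \<Rightarrow> nat) \<Rightarrow> nat set" where "img \<alpha> = \<alpha> ` {1..k}"

definition hsum :: "(nat \<Rightarrow> nat) \<Rightarrow> (nat \<times> nat \<Rightarrow> 'a) \<Rightarrow> real" where
  "hsum \<alpha> w = (\<Sum>i\<in>img \<alpha>. hfun (w (i, i)))"

definition u :: "(nat \<Rightarrow> nat) \<Rightarrow> (nat \<times> nat \<Rightarrow> 'a) \<Rightarrow> real" where
  "u \<alpha> w = K (pull k \<alpha> w) - mean - hsum \<alpha> w"

lemma finite_incr: "finite incr"
proof -
  have "finite ({1..k} \<rightarrow>\<^sub>E {1..n})" by (intro finite_PiE) auto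
  then show ?thesis unfolding incr_def by (rule rev_finite_subset) blast
qed

lemma incrD:
  assumes "\<alpha> \<in> incr"
  shows "inj_on \<alpha> {1..k}" "\<alpha> \<in> {1..k} \<rightarrow> {1..n}" "img \<alpha> \<subseteq> {1..n}" "finite (img \<alpha>)" "card (img \<alpha>) = k"
proof -
  show inj: "inj_on \<alpha> {1..k}"
    using assms unfolding incr_def by (blast intro: strict_mono_on_imp_inj_on)
  show "\<alpha> \<in> {1..k} \<rightarrow> {1..n}" using assms unfolding incr_def by (auto simp: PiE_def)
  then show "img \<alpha> \<subseteq> {1..n}" by (auto simp: img_def)
  show "finite (img \<alpha>)" by (simp add: img_def)
  show "card (img \<alpha>) = k" unfolding img_def using card_image[OF inj] by simp
qed

text \<open>Symmetry of the kernel moves any vertex of the tuple to the first place, by a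
  transposition. The price is monotonicity: the new tuple is only injective. Facts about the first
  argument thereby reach every vertex.\<close>

lemma relabel:
  assumes \<alpha>: "\<alpha> \<in> incr" and i: "i \<in> img \<alpha>"
  obtains a where "inj_on a {1..k}" "a \<in> {1..k} \<rightarrow> {1..n}" "a 1 = i"
    "\<And>w. w \<in> space \<Omega> \<Longrightarrow> K (pull k \<alpha> w) = K (pull k a w)"
proof -
  obtain j where j: "j \<in> {1..k}" "\<alpha> j = i" using i by (auto simp: img_def)
  let ?\<pi> = "Transposition.transpose 1 j"
  have \<pi>: "?\<pi> permutes {1..k}" by (rule transpose_first_permutes[OF j(1)])
  have \<pi>_mem: "?\<pi> \<in> {1..k} \<rightarrow> {1..k}" using permutes_in_image[OF \<pi>] by blast
  show ?thesis
  proof (rule that)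
    show "inj_on (\<alpha> \<circ> ?\<pi>) {1..k}"
      using incrD(1)[OF \<alpha>] permutes_inj_on[OF \<pi>] permutes_image[OF \<pi>] by (intro comp_inj_on) simp_all
    show "\<alpha> \<circ> ?\<pi> \<in> {1..k} \<rightarrow> {1..n}" using incrD(2)[OF \<alpha>] \<pi>_mem by fastforce
    show "(\<alpha> \<circ> ?\<pi>) 1 = i" using j by simp
    fix w assume w: "w \<in> space \<Omega>"
    have "pull k (\<alpha> \<circ> ?\<pi>) w = pull k ?\<pi> (pull k \<alpha> w)"
      using sort_pair_mem[OF _ \<pi>_mem] by (auto simp: pull_def sort_pair_comp)
    moreover have "pull k \<alpha> w \<in> space \<Omega>k"
      by (rule measurable_space[OF measurable_pull[OF incrD(1,2)[OF \<alpha>]] w])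
    ultimately show "K (pull k \<alpha> w) = K (pull k (\<alpha> \<circ> ?\<pi>) w)"
      using K_sym[OF \<pi>] by simp
  qed
qed

lemma K_pull_sq:
  assumes "\<alpha> \<in> incr"
  shows "sq_integrable \<Omega> (\<lambda>w. K (pull k \<alpha> w))"
proof -
  note m = incrD(1,2)[OF assms]
  have "(\<lambda>w. K (pull k \<alpha> w)) \<in> borel_measurable \<Omega>"
    by (rule measurable_compose[OF measurable_pull[OF m] K_meas])
  moreover have "integrable \<Omega> (\<lambda>w. (K (pull k \<alpha> w))\<^sup>2)"
    using integral_pull(2)[OF m, of "\<lambda>w. (K w)\<^sup>2"] sq_integrableD[OF K_sq(1)] K_meas by simp
  ultimately show ?thesis by (simp add: sq_integrable_def)
qed

lemma hsum_sq: "\<alpha> \<in> incr \<Longrightarrow> sq_integrable \<Omega> (hsum \<alpha>)"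
  unfolding hsum_def[abs_def] using incrD(3) by (intro sq_integrable_sum hfun_component) blast

lemma u_sq: "\<alpha> \<in> incr \<Longrightarrow> sq_integrable \<Omega> (u \<alpha>)"
  unfolding u_def[abs_def] by (intro sq_integrable_diff K_pull_sq hsum_sq N.P.sq_integrable_const)

lemma space_fun_upd: "w \<in> space \<Omega> \<Longrightarrow> p \<in> pairs n \<Longrightarrow> t \<in> space (Q p) \<Longrightarrow> w(p := t) \<in> space \<Omega>"
  by (auto simp: space_PiM PiE_iff extensional_def)

text \<open>Given the variable at vertex i, the kernel has mean \<open>hfun t + mean\<close> by
  \<open>relabel\<close>, while \<open>hsum\<close> contributes \<open>hfun t\<close> from i itself
  and 0 from the other vertices; everything cancels.\<close>

lemma u_regression:
  assumes \<alpha>: "\<alpha> \<in> incr" and i: "i \<in> img \<alpha>"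
  shows "AE t in Q (i, i). (\<integral>w. u \<alpha> (w((i, i) := t)) \<partial>\<Omega>) = 0"
proof -
  have i_in: "i \<in> {1..n}" using incrD(3)[OF \<alpha>] i by blast
  note ii = hfun_component(1)[OF i_in]
  obtain a where a: "inj_on a {1..k}" "a \<in> {1..k} \<rightarrow> {1..n}" and a1: "a 1 = i"
    and K_eq: "\<And>w. w \<in> space \<Omega> \<Longrightarrow> K (pull k \<alpha> w) = K (pull k a w)"
    using relabel[OF \<alpha> i] by metis
  have one: "1 \<in> {1..k}" using k_ge by simp
  have "AE t in Q (i, i). integrable \<Omega>k (\<lambda>w. K (w((1, 1) := t)))"
    unfolding Q_diag[OF i_in] by (rule Nk.integrable_resample(1)[OF one_in K_int])
  then show ?thesis
    using AE_space
  proof eventually_elim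
    case (elim t)
    have t1: "t \<in> space (Q (1, 1))" using elim(2) unfolding Q_diag[OF i_in] .
    have "(\<lambda>w. w((1, 1) := t)) \<in> \<Omega>k \<rightarrow>\<^sub>M \<Omega>k"
      using t1 one_in by (intro measurable_fun_upd[where J = "pairs k"]) auto
    from measurable_compose[OF this K_meas]
    have F: "(\<lambda>w. K (w((1, 1) := t))) \<in> borel_measurable \<Omega>k" .
    have eq: "K (pull k \<alpha> (w((i, i) := t))) = K ((pull k a w)((1, 1) := t))" if "w \<in> space \<Omega>" for w
      using K_eq[OF space_fun_upd[OF that ii elim(2)]] pull_fun_upd[OF a(1) one, of w t] a1 by simp
    have intK: "integrable \<Omega> (\<lambda>w. K (pull k \<alpha> (w((i, i) := t))))"
      using integral_pull(2)[OF a F] elim(1) eq by (simp cong: Bochner_Integration.integrable_cong)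
    have valK: "(\<integral>w. K (pull k \<alpha> (w((i, i) := t))) \<partial>\<Omega>) = hfun t + mean"
      using integral_pull(1)[OF a F] eq by (simp add: hfun_def cong: Bochner_Integration.integral_cong)
    have hs: "hsum \<alpha> (w((i, i) := t)) = hfun t + (\<Sum>j\<in>img \<alpha> - {i}. hfun (w (j, j)))" for w :: "_ \<Rightarrow> 'a"
    proof -
      have "hsum \<alpha> (w((i, i) := t)) = hfun t + (\<Sum>j\<in>img \<alpha> - {i}. hfun ((w((i, i) := t)) (j, j)))"
        unfolding hsum_def using incrD(4)[OF \<alpha>] i by (simp add: sum.remove)
      also have "(\<Sum>j\<in>img \<alpha> - {i}. hfun ((w((i, i) := t)) (j, j))) = (\<Sum>j\<in>img \<alpha> - {i}. hfun (w (j, j)))"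
        by (rule sum.cong) auto
      finally show ?thesis .
    qed
    have inth: "integrable \<Omega> (\<lambda>w. hfun (w (j, j)))" if "j \<in> img \<alpha> - {i}" for j
      using that incrD(3)[OF \<alpha>] by (intro N.P.sq_integrable_imp_integrable hfun_component) blast
    have inths: "integrable \<Omega> (\<lambda>w. \<Sum>j\<in>img \<alpha> - {i}. hfun (w (j, j)))"
      by (intro Bochner_Integration.integrable_sum inth)
    have valh: "(\<integral>w. (\<Sum>j\<in>img \<alpha> - {i}. hfun (w (j, j))) \<partial>\<Omega>) = 0"
      by (subst Bochner_Integration.integral_sum[OF inth])
        (use incrD(3)[OF \<alpha>] in \<open>auto intro!: sum.neutral hfun_component(5)\<close>)
    have "(\<integral>w. u \<alpha> (w((i, i) := t)) \<partial>\<Omega>)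
      = (\<integral>w. K (pull k \<alpha> (w((i, i) := t))) - (mean + hfun t) - (\<Sum>j\<in>img \<alpha> - {i}. hfun (w (j, j))) \<partial>\<Omega>)"
      unfolding u_def hs by (simp add: algebra_simps)
    also have "\<dots> = (hfun t + mean) - (mean + hfun t) - 0"
      using intK inths by (simp add: valK valh N.P.prob_space)
    finally show ?case by simp
  qed
qed

lemma hfun_depends: "depends_on \<Omega> {(j, j)} (\<lambda>w. hfun (w (j, j)))"
  by (rule N.depends_on_component)

lemma u_depends:
  assumes "\<alpha> \<in> incr" shows "depends_on \<Omega> (block n (img \<alpha>)) (u \<alpha>)"
  unfolding depends_on_def
proof (intro ballI impI)
  fix w w' :: "nat \<times> nat \<Rightarrow> 'a" assume eq: "\<forall>i\<in>block n (img \<alpha>). w i = w' i"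
  have \<alpha>: "\<alpha> \<in> {1..k} \<rightarrow> img \<alpha>" by (auto simp: img_def)
  have "pull k \<alpha> w = pull k \<alpha> w'"
    unfolding pull_def using sort_pair_in_pairs[OF _ \<alpha> incrD(3)[OF assms]] eq
    by (intro restrict_ext) blast
  moreover have "hsum \<alpha> w = hsum \<alpha> w'"
    unfolding hsum_def
  proof (intro sum.cong refl arg_cong[where f = hfun])
    fix i assume "i \<in> img \<alpha>"
    then have "(i, i) \<in> block n (img \<alpha>)"
      using incrD(3)[OF assms] by (auto simp: block_def pairs_def)
    then show "w (i, i) = w' (i, i)" using eq by blast
  qed
  ultimately show "u \<alpha> w = u \<alpha> w'" by (simp add: u_def)
qed

lemma block_subset: "block n V \<subseteq> pairs n" by (auto simp: block_def)

text \<open>A coordinate above the diagonal is common to both blocks only if two vertices are. With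
  at most one common vertex the blocks meet at most in one loop, and the regression of
  \<open>u \<alpha>\<close> on that loop vanishes. For disjoint tuples any vertex of \<alpha> serves
  as pivot.\<close>

lemma u_orthogonal:
  assumes \<alpha>: "\<alpha> \<in> incr" and \<beta>: "\<beta> \<in> incr" and le: "card (img \<alpha> \<inter> img \<beta>) \<le> 1"
  shows "(\<integral>w. u \<alpha> w * u \<beta> w \<partial>\<Omega>) = 0"
proof -
  have fin: "finite (img \<alpha> \<inter> img \<beta>)" using incrD(4)[OF \<alpha>] by simp
  have ne: "img \<alpha> \<noteq> {}" using k_ge by (simp add: img_def)
  obtain i where i: "i \<in> img \<alpha>" "img \<alpha> \<inter> img \<beta> \<subseteq> {i}"
  proof (cases "img \<alpha> \<inter> img \<beta> = {}")
    case True
    then show ?thesis using that ne by blast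
  next
    case False
    then have "card (img \<alpha> \<inter> img \<beta>) = 1" using le fin by (simp add: le_antisym card_gt_0_iff Suc_leI)
    then show ?thesis using that by (metis card_1_singletonE Int_iff insertI1 order_refl)
  qed
  show ?thesis
  proof (rule N.integral_mult_orthogonal[where A = "block n (img \<alpha>)" and B = "block n (img \<beta>)" and p = "(i, i)"])
    show "(i, i) \<in> pairs n" using i incrD(3)[OF \<alpha>] hfun_component(1) by blast
    show "block n (img \<alpha>) \<inter> block n (img \<beta>) \<subseteq> {(i, i)}"
    proof
      fix p assume "p \<in> block n (img \<alpha>) \<inter> block n (img \<beta>)"
      then have "fst p \<in> img \<alpha> \<inter> img \<beta>" "snd p \<in> img \<alpha> \<inter> img \<beta>" by (auto simp: block_def)
      then have "fst p = i" "snd p = i" using i by blast+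
      then show "p \<in> {(i, i)}" by (simp add: prod_eq_iff)
    qed
    show "integrable \<Omega> (u \<alpha>)" by (rule N.P.sq_integrable_imp_integrable[OF u_sq[OF \<alpha>]])
    show "integrable \<Omega> (\<lambda>w. u \<alpha> w * u \<beta> w)" by (rule sq_integrable_mult[OF u_sq[OF \<alpha>] u_sq[OF \<beta>]])
  qed (use block_subset u_depends[OF \<alpha>] u_depends[OF \<beta>] u_regression[OF \<alpha> i(1)] in blast)+
qed

text \<open>The same pivot argument with a single loop as second block. If j lies outside the tuple,
  any vertex of \<alpha> can be the pivot.\<close>

lemma u_hfun_orthogonal:
  assumes \<alpha>: "\<alpha> \<in> incr" and j: "j \<in> {1..n}"
  shows "(\<integral>w. u \<alpha> w * hfun (w (j, j)) \<partial>\<Omega>) = 0"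
proof -
  have ne: "img \<alpha> \<noteq> {}" using k_ge by (simp add: img_def)
  obtain i where i: "i \<in> img \<alpha>" "img \<alpha> \<inter> {j} \<subseteq> {i}"
  proof (cases "j \<in> img \<alpha>")
    case True
    then show ?thesis using that by blast
  next
    case False
    then show ?thesis using that ne by blast
  qed
  show ?thesis
  proof (rule N.integral_mult_orthogonal[where A = "block n (img \<alpha>)" and B = "{(j, j)}" and p = "(i, i)"])
    show "(i, i) \<in> pairs n" using i incrD(3)[OF \<alpha>] hfun_component(1) by blast
    show "block n (img \<alpha>) \<inter> {(j, j)} \<subseteq> {(i, i)}"
      using i by (auto simp: block_def)
    show "{(j, j)} \<subseteq> pairs n" using hfun_component(1)[OF j] by simp
    show "integrable \<Omega> (u \<alpha>)" by (rule N.P.sq_integrable_imp_integrable[OF u_sq[OF \<alpha>]])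
    show "integrable \<Omega> (\<lambda>w. u \<alpha> w * hfun (w (j, j)))"
      by (rule sq_integrable_mult[OF u_sq[OF \<alpha>] hfun_component(4)[OF j]])
  qed (use block_subset u_depends[OF \<alpha>] hfun_depends u_regression[OF \<alpha> i(1)] in blast)+
qed

lemma integral_hfun_sum_power2:
  assumes "V \<subseteq> {1..n}"
  shows "(\<integral>w. (\<Sum>i\<in>V. c * hfun (w (i, i)))\<^sup>2 \<partial>\<Omega>) = real (card V) * (c\<^sup>2 * s1sq)"
proof -
  let ?D = "(\<lambda>i. (i, i)) ` V"
  have inj: "inj_on (\<lambda>i. (i, i)) V" by (simp add: inj_on_def)
  have D: "?D \<subseteq> pairs n" using assms hfun_component(1) by blast
  have "(\<integral>w. (\<Sum>p\<in>?D. c * hfun (w p))\<^sup>2 \<partial>\<Omega>) = (\<Sum>p\<in>?D. \<integral>t. (c * hfun t)\<^sup>2 \<partial>Q p)"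
  proof (rule N.integral_sum_components_power2[OF D])
    fix p assume "p \<in> ?D"
    then obtain i where i: "i \<in> {1..n}" "p = (i, i)" using assms by blast
    show "sq_integrable (Q p) (\<lambda>t. c * hfun t)" "(\<integral>t. c * hfun t \<partial>Q p) = 0"
      unfolding i(2) using hfun_component(2,3)[OF i(1)] by (auto intro: sq_integrable_cmult)
  qed
  also have "\<dots> = (\<Sum>i\<in>V. c\<^sup>2 * s1sq)"
  proof -
    have "(\<integral>t. (c * hfun t)\<^sup>2 \<partial>Q (i, i)) = c\<^sup>2 * s1sq" if "i \<in> V" for i
    proof -
      have i: "i \<in> {1..n}" using assms that by blast
      show ?thesis unfolding s1sq_def Q_diag[OF i] by (simp add: power_mult_distrib)
    qed
    then show ?thesis by (simp add: sum.reindex[OF inj])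
  qed
  finally show ?thesis by (simp add: sum.reindex[OF inj])
qed

lemma s1sq_nonneg: "0 \<le> s1sq" by (simp add: s1sq_def)

text \<open>Pythagoras: the variance of a summand is the second moment of \<open>u \<alpha>\<close>
  plus k times \<open>s1sq\<close>. One copy is kept on the left so that
  \<open>s1sq \<le> vari\<close> can be read off as well.\<close>

lemma u_power2_le:
  assumes \<alpha>: "\<alpha> \<in> incr"
  shows "(\<integral>w. (u \<alpha> w)\<^sup>2 \<partial>\<Omega>) + s1sq \<le> vari"
proof -
  note m = incrD(1,2)[OF \<alpha>]
  note [measurable] = K_meas
  have uh: "(\<integral>w. u \<alpha> w * hsum \<alpha> w \<partial>\<Omega>) = 0"
  proof -
    have i: "integrable \<Omega> (\<lambda>w. u \<alpha> w * hfun (w (j, j)))" if "j \<in> img \<alpha>" for j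
      using that incrD(3)[OF \<alpha>] by (intro sq_integrable_mult u_sq \<alpha> hfun_component(4)) blast
    have "(\<integral>w. u \<alpha> w * hsum \<alpha> w \<partial>\<Omega>) = (\<Sum>j\<in>img \<alpha>. \<integral>w. u \<alpha> w * hfun (w (j, j)) \<partial>\<Omega>)"
      unfolding hsum_def sum_distrib_left by (rule Bochner_Integration.integral_sum[OF i])
    also have "\<dots> = 0"
      using incrD(3)[OF \<alpha>] by (intro sum.neutral ballI u_hfun_orthogonal[OF \<alpha>]) blast
    finally show ?thesis .
  qed
  have hh: "(\<integral>w. (hsum \<alpha> w)\<^sup>2 \<partial>\<Omega>) = real k * s1sq"
    using integral_hfun_sum_power2[OF incrD(3)[OF \<alpha>], of 1] incrD(5)[OF \<alpha>] by (simp add: hsum_def)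
  have "vari = (\<integral>w. (K (pull k \<alpha> w) - mean)\<^sup>2 \<partial>\<Omega>)"
    unfolding vari_def by (rule integral_pull(1)[OF m, symmetric]) measurable
  also have "\<dots> = (\<integral>w. (u \<alpha> w)\<^sup>2 + (hsum \<alpha> w)\<^sup>2 + 2 * (u \<alpha> w * hsum \<alpha> w) \<partial>\<Omega>)"
  proof (rule Bochner_Integration.integral_cong[OF refl])
    fix w
    have "K (pull k \<alpha> w) - mean = u \<alpha> w + hsum \<alpha> w" by (simp add: u_def)
    then show "(K (pull k \<alpha> w) - mean)\<^sup>2 = (u \<alpha> w)\<^sup>2 + (hsum \<alpha> w)\<^sup>2 + 2 * (u \<alpha> w * hsum \<alpha> w)"
      by (simp only: power2_sum mult.assoc)
  qed
  also have "\<dots> = (\<integral>w. (u \<alpha> w)\<^sup>2 \<partial>\<Omega>) + real k * s1sq"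
    using sq_integrableD(2)[OF u_sq[OF \<alpha>]] sq_integrableD(2)[OF hsum_sq[OF \<alpha>]] sq_integrable_mult[OF u_sq[OF \<alpha>] hsum_sq[OF \<alpha>]]
    by (simp add: uh hh)
  finally have "vari = (\<integral>w. (u \<alpha> w)\<^sup>2 \<partial>\<Omega>) + real k * s1sq" .
  moreover have "1 * s1sq \<le> real k * s1sq"
    using k_ge by (intro mult_right_mono s1sq_nonneg) simp
  ultimately show ?thesis by simp
qed

lemma u_mult_le:
  assumes "\<alpha> \<in> incr" "\<beta> \<in> incr"
  shows "(\<integral>w. u \<alpha> w * u \<beta> w \<partial>\<Omega>) \<le> vari"
proof -
  have le: "(\<integral>w. (u \<gamma> w)\<^sup>2 \<partial>\<Omega>) \<le> vari" if "\<gamma> \<in> incr" for \<gamma>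
    using u_power2_le[OF that] s1sq_nonneg by linarith
  have nn: "0 \<le> vari" by (simp add: vari_def)
  have "(\<integral>w. u \<alpha> w * u \<beta> w \<partial>\<Omega>) \<le> (\<integral>w. \<bar>u \<alpha> w * u \<beta> w\<bar> \<partial>\<Omega>)"
    using integral_abs_bound[of \<Omega> "\<lambda>w. u \<alpha> w * u \<beta> w"] by linarith
  also have "\<dots> \<le> sqrt ((\<integral>w. (u \<alpha> w)\<^sup>2 \<partial>\<Omega>) * (\<integral>w. (u \<beta> w)\<^sup>2 \<partial>\<Omega>))"
    by (intro Cauchy_Schwarz_integral u_sq assms)
  also have "\<dots> \<le> sqrt (vari * vari)"
    by (intro real_sqrt_le_mono mult_mono le assms nn) simp
  finally show ?thesis using nn by simp
qed

text \<open>Products with at most one common vertex integrate to 0 and the others to at most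
  \<open>vari\<close>, so only counting is left. The set X will be all tuples, or those through one
  vertex.\<close>

lemma u_sum_power2_le:
  assumes X: "X \<subseteq> incr"
  shows "(\<integral>w. (\<Sum>\<alpha>\<in>X. u \<alpha> w)\<^sup>2 \<partial>\<Omega>)
      \<le> real (card {(\<alpha>, \<beta>) \<in> X \<times> X. 2 \<le> card (img \<alpha> \<inter> img \<beta>)}) * vari"
proof -
  have fin: "finite X" using X finite_incr by (rule finite_subset)
  have i: "integrable \<Omega> (\<lambda>w. u (fst ab) w * u (snd ab) w)" if "ab \<in> X \<times> X" for ab
    using that X by (intro sq_integrable_mult u_sq) auto
  let ?G = "{(\<alpha>, \<beta>) \<in> X \<times> X. 2 \<le> card (img \<alpha> \<inter> img \<beta>)}"
  have "(\<integral>w. (\<Sum>\<alpha>\<in>X. u \<alpha> w)\<^sup>2 \<partial>\<Omega>) = (\<integral>w. (\<Sum>ab\<in>X \<times> X. u (fst ab) w * u (snd ab) w) \<partial>\<Omega>)"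
    by (simp add: power2_eq_square sum_product sum.cartesian_product case_prod_beta')
  also have "\<dots> = (\<Sum>ab\<in>X \<times> X. \<integral>w. u (fst ab) w * u (snd ab) w \<partial>\<Omega>)"
    by (rule Bochner_Integration.integral_sum[OF i])
  also have "\<dots> = (\<Sum>ab\<in>?G. \<integral>w. u (fst ab) w * u (snd ab) w \<partial>\<Omega>)"
  proof (rule sum.mono_neutral_right)
    show "\<forall>ab\<in>X \<times> X - ?G. (\<integral>w. u (fst ab) w * u (snd ab) w \<partial>\<Omega>) = 0"
    proof
      fix ab assume ab: "ab \<in> X \<times> X - ?G"
      then have "card (img (fst ab) \<inter> img (snd ab)) \<le> 1" by (cases ab) auto
      then show "(\<integral>w. u (fst ab) w * u (snd ab) w \<partial>\<Omega>) = 0"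
        using ab X by (intro u_orthogonal) auto
    qed
  qed (use fin in auto)
  also have "\<dots> \<le> (\<Sum>ab\<in>?G. vari)"
    using X by (intro sum_mono u_mult_le) auto
  finally show ?thesis by simp
qed

end

section \<open>Overlapping index tuples and the convergence rate\<close>

lemma card_subsets_above:
  assumes "finite A" "B \<subseteq> A" "card B \<le> k"
  shows "card {V. V \<subseteq> A \<and> card V = k \<and> B \<subseteq> V} = (card A - card B) choose (k - card B)"
proof -
  have finB: "finite B" using assms finite_subset by blast
  have "bij_betw (\<lambda>V. V - B) {V. V \<subseteq> A \<and> card V = k \<and> B \<subseteq> V} {W. W \<subseteq> A - B \<and> card W = k - card B}"
  proof (rule bij_betw_byWitness[where f' = "\<lambda>W. W \<union> B"])
    show "\<forall>V\<in>{V. V \<subseteq> A \<and> card V = k \<and> B \<subseteq> V}. V - B \<union> B = V" by blast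
    show "\<forall>W\<in>{W. W \<subseteq> A - B \<and> card W = k - card B}. W \<union> B - B = W" by blast
    show "(\<lambda>V. V - B) ` {V. V \<subseteq> A \<and> card V = k \<and> B \<subseteq> V} \<subseteq> {W. W \<subseteq> A - B \<and> card W = k - card B}"
      using finB by (auto simp: card_Diff_subset)
    show "(\<lambda>W. W \<union> B) ` {W. W \<subseteq> A - B \<and> card W = k - card B} \<subseteq> {V. V \<subseteq> A \<and> card V = k \<and> B \<subseteq> V}"
    proof
      fix V assume "V \<in> (\<lambda>W. W \<union> B) ` {W. W \<subseteq> A - B \<and> card W = k - card B}"
      then obtain W where W: "W \<subseteq> A - B" "card W = k - card B" "V = W \<union> B" by blast
      then have "card V = card W + card B"
        using finB assms(1) by (metis card_Un_disjoint Diff_disjoint finite_Diff finite_subset inf_commute inf_mono le_bot order_refl)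
      then show "V \<in> {V. V \<subseteq> A \<and> card V = k \<and> B \<subseteq> V}" using W assms by auto
    qed
  qed
  then have "card {V. V \<subseteq> A \<and> card V = k \<and> B \<subseteq> V} = card {W. W \<subseteq> A - B \<and> card W = k - card B}"
    by (rule bij_betw_same_card)
  also have "\<dots> = card (A - B) choose (k - card B)"
    using assms(1) by (intro n_subsets) simp
  finally show ?thesis using assms finB by (simp add: card_Diff_subset)
qed

text \<open>Here a and b count the tuples through one and two given vertices, s is sigma_1^2, v the
  kernel variance, q its fourth moment, V the total variance, and B bounds the second moment of the
  remainder through one vertex. The left side is that of \<open>nonlinear_berry_esseen\<close>: 2 +
  1 + 4 multiples of sqrt(Y) and (5/2) * 4 = 10 multiples of Z.\<close>

lemma berry_esseen_rate:
  fixes a b q s v V U2 h4 :: real and n k :: nat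
  defines "B \<equiv> (real n - 1) * b\<^sup>2 * v"
  assumes k: "1 \<le> k" "k \<le> n" and a: "0 < a" and ab: "(real n - 1) * b = (real k - 1) * a"
    and s: "0 < s" "s \<le> v" and v: "v \<le> sqrt q" and U2: "0 \<le> U2" "U2 \<le> real n * B"
    and h4: "0 \<le> h4" "h4 \<le> 16 * q" and V: "V = U2 + real n * (a\<^sup>2 * s)"
  shows "2 * sqrt (U2 / V) + \<bar>1 - real n * (a\<^sup>2 * s / V)\<bar> + 5 / 2 * sqrt (real n * (a ^ 4 * h4 / V\<^sup>2))
      + real n * (4 * sqrt (a\<^sup>2 * s / V * (B / V))) \<le> 12 * real k * sqrt q / (sqrt (real n) * s)"
proof -
  \<comment> \<open>D is the variance of the linear part, Y a bound for the remainder's share of the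
    total variance, Z the target rate without 12 k.\<close>
  define D where "D = real n * (a\<^sup>2 * s)"
  define Y where "Y = B / (a\<^sup>2 * s)"
  define Z where "Z = sqrt q / (sqrt (real n) * s)"
  have n: "0 < real n" "1 \<le> real n" using k by simp_all
  have as: "0 < a\<^sup>2 * s" using a s by simp
  have D: "0 < D" using n as by (simp add: D_def)
  have VD: "D \<le> V" "0 < V" using D U2 V by (simp_all add: D_def)
  have v0: "0 < v" using s by simp
  then have "0 < sqrt q" using v by linarith
  then have q: "0 < q" by simp
  have B: "0 \<le> B" unfolding B_def using n v0 by simp
  have Y: "0 \<le> Y" using B as by (simp add: Y_def)
  have Z: "0 \<le> Z" using q s by (simp add: Z_def)
  have r1: "U2 / V \<le> Y"
  proof -
    have "U2 / V \<le> real n * B / D" using U2 VD D by (intro frac_le) auto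
    also have "\<dots> = Y" using n by (simp add: D_def Y_def)
    finally show ?thesis .
  qed
  have VD_eq: "V - D = U2" unfolding V D_def by simp
  have r2: "0 \<le> U2 / V" using U2(1) VD(2) by simp
  have r2': "U2 / V \<le> 1" using VD_eq D VD(2) by (subst divide_le_eq_1_pos) linarith+
  have t1: "sqrt (U2 / V) \<le> sqrt Y" using r1 by simp
  have t2: "\<bar>1 - real n * (a\<^sup>2 * s / V)\<bar> \<le> sqrt Y"
  proof -
    have "1 - real n * (a\<^sup>2 * s / V) = (V - D) / V"
      unfolding D_def times_divide_eq_right[symmetric] diff_divide_distrib using VD(2) by simp
    then have "1 - real n * (a\<^sup>2 * s / V) = U2 / V" unfolding VD_eq .
    \<comment> \<open>The variance defect equals the share \<open>U2 / V\<close>, which is at most 1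
      and so lies below its own root.\<close>
    moreover have "U2 / V \<le> sqrt (U2 / V)"
      using mult_left_le[OF r2' r2] by (intro real_le_rsqrt) (simp only: power2_eq_square)
    ultimately show ?thesis using r2 t1 unfolding abs_le_iff by linarith
  qed
  have t3: "sqrt (real n * (a ^ 4 * h4 / V\<^sup>2)) \<le> 4 * Z"
  proof -
    have "real n * (a ^ 4 * h4 / V\<^sup>2) \<le> real n * (a ^ 4 * (16 * q) / D\<^sup>2)"
      using h4 VD D q by (intro mult_left_mono frac_le power_mono) auto
    also have "\<dots> = (4 * Z)\<^sup>2"
    proof -
      have "D\<^sup>2 = a ^ 4 * (real n * (real n * s\<^sup>2))"
        by (simp add: D_def power_mult_distrib power2_eq_square[of "real n"])
      then have "real n * (a ^ 4 * (16 * q) / D\<^sup>2) = 16 * q / (real n * s\<^sup>2)"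
        using n a s by simp
      also have "\<dots> = (4 * Z)\<^sup>2"
        using q n by (simp add: Z_def power_mult_distrib power_divide)
      finally show ?thesis .
    qed
    finally have "sqrt (real n * (a ^ 4 * h4 / V\<^sup>2)) \<le> sqrt ((4 * Z)\<^sup>2)" by (rule real_sqrt_le_mono)
    also have "\<dots> = 4 * Z" using Z by (intro real_sqrt_unique) simp_all
    finally show ?thesis .
  qed
  have t4: "real n * (4 * sqrt (a\<^sup>2 * s / V * (B / V))) \<le> 4 * sqrt Y"
  proof -
    have "a\<^sup>2 * s / V * (B / V) \<le> a\<^sup>2 * s / D * (B / D)"
      using as s B VD D by (intro mult_mono frac_le) auto
    also have "\<dots> = Y / (real n)\<^sup>2"
      using n a s by (simp add: D_def Y_def power2_eq_square)
    finally have "sqrt (a\<^sup>2 * s / V * (B / V)) \<le> sqrt (Y / (real n)\<^sup>2)" by (rule real_sqrt_le_mono)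
    also have "\<dots> = sqrt Y / real n" using n by (simp add: real_sqrt_divide)
    finally have "real n * sqrt (a\<^sup>2 * s / V * (B / V)) \<le> real n * (sqrt Y / real n)"
      using n by (intro mult_left_mono) auto
    also have "\<dots> = sqrt Y" using n by simp
    finally show ?thesis by simp
  qed
  \<comment> \<open>The counting relation gives Y = (k - 1)^2 v / (s (n - 1)). Then v s \<le> v^2
    \<le> q turns v / s into q / s^2, and n - 1 \<ge> n / 2 produces the factor 2.\<close>
  have YZ: "Y \<le> 2 * ((real k - 1) * Z)\<^sup>2"
  proof (cases "n = 1")
    case True
    \<comment> \<open>B carries the factor n - 1, which is 0 here.\<close>
    then show ?thesis by (simp add: Y_def B_def)
  next
    case False
    then have n2: "2 \<le> real n" using k by simp
    have "(real n - 1) * b\<^sup>2 * (real n - 1) = ((real n - 1) * b)\<^sup>2"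
      by (simp only: power2_eq_square mult_ac)
    also have "\<dots> = (real k - 1)\<^sup>2 * a\<^sup>2" by (simp only: ab power_mult_distrib)
    finally have "(real n - 1) * b\<^sup>2 * (real n - 1) = (real k - 1)\<^sup>2 * a\<^sup>2" .
    moreover have nz: "real n - 1 \<noteq> 0" using n2 by simp
    ultimately have "(real n - 1) * b\<^sup>2 = (real k - 1)\<^sup>2 * a\<^sup>2 / (real n - 1)"
      by (metis nonzero_eq_divide_eq)
    then have "B = (real k - 1)\<^sup>2 * a\<^sup>2 / (real n - 1) * v" unfolding B_def by (simp only:)
    then have "Y = (real k - 1)\<^sup>2 * a\<^sup>2 / (real n - 1) * v / (a\<^sup>2 * s)" unfolding Y_def by (simp only:)
    also have "\<dots> = (real k - 1)\<^sup>2 * ((v / s) * (1 / (real n - 1)))"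
      using a by simp
    also have "\<dots> \<le> (real k - 1)\<^sup>2 * (q / s\<^sup>2 * (2 / real n))"
    proof (intro mult_left_mono mult_mono)
      have "v * s \<le> v * v" using s v0 by (intro mult_left_mono) auto
      also have "\<dots> \<le> sqrt q * sqrt q" using v v0 q by (intro mult_mono) auto
      also have "\<dots> = q" using q by simp
      finally have "v * s / s\<^sup>2 \<le> q / s\<^sup>2" by (rule divide_right_mono) simp
      then show "v / s \<le> q / s\<^sup>2" using s by (simp add: power2_eq_square)
      have "1 / (real n - 1) = 2 / (2 * (real n - 1))"
        by (metis mult_divide_mult_cancel_left mult.right_neutral zero_neq_numeral)
      also have "\<dots> \<le> 2 / real n" using n2 by (intro divide_left_mono) auto
      finally show "1 / (real n - 1) \<le> 2 / real n" .
      show "0 \<le> q / s\<^sup>2" using q by simp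
      show "0 \<le> 1 / (real n - 1)" using n2 by simp
    qed simp
    also have "\<dots> = 2 * ((real k - 1)\<^sup>2 * (q / (real n * s\<^sup>2)))" by (simp add: mult_ac)
    also have "q / (real n * s\<^sup>2) = Z\<^sup>2"
      using q n by (simp add: Z_def power_mult_distrib power_divide)
    also have "2 * ((real k - 1)\<^sup>2 * Z\<^sup>2) = 2 * ((real k - 1) * Z)\<^sup>2"
      by (simp only: power_mult_distrib)
    finally show ?thesis .
  qed
  \<comment> \<open>Numerically 49 * 2 = 98 \<le> 100.\<close>
  have "7 * sqrt Y \<le> 10 * ((real k - 1) * Z)"
  proof -
    have kZ: "0 \<le> (real k - 1) * Z" using k Z by simp
    have "(7 * sqrt Y)\<^sup>2 = 49 * Y" using Y by (simp add: power_mult_distrib)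
    also have "\<dots> \<le> 100 * ((real k - 1) * Z)\<^sup>2"
      using YZ zero_le_power2[of "(real k - 1) * Z"] by linarith
    also have "\<dots> = (10 * ((real k - 1) * Z))\<^sup>2" by (simp add: power_mult_distrib)
    finally show ?thesis by (rule power2_le_imp_le) (use kZ in simp)
  qed
  \<comment> \<open>The sum is 10 k Z, rounded up to 12 k Z.\<close>
  moreover have "10 * ((real k - 1) * Z) + 10 * Z \<le> 12 * (real k * Z)"
  proof -
    have "10 * ((real k - 1) * Z) + 10 * Z = 10 * (real k * Z)"
      by (simp only: left_diff_distrib right_diff_distrib mult_1)
    moreover have "0 \<le> real k * Z" using Z by simp
    ultimately show ?thesis by linarith
  qed
  ultimately have "7 * sqrt Y + 10 * Z \<le> 12 * (real k * Z)" by linarith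
  moreover have "2 * x1 + x2 + 5 / 2 * x3 + x4 \<le> 7 * y + 10 * z"
    if "x1 \<le> y" "x2 \<le> y" "x3 \<le> 4 * z" "x4 \<le> 4 * y" for x1 x2 x3 x4 y z :: real
    using that by linarith
  note this[OF t1 t2 t3 t4]
  ultimately show ?thesis unfolding Z_def by simp
qed

section \<open>Counting increasing tuples through their vertex sets\<close>

context ustat_product begin

text \<open>A strictly increasing tuple is the sorted enumeration of its vertex set, and
  extensionality fixes its values outside \<open>{1..k}\<close>.\<close>

lemma img_inj: "inj_on img incr"
proof (rule inj_onI)
  fix \<alpha> \<beta> assume \<alpha>: "\<alpha> \<in> incr" and \<beta>: "\<beta> \<in> incr" and eq: "img \<alpha> = img \<beta>"
  have sorted: "sorted_wrt (<) (map \<gamma> [1..<Suc k])" if "\<gamma> \<in> incr" for \<gamma>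
  proof -
    have mono: "strict_mono_on {1..k} \<gamma>" using that unfolding incr_def by blast
    have "sorted_wrt (\<lambda>x y. \<gamma> x < \<gamma> y) [1..<Suc k]"
    proof (rule sorted_wrt_mono_rel[OF _ sorted_wrt_upt])
      fix x y assume "x \<in> set [1..<Suc k]" "y \<in> set [1..<Suc k]" "x < y"
      then show "\<gamma> x < \<gamma> y"
        by (intro strict_mono_onD[OF mono]) (simp_all only: set_upt atLeastLessThanSuc_atLeastAtMost)
    qed
    then show ?thesis by (simp only: sorted_wrt_map)
  qed
  have set: "set (map \<gamma> [1..<Suc k]) = img \<gamma>" for \<gamma>
    unfolding img_def by (simp only: set_map set_upt atLeastLessThanSuc_atLeastAtMost)
  have "map \<alpha> [1..<Suc k] = map \<beta> [1..<Suc k]"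
    by (rule strict_sorted_equal[OF sorted[OF \<beta>] sorted[OF \<alpha>]]) (simp only: set eq)
  then have "\<forall>i\<in>set [1..<Suc k]. \<alpha> i = \<beta> i" by (simp only: map_eq_conv)
  then have "\<alpha> i = \<beta> i" if "i \<in> {1..k}" for i
    using that by (simp only: set_upt atLeastLessThanSuc_atLeastAtMost)
  moreover have "\<alpha> \<in> {1..k} \<rightarrow>\<^sub>E {1..n}" "\<beta> \<in> {1..k} \<rightarrow>\<^sub>E {1..n}"
    using \<alpha> \<beta> unfolding incr_def by blast+
  ultimately show "\<alpha> = \<beta>" using PiE_ext by metis
qed

lemma img_surj:
  assumes V: "V \<subseteq> {1..n}" "card V = k"
  shows "\<exists>\<alpha>\<in>incr. img \<alpha> = V"
proof -
  have fin: "finite V" using V finite_subset by blast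
  define xs where "xs = sorted_list_of_set V"
  have xs: "sorted_wrt (<) xs" "set xs = V" "length xs = k"
    using fin V by (simp_all add: xs_def)
  \<comment> \<open>The shift by 1 reconciles tuples indexed from 1 with lists indexed from
    0.\<close>
  define \<alpha> where "\<alpha> = (\<lambda>i\<in>{1..k}. xs ! (i - 1))"
  have im: "img \<alpha> = V"
  proof -
    have "img \<alpha> = (\<lambda>i. xs ! (i - 1)) ` {1..k}" by (simp add: img_def \<alpha>_def)
    also have "\<dots> = (!) xs ` ((\<lambda>i. i - 1) ` {1..k})" by (simp add: image_image)
    also have "(\<lambda>i. i - 1) ` {1..k} = {0..<k}"
    proof
      show "{0..<k} \<subseteq> (\<lambda>i. i - 1) ` {1..k}"
      proof
        fix i assume "i \<in> {0..<k}"
        then show "i \<in> (\<lambda>i. i - 1) ` {1..k}" by (intro image_eqI[of _ _ "Suc i"]) auto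
      qed
    qed auto
    also have "(!) xs ` {0..<k} = V" using nth_image[of k xs] xs by simp
    finally show ?thesis .
  qed
  have "\<alpha> i \<in> {1..n}" if "i \<in> {1..k}" for i
    using im V that unfolding img_def by blast
  then have "\<alpha> \<in> {1..k} \<rightarrow>\<^sub>E {1..n}" by (simp add: PiE_iff \<alpha>_def)
  moreover have "strict_mono_on {1..k} \<alpha>"
  proof (rule strict_mono_onI)
    fix i j assume ij: "i \<in> {1..k}" "j \<in> {1..k}" "i < j"
    then have "xs ! (i - 1) < xs ! (j - 1)"
      using xs by (intro sorted_wrt_nth_less[OF xs(1)]) auto
    then show "\<alpha> i < \<alpha> j" using ij by (simp add: \<alpha>_def)
  qed
  ultimately show ?thesis using im unfolding incr_def by blast
qed

lemma card_incr_above: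
  assumes "B \<subseteq> {1..n}" "card B \<le> k"
  shows "card {\<alpha> \<in> incr. B \<subseteq> img \<alpha>} = (n - card B) choose (k - card B)"
proof -
  have "inj_on img {\<alpha> \<in> incr. B \<subseteq> img \<alpha>}" by (rule inj_on_subset[OF img_inj]) simp
  then have "card {\<alpha> \<in> incr. B \<subseteq> img \<alpha>} = card (img ` {\<alpha> \<in> incr. B \<subseteq> img \<alpha>})"
    by (rule card_image[symmetric])
  also have "img ` {\<alpha> \<in> incr. B \<subseteq> img \<alpha>} = {V. V \<subseteq> {1..n} \<and> card V = k \<and> B \<subseteq> V}"
  proof (intro equalityI subsetI)
    fix V assume "V \<in> img ` {\<alpha> \<in> incr. B \<subseteq> img \<alpha>}"
    then obtain \<alpha> where \<alpha>: "\<alpha> \<in> incr" "B \<subseteq> img \<alpha>" "V = img \<alpha>" by blast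
    show "V \<in> {V. V \<subseteq> {1..n} \<and> card V = k \<and> B \<subseteq> V}"
      unfolding \<alpha>(3) using incrD(3,5)[OF \<alpha>(1)] \<alpha>(2) by simp
  next
    fix V assume "V \<in> {V. V \<subseteq> {1..n} \<and> card V = k \<and> B \<subseteq> V}"
    then have V: "V \<subseteq> {1..n}" "card V = k" "B \<subseteq> V" by simp_all
    from img_surj[OF V(1,2)] obtain \<alpha> where "\<alpha> \<in> incr" "img \<alpha> = V" by blast
    then show "V \<in> img ` {\<alpha> \<in> incr. B \<subseteq> img \<alpha>}" using V(3) by (intro image_eqI[of _ _ \<alpha>]) simp_all
  qed
  also have "card {V. V \<subseteq> {1..n} \<and> card V = k \<and> B \<subseteq> V} = (card {1..n} - card B) choose (k - card B)"
    by (rule card_subsets_above[OF _ assms]) simp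
  finally show ?thesis by (simp only: card_atLeastAtMost diff_Suc_1)
qed

definition deg1 :: nat where "deg1 = (n - 1) choose (k - 1)"
text \<open>The number of tuples through two given vertices. For k = 1 there are none, whereas
  truncated subtraction would turn the binomial coefficient into 1.\<close>

definition deg2 :: nat where "deg2 = (if k = 1 then 0 else (n - 2) choose (k - 2))"

lemma deg1_pos: "0 < deg1" using k_le by (simp add: deg1_def zero_less_binomial)

text \<open>Double counting of a second vertex: each tuple through a fixed vertex has k - 1 others,
  and each of the n - 1 candidates lies in \<open>deg2\<close> of these tuples. In binomial form it
  is the absorption identity.\<close>

lemma deg_rel: "(real n - 1) * real deg2 = (real k - 1) * real deg1"
proof (cases "k = 1")
  case False
  then obtain k' n' where kn: "k = Suc (Suc k')" "n = Suc (Suc n')"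
    using k_ge k_le by (metis One_nat_def Suc_le_D Suc_le_mono le_antisym not_less_eq_eq)
  have "Suc n' * (n' choose k') = (Suc n' choose Suc k') * Suc k'" by (rule Suc_times_binomial_eq)
  then have "real (Suc n') * real (n' choose k') = real (Suc n' choose Suc k') * real (Suc k')"
    by (simp only: of_nat_mult[symmetric])
  moreover have "deg1 = (Suc n' choose Suc k')" "deg2 = (n' choose k')"
    unfolding deg1_def deg2_def using kn by simp_all
  moreover have "real n - 1 = real (Suc n')" "real k - 1 = real (Suc k')" using kn by simp_all
  ultimately show ?thesis by (simp only: mult.commute)
next
  case True
  then show ?thesis unfolding deg2_def by simp
qed

lemma card_incr_containing: "i \<in> {1..n} \<Longrightarrow> card {\<alpha> \<in> incr. i \<in> img \<alpha>} = deg1"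
  using card_incr_above[of "{i}"] k_ge by (simp add: deg1_def)

lemma card_incr_containing2:
  assumes "i \<in> {1..n}" "j \<in> {1..n}" "i \<noteq> j"
  shows "card {\<alpha> \<in> incr. i \<in> img \<alpha> \<and> j \<in> img \<alpha>} = deg2"
proof (cases "k = 1")
  case True
  have "\<not> (i \<in> img \<alpha> \<and> j \<in> img \<alpha>)" for \<alpha>
    unfolding img_def unfolding True using assms(3) by simp
  then have "{\<alpha> \<in> incr. i \<in> img \<alpha> \<and> j \<in> img \<alpha>} = {}" by blast
  moreover have "deg2 = 0" unfolding deg2_def using True by simp
  ultimately show ?thesis by (simp only: card.empty)
next
  case False
  have "card {i, j} = 2" using assms(3) by simp
  then show ?thesis
    using card_incr_above[of "{i, j}"] assms False k_ge by (simp add: deg2_def numeral_2_eq_2)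
qed

text \<open>Union bound over a second common vertex: n - 1 choices, and \<open>deg2\<close>
  possibilities for either tuple. Larger overlaps are counted repeatedly, harmless in an upper
  bound.\<close>

lemma card_overlap_at:
  assumes i: "i \<in> {1..n}"
  shows "card {(\<alpha>, \<beta>) \<in> {\<alpha> \<in> incr. i \<in> img \<alpha>} \<times> {\<alpha> \<in> incr. i \<in> img \<alpha>}. 2 \<le> card (img \<alpha> \<inter> img \<beta>)}
      \<le> (n - 1) * deg2\<^sup>2"
proof -
  define X where "X j = {\<alpha> \<in> incr. i \<in> img \<alpha> \<and> j \<in> img \<alpha>}" for j
  have fin: "finite (X j)" for j unfolding X_def using finite_incr by simp
  have "{(\<alpha>, \<beta>) \<in> {\<alpha> \<in> incr. i \<in> img \<alpha>} \<times> {\<alpha> \<in> incr. i \<in> img \<alpha>}. 2 \<le> card (img \<alpha> \<inter> img \<beta>)}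
    \<subseteq> (\<Union>j\<in>{1..n} - {i}. X j \<times> X j)"
  proof (clarify)
    fix \<alpha> \<beta> assume \<alpha>: "\<alpha> \<in> incr" "i \<in> img \<alpha>" and \<beta>: "\<beta> \<in> incr" "i \<in> img \<beta>"
      and 2: "2 \<le> card (img \<alpha> \<inter> img \<beta>)"
    have "\<not> img \<alpha> \<inter> img \<beta> \<subseteq> {i}"
    proof
      assume "img \<alpha> \<inter> img \<beta> \<subseteq> {i}"
      then have "card (img \<alpha> \<inter> img \<beta>) \<le> card {i}" by (rule card_mono[rotated]) simp
      then show False using 2 by simp
    qed
    then obtain j where j: "j \<in> img \<alpha>" "j \<in> img \<beta>" "j \<noteq> i" by blast
    have "j \<in> {1..n}" using j(1) incrD(3)[OF \<alpha>(1)] by (rule rev_subsetD)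
    then have "j \<in> {1..n} - {i}" using j(3) by simp
    moreover have "(\<alpha>, \<beta>) \<in> X j \<times> X j" unfolding X_def using \<alpha> \<beta> j by simp
    ultimately show "(\<alpha>, \<beta>) \<in> (\<Union>j\<in>{1..n} - {i}. X j \<times> X j)" by (rule UN_I)
  qed
  then have "card {(\<alpha>, \<beta>) \<in> {\<alpha> \<in> incr. i \<in> img \<alpha>} \<times> {\<alpha> \<in> incr. i \<in> img \<alpha>}. 2 \<le> card (img \<alpha> \<inter> img \<beta>)}
    \<le> card (\<Union>j\<in>{1..n} - {i}. X j \<times> X j)"
    by (rule card_mono[rotated]) (simp add: fin)
  also have "\<dots> \<le> (\<Sum>j\<in>{1..n} - {i}. card (X j \<times> X j))" by (rule card_UN_le) simp
  also have "\<dots> = (\<Sum>j\<in>{1..n} - {i}. deg2\<^sup>2)"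
  proof (rule sum.cong[OF refl])
    fix j assume "j \<in> {1..n} - {i}"
    then have "card (X j) = deg2" unfolding X_def using i by (intro card_incr_containing2) auto
    then show "card (X j \<times> X j) = deg2\<^sup>2" by (simp add: card_cartesian_product power2_eq_square)
  qed
  also have "\<dots> = (n - 1) * deg2\<^sup>2" using i by simp
  finally show ?thesis .
qed

lemma card_overlap: "card {(\<alpha>, \<beta>) \<in> incr \<times> incr. 2 \<le> card (img \<alpha> \<inter> img \<beta>)} \<le> n * ((n - 1) * deg2\<^sup>2)"
proof -
  define G where "G i = {(\<alpha>, \<beta>) \<in> {\<alpha> \<in> incr. i \<in> img \<alpha>} \<times> {\<alpha> \<in> incr. i \<in> img \<alpha>}.
    2 \<le> card (img \<alpha> \<inter> img \<beta>)}" for i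
  have fin: "finite (G i)" for i
    by (rule finite_subset[of _ "incr \<times> incr"]) (auto simp: G_def finite_incr)
  have "{(\<alpha>, \<beta>) \<in> incr \<times> incr. 2 \<le> card (img \<alpha> \<inter> img \<beta>)} \<subseteq> (\<Union>i\<in>{1..n}. G i)"
  proof (clarify)
    fix \<alpha> \<beta> assume \<alpha>: "\<alpha> \<in> incr" and \<beta>: "\<beta> \<in> incr" and 2: "2 \<le> card (img \<alpha> \<inter> img \<beta>)"
    from 2 have "img \<alpha> \<inter> img \<beta> \<noteq> {}" by (metis card.empty not_numeral_le_zero)
    then obtain i where i: "i \<in> img \<alpha>" "i \<in> img \<beta>" by blast
    have "(\<alpha>, \<beta>) \<in> G i" unfolding G_def using \<alpha> \<beta> i 2 by simp
    moreover have "i \<in> {1..n}" using i(1) incrD(3)[OF \<alpha>] by (rule rev_subsetD)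
    ultimately show "(\<alpha>, \<beta>) \<in> (\<Union>i\<in>{1..n}. G i)" by (rule UN_I[rotated])
  qed
  then have "card {(\<alpha>, \<beta>) \<in> incr \<times> incr. 2 \<le> card (img \<alpha> \<inter> img \<beta>)} \<le> card (\<Union>i\<in>{1..n}. G i)"
    by (rule card_mono[rotated]) (simp add: fin)
  also have "\<dots> \<le> (\<Sum>i\<in>{1..n}. card (G i))" by (rule card_UN_le) simp
  also have "\<dots> \<le> (\<Sum>i\<in>{1..n}. (n - 1) * deg2\<^sup>2)"
    unfolding G_def by (rule sum_mono, rule card_overlap_at)
  also have "\<dots> = n * ((n - 1) * deg2\<^sup>2)" by simp
  finally show ?thesis .
qed

section \<open>Linear part, remainder and variance of the statistic\<close>

definition stat :: "(nat \<times> nat \<Rightarrow> 'a) \<Rightarrow> real" where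
  "stat w = (\<Sum>\<alpha>\<in>incr. K (pull k \<alpha> w))"

definition Usum :: "(nat \<times> nat \<Rightarrow> 'a) \<Rightarrow> real" where "Usum w = (\<Sum>\<alpha>\<in>incr. u \<alpha> w)"

definition Hsum :: "(nat \<times> nat \<Rightarrow> 'a) \<Rightarrow> real" where "Hsum w = (\<Sum>i\<in>{1..n}. hfun (w (i, i)))"

text \<open>After exchanging the sums each vertex is counted once for every tuple through it; this
  is the origin of the weight \<open>deg1\<close>.\<close>

lemma sum_hsum: "(\<Sum>\<alpha>\<in>incr. hsum \<alpha> w) = real deg1 * Hsum w"
proof -
  have "(\<Sum>\<alpha>\<in>incr. hsum \<alpha> w) = (\<Sum>\<alpha>\<in>incr. \<Sum>i\<in>{i \<in> {1..n}. i \<in> img \<alpha>}. hfun (w (i, i)))"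
    unfolding hsum_def
  proof (intro sum.cong refl)
    fix \<alpha> assume "\<alpha> \<in> incr"
    from incrD(3)[OF this] show "img \<alpha> = {i \<in> {1..n}. i \<in> img \<alpha>}" by blast
  qed
  also have "\<dots> = (\<Sum>i\<in>{1..n}. \<Sum>\<alpha>\<in>{\<alpha> \<in> incr. i \<in> img \<alpha>}. hfun (w (i, i)))"
    by (rule sum.swap_restrict[OF finite_incr]) simp
  also have "\<dots> = (\<Sum>i\<in>{1..n}. real deg1 * hfun (w (i, i)))"
    using card_incr_containing by (intro sum.cong refl) simp
  finally show ?thesis by (simp only: Hsum_def sum_distrib_left)
qed

lemma stat_decomp: "stat w = real (card incr) * mean + (real deg1 * Hsum w + Usum w)"
proof -
  have "stat w = (\<Sum>\<alpha>\<in>incr. mean + (hsum \<alpha> w + u \<alpha> w))"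
    unfolding stat_def by (rule sum.cong) (auto simp: u_def)
  then show ?thesis by (simp add: sum.distrib sum_hsum Usum_def)
qed

lemma Usum_sq: "sq_integrable \<Omega> Usum"
  unfolding Usum_def[abs_def] by (intro sq_integrable_sum u_sq)

lemma Hsum_sq: "sq_integrable \<Omega> Hsum"
  unfolding Hsum_def[abs_def] by (intro sq_integrable_sum hfun_component(4))

lemma u_zero: "\<alpha> \<in> incr \<Longrightarrow> (\<integral>w. u \<alpha> w \<partial>\<Omega>) = 0"
proof -
  assume \<alpha>: "\<alpha> \<in> incr"
  have h: "integrable \<Omega> (\<lambda>w. hfun (w (i, i)))" if "i \<in> img \<alpha>" for i
    using that incrD(3)[OF \<alpha>] by (intro N.P.sq_integrable_imp_integrable hfun_component(4)) blast
  have h0: "(\<integral>w. hsum \<alpha> w \<partial>\<Omega>) = 0"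
    unfolding hsum_def
    by (subst Bochner_Integration.integral_sum[OF h], assumption, rule sum.neutral)
      (use incrD(3)[OF \<alpha>] hfun_component(5) in blast)
  have K0: "(\<integral>w. K (pull k \<alpha> w) \<partial>\<Omega>) = mean"
    unfolding mean_def by (rule integral_pull(1)[OF incrD(1,2)[OF \<alpha>] K_meas])
  show ?thesis
    unfolding u_def
    using N.P.sq_integrable_imp_integrable[OF K_pull_sq[OF \<alpha>]] N.P.sq_integrable_imp_integrable[OF hsum_sq[OF \<alpha>]]
    by (simp add: K0 h0 N.P.prob_space)
qed

lemma Usum_zero: "(\<integral>w. Usum w \<partial>\<Omega>) = 0"
  unfolding Usum_def
  by (subst Bochner_Integration.integral_sum) (auto intro: N.P.sq_integrable_imp_integrable[OF u_sq] simp: u_zero)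

lemma Hsum_zero: "(\<integral>w. Hsum w \<partial>\<Omega>) = 0"
  unfolding Hsum_def
  by (subst Bochner_Integration.integral_sum)
    (auto intro: N.P.sq_integrable_imp_integrable[OF hfun_component(4)] simp: hfun_component(5))

lemma Hsum_power2: "(\<integral>w. (Hsum w)\<^sup>2 \<partial>\<Omega>) = real n * s1sq"
  unfolding Hsum_def using integral_hfun_sum_power2[of "{1..n}" 1] by simp

lemma Hsum_Usum: "(\<integral>w. Hsum w * Usum w \<partial>\<Omega>) = 0"
proof -
  have i: "integrable \<Omega> (\<lambda>w. u \<alpha> w * hfun (w (j, j)))" if "\<alpha> \<in> incr" "j \<in> {1..n}" for \<alpha> j
    by (intro sq_integrable_mult u_sq hfun_component(4) that)
  have "(\<integral>w. Hsum w * Usum w \<partial>\<Omega>) = (\<integral>w. (\<Sum>\<alpha>\<in>incr. \<Sum>j\<in>{1..n}. u \<alpha> w * hfun (w (j, j))) \<partial>\<Omega>)"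
  proof (rule Bochner_Integration.integral_cong[OF refl])
    show "Hsum w * Usum w = (\<Sum>\<alpha>\<in>incr. \<Sum>j\<in>{1..n}. u \<alpha> w * hfun (w (j, j)))" for w
      by (subst mult.commute) (simp only: Hsum_def Usum_def sum_product)
  qed
  also have "\<dots> = (\<Sum>\<alpha>\<in>incr. \<integral>w. (\<Sum>j\<in>{1..n}. u \<alpha> w * hfun (w (j, j))) \<partial>\<Omega>)"
    by (intro Bochner_Integration.integral_sum Bochner_Integration.integrable_sum i)
  also have "\<dots> = (\<Sum>\<alpha>\<in>incr. \<Sum>j\<in>{1..n}. \<integral>w. u \<alpha> w * hfun (w (j, j)) \<partial>\<Omega>)"
    by (intro sum.cong refl Bochner_Integration.integral_sum i)
  also have "\<dots> = 0" by (intro sum.neutral ballI u_hfun_orthogonal)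
  finally show ?thesis .
qed

lemma stat_expectation: "(\<integral>w. stat w \<partial>\<Omega>) = real (card incr) * mean"
  unfolding stat_decomp
  using N.P.sq_integrable_imp_integrable[OF Usum_sq] N.P.sq_integrable_imp_integrable[OF Hsum_sq]
  by (simp add: Usum_zero Hsum_zero N.P.prob_space)

text \<open>Orthogonality of linear part and remainder gives an exact sum. Hence the variance defect
  of the normalised linear part is exactly the remainder's share.\<close>

lemma stat_variance:
  "N.P.variance stat = (\<integral>w. (Usum w)\<^sup>2 \<partial>\<Omega>) + real n * ((real deg1)\<^sup>2 * s1sq)"
proof -
  have "N.P.variance stat = (\<integral>w. (real deg1)\<^sup>2 * (Hsum w)\<^sup>2 + (Usum w)\<^sup>2 + 2 * real deg1 * (Hsum w * Usum w) \<partial>\<Omega>)"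
  proof (rule Bochner_Integration.integral_cong[OF refl])
    fix w
    have "stat w - N.P.expectation stat = real deg1 * Hsum w + Usum w"
      using stat_decomp[of w] stat_expectation by simp
    then show "(stat w - N.P.expectation stat)\<^sup>2
        = (real deg1)\<^sup>2 * (Hsum w)\<^sup>2 + (Usum w)\<^sup>2 + 2 * real deg1 * (Hsum w * Usum w)"
      by (simp only: power2_sum power_mult_distrib mult.assoc)
  qed
  also have "\<dots> = (real deg1)\<^sup>2 * (real n * s1sq) + (\<integral>w. (Usum w)\<^sup>2 \<partial>\<Omega>)"
    using sq_integrableD(2)[OF Hsum_sq] sq_integrableD(2)[OF Usum_sq] sq_integrable_mult[OF Hsum_sq Usum_sq]
    by (simp add: Hsum_power2 Hsum_Usum)
  finally show ?thesis by (simp add: mult.left_commute)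
qed

text \<open>The terms that read the variable at vertex i; all others are constant in that
  coordinate, as the assumption \<open>UA\<close> of the general bound asks.\<close>

definition Apart :: "nat \<Rightarrow> (nat \<times> nat \<Rightarrow> 'a) \<Rightarrow> real" where
  "Apart i w = (\<Sum>\<alpha>\<in>{\<alpha> \<in> incr. i \<in> img \<alpha>}. u \<alpha> w)"

lemma Apart_sq: "sq_integrable \<Omega> (Apart i)"
  unfolding Apart_def[abs_def] by (intro sq_integrable_sum u_sq) blast

lemma Apart_power2_le:
  assumes "i \<in> {1..n}"
  shows "(\<integral>w. (Apart i w)\<^sup>2 \<partial>\<Omega>) \<le> (real n - 1) * (real deg2)\<^sup>2 * vari"
proof -
  have "(\<integral>w. (Apart i w)\<^sup>2 \<partial>\<Omega>) \<le> real (card {(\<alpha>, \<beta>) \<in> {\<alpha> \<in> incr. i \<in> img \<alpha>} \<times> {\<alpha> \<in> incr. i \<in> img \<alpha>}. 2 \<le> card (img \<alpha> \<inter> img \<beta>)}) * vari"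
    unfolding Apart_def by (rule u_sum_power2_le) blast
  also have "\<dots> \<le> real ((n - 1) * deg2\<^sup>2) * vari"
    by (intro mult_right_mono of_nat_mono card_overlap_at assms) (simp add: vari_def)
  also have "real ((n - 1) * deg2\<^sup>2) = (real n - 1) * (real deg2)\<^sup>2"
    using k_ge k_le by (simp add: of_nat_diff)
  finally show ?thesis .
qed

lemma Usum_power2_le: "(\<integral>w. (Usum w)\<^sup>2 \<partial>\<Omega>) \<le> real n * ((real n - 1) * (real deg2)\<^sup>2 * vari)"
proof -
  have "(\<integral>w. (Usum w)\<^sup>2 \<partial>\<Omega>) \<le> real (card {(\<alpha>, \<beta>) \<in> incr \<times> incr. 2 \<le> card (img \<alpha> \<inter> img \<beta>)}) * vari"
    unfolding Usum_def by (rule u_sum_power2_le) blast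
  also have "\<dots> \<le> real (n * ((n - 1) * deg2\<^sup>2)) * vari"
    by (intro mult_right_mono of_nat_mono card_overlap) (simp add: vari_def)
  also have "real (n * ((n - 1) * deg2\<^sup>2)) = real n * ((real n - 1) * (real deg2)\<^sup>2)"
    using k_ge k_le by (simp add: of_nat_diff)
  finally show ?thesis by (simp only: mult.assoc)
qed

lemma Usum_Apart_const:
  assumes i: "i \<in> {1..n}" and w: "w \<in> space \<Omega>" and t: "t \<in> space (Q (i, i))"
  shows "Usum w - Apart i w = Usum (w((i, i) := t)) - Apart i (w((i, i) := t))"
proof -
  note w' = space_fun_upd[OF w hfun_component(1)[OF i] t]
  have split: "Usum v - Apart i v = (\<Sum>\<alpha>\<in>{\<alpha> \<in> incr. i \<notin> img \<alpha>}. u \<alpha> v)" for v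
  proof -
    have "incr = {\<alpha> \<in> incr. i \<in> img \<alpha>} \<union> {\<alpha> \<in> incr. i \<notin> img \<alpha>}" by blast
    then have "Usum v = (\<Sum>\<alpha>\<in>{\<alpha> \<in> incr. i \<in> img \<alpha>} \<union> {\<alpha> \<in> incr. i \<notin> img \<alpha>}. u \<alpha> v)"
      unfolding Usum_def by simp
    also have "\<dots> = Apart i v + (\<Sum>\<alpha>\<in>{\<alpha> \<in> incr. i \<notin> img \<alpha>}. u \<alpha> v)"
      unfolding Apart_def using finite_incr by (intro sum.union_disjoint) auto
    finally show ?thesis by simp
  qed
  show ?thesis
    unfolding split
  proof (rule sum.cong[OF refl])
    fix \<alpha> assume \<alpha>: "\<alpha> \<in> {\<alpha> \<in> incr. i \<notin> img \<alpha>}"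
    then have "\<alpha> \<in> incr" by blast
    from u_depends[OF this] w w' show "u \<alpha> w = u \<alpha> (w((i, i) := t))"
    proof (rule depends_onD)
      fix p assume "p \<in> block n (img \<alpha>)"
      then show "w p = (w((i, i) := t)) p" using \<alpha> by (auto simp: block_def)
    qed
  qed
qed

lemma vari_le: "vari \<le> sqrt (\<integral>w. K w ^ 4 \<partial>\<Omega>k)"
proof -
  have i2: "integrable \<Omega>k (\<lambda>w. (K w)\<^sup>2)" using K_sq by auto
  have "vari = (\<integral>w. (K w)\<^sup>2 \<partial>\<Omega>k) - mean\<^sup>2"
    unfolding vari_def mean_def by (rule Nk.P.variance_eq[OF K_int i2])
  also have "\<dots> \<le> (\<integral>w. (K w)\<^sup>2 \<partial>\<Omega>k)" by simp
  also have "\<dots> \<le> sqrt (\<integral>w. ((K w)\<^sup>2)\<^sup>2 \<partial>\<Omega>k)"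
    by (rule real_le_rsqrt, rule Nk.P.expectation_power2_le[OF K_sq(2)])
  finally show ?thesis by simp
qed

theorem ustat_berry_esseen:
  assumes s1: "0 < s1sq"
  shows "\<bar>measure \<Omega> {w \<in> space \<Omega>. (stat w - N.P.expectation stat) / sqrt (N.P.variance stat) \<le> z} - std_normal_cdf z\<bar>
      \<le> 12 * real k * sqrt (\<integral>w. K w ^ 4 \<partial>\<Omega>k) / (sqrt (real n) * s1sq)"
proof -
  define V where "V = N.P.variance stat"
  \<comment> \<open>The scale is the standard deviation of the whole statistic, so the linear part
    has variance at most 1 and its defect must be paid for.\<close>
  define c where "c = 1 / sqrt V"
  define a where "a = real deg1"
  let ?U2 = "\<integral>w. (Usum w)\<^sup>2 \<partial>\<Omega>" and ?h4 = "\<integral>t. hfun t ^ 4 \<partial>Q (1, 1)"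
    and ?B = "(real n - 1) * (real deg2)\<^sup>2 * vari"
  have a: "0 < a" using deg1_pos by (simp add: a_def)
  have n: "0 < real n" using k_ge k_le by simp
  have V_eq: "V = ?U2 + real n * (a\<^sup>2 * s1sq)" by (simp add: V_def a_def stat_variance)
  have "0 < real n * (a\<^sup>2 * s1sq)" using n a s1 by simp
  moreover have "0 \<le> ?U2" by simp
  ultimately have V: "0 < V" unfolding V_eq by linarith
  have c2: "c\<^sup>2 = 1 / V" using V by (simp add: c_def power_divide)
  have c4: "c ^ 4 = 1 / V\<^sup>2"
  proof -
    have "c ^ 4 = (c\<^sup>2)\<^sup>2" by simp
    then show ?thesis by (simp add: c2 power_divide)
  qed
  \<comment> \<open>Only loops are redrawn; coordinates above the diagonal enter solely through
    \<open>Usum\<close>.\<close>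
  let ?D = "(\<lambda>i. (i, i)) ` {1..n}" and ?h = "\<lambda>p t. (c * a) * hfun t"
  have inj: "inj_on (\<lambda>i. (i, i)) {1..n}" by (simp add: inj_on_def)
  have sumD: "(\<Sum>p\<in>?D. F p) = (\<Sum>i\<in>{1..n}. F (i, i))" for F :: "_ \<Rightarrow> real"
    by (simp only: sum.reindex[OF inj] comp_def)
  have h2_eq: "(\<integral>t. ((c * a) * hfun t)\<^sup>2 \<partial>Q (i, i)) = a\<^sup>2 * s1sq / V" if "i \<in> {1..n}" for i
    unfolding Q_diag[OF that] s1sq_def by (simp add: power_mult_distrib c2)
  have h4_eq: "(\<integral>t. ((c * a) * hfun t) ^ 4 \<partial>Q (i, i)) = a ^ 4 * ?h4 / V\<^sup>2" if "i \<in> {1..n}" for i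
    unfolding Q_diag[OF that] by (simp add: power_mult_distrib c4)
  have W: "(\<Sum>p\<in>?D. ?h p (w p)) + c * Usum w = (stat w - N.P.expectation stat) / sqrt (N.P.variance stat)" for w
  proof -
    have "(\<Sum>p\<in>?D. ?h p (w p)) = c * (a * Hsum w)"
      unfolding sumD Hsum_def by (simp only: sum_distrib_left mult.assoc)
    moreover have "stat w - N.P.expectation stat = a * Hsum w + Usum w"
      using stat_decomp[of w] stat_expectation by (simp add: a_def)
    ultimately show ?thesis unfolding c_def V_def by (simp add: add_divide_distrib)
  qed
  have "\<bar>measure \<Omega> {w \<in> space \<Omega>. (\<Sum>p\<in>?D. ?h p (w p)) + c * Usum w \<le> z} - std_normal_cdf z\<bar>
      \<le> 2 * sqrt (\<integral>w. (c * Usum w)\<^sup>2 \<partial>\<Omega>) + \<bar>1 - (\<Sum>p\<in>?D. \<integral>t. (?h p t)\<^sup>2 \<partial>Q p)\<bar>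
        + 5 / 2 * sqrt (\<Sum>p\<in>?D. \<integral>t. ?h p t ^ 4 \<partial>Q p)
        + (\<Sum>p\<in>?D. 4 * sqrt ((\<integral>t. (?h p t)\<^sup>2 \<partial>Q p) * (\<integral>w. (c * Apart (fst p) w)\<^sup>2 \<partial>\<Omega>)))"
  proof (rule N.nonlinear_berry_esseen)
    show "?D \<subseteq> pairs n" using hfun_component(1) by blast
    show "sq_integrable \<Omega> (\<lambda>w. c * Usum w)" by (rule sq_integrable_cmult[OF Usum_sq])
    fix p assume p: "p \<in> ?D"
    then obtain i where i: "i \<in> {1..n}" "p = (i, i)" by blast
    have Qp: "Q p = Q (1, 1)" unfolding i(2) by (rule Q_diag[OF i(1)])
    show "?h p \<in> borel_measurable (Q p)" unfolding Qp using hfun_meas by simp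
    show "integrable (Q p) (\<lambda>t. ?h p t ^ 4)"
      unfolding Qp power_mult_distrib using hfun4 by simp
    show "integral\<^sup>L (Q p) (?h p) = 0" unfolding Qp using hfun_zero by simp
    show "sq_integrable \<Omega> (\<lambda>w. c * Apart (fst p) w)" by (rule sq_integrable_cmult[OF Apart_sq])
    fix w t assume w: "w \<in> space \<Omega>" and t: "t \<in> space (Q p)"
    have "Usum w - Apart i w = Usum (w((i, i) := t)) - Apart i (w((i, i) := t))"
      by (rule Usum_Apart_const[OF i(1) w t[unfolded i(2)]])
    then show "c * Usum w - c * Apart (fst p) w = c * Usum (w(p := t)) - c * Apart (fst p) (w(p := t))"
      unfolding i(2) right_diff_distrib[symmetric] by simp
  qed
  also have "(\<integral>w. (c * Usum w)\<^sup>2 \<partial>\<Omega>) = ?U2 / V"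
    by (simp add: power_mult_distrib c2)
  also have "(\<Sum>p\<in>?D. \<integral>t. (?h p t)\<^sup>2 \<partial>Q p) = real n * (a\<^sup>2 * s1sq / V)"
    unfolding sumD by (simp add: h2_eq)
  also have "(\<Sum>p\<in>?D. \<integral>t. ?h p t ^ 4 \<partial>Q p) = real n * (a ^ 4 * ?h4 / V\<^sup>2)"
    unfolding sumD by (simp add: h4_eq)
  also have "(\<Sum>p\<in>?D. 4 * sqrt ((\<integral>t. (?h p t)\<^sup>2 \<partial>Q p) * (\<integral>w. (c * Apart (fst p) w)\<^sup>2 \<partial>\<Omega>)))
      \<le> (\<Sum>i\<in>{1..n}. 4 * sqrt (a\<^sup>2 * s1sq / V * (?B / V)))"
    unfolding sumD
  proof (rule sum_mono)
    fix i assume i: "i \<in> {1..n}"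
    note h2_eq[OF i]
    moreover have "(\<integral>w. (c * Apart i w)\<^sup>2 \<partial>\<Omega>) \<le> ?B / V"
      using Apart_power2_le[OF i] V by (simp add: power_mult_distrib c2 divide_right_mono)
    moreover have "0 \<le> a\<^sup>2 * s1sq / V" using a s1 V by simp
    ultimately show "4 * sqrt ((\<integral>t. ((c * a) * hfun t)\<^sup>2 \<partial>Q (i, i)) * (\<integral>w. (c * Apart (fst (i, i)) w)\<^sup>2 \<partial>\<Omega>))
      \<le> 4 * sqrt (a\<^sup>2 * s1sq / V * (?B / V))"
      by (simp only: fst_conv) (intro mult_left_mono real_sqrt_le_mono, auto)
  qed
  also have "(\<Sum>i\<in>{1..n}. 4 * sqrt (a\<^sup>2 * s1sq / V * (?B / V))) = real n * (4 * sqrt (a\<^sup>2 * s1sq / V * (?B / V)))"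
    by simp
  also have "2 * sqrt (?U2 / V) + \<bar>1 - real n * (a\<^sup>2 * s1sq / V)\<bar> + 5 / 2 * sqrt (real n * (a ^ 4 * ?h4 / V\<^sup>2))
      + real n * (4 * sqrt (a\<^sup>2 * s1sq / V * (?B / V)))
      \<le> 12 * real k * sqrt (\<integral>w. K w ^ 4 \<partial>\<Omega>k) / (sqrt (real n) * s1sq)"
  proof (rule berry_esseen_rate[OF k_ge k_le a _ s1 _ vari_le])
    show "(real n - 1) * real deg2 = (real k - 1) * a" unfolding a_def by (rule deg_rel)
    \<comment> \<open>Since \<open>deg1\<close> is positive some tuple exists; its remainder has a
      nonnegative second moment, which gives \<open>s1sq \<le> vari\<close>.\<close>
    obtain \<alpha> where "\<alpha> \<in> incr" using card_incr_containing[of 1] deg1_pos k_ge k_le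
      by (metis (no_types, lifting) atLeastAtMost_iff card.empty empty_Collect_eq less_irrefl order_refl order_trans)
    moreover have "0 \<le> (\<integral>w. (u \<alpha> w)\<^sup>2 \<partial>\<Omega>)" by simp
    ultimately show "s1sq \<le> vari" using u_power2_le[of \<alpha>] by linarith
    show "?U2 \<le> real n * ((real n - 1) * (real deg2)\<^sup>2 * vari)" by (rule Usum_power2_le)
    show "?h4 \<le> 16 * (\<integral>w. K w ^ 4 \<partial>\<Omega>k)" by (rule hfun4_le)
    show "V = ?U2 + real n * (a\<^sup>2 * s1sq)" by (rule V_eq)
  qed simp_all
  finally show ?thesis unfolding W by simp
qed

end

section \<open>Transfer from the sample to the product space\<close>

text \<open>Testing against functions of the first vertex variable characterises a conditional mean;
  b will be an indicator. After redrawing that coordinate, \<open>b t\<close> is constant in the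
  inner integral.\<close>

lemma (in ustat_product) regression:
  assumes b [measurable]: "b \<in> borel_measurable (Q (1, 1))" and bnd: "\<And>t. \<bar>b t\<bar> \<le> 1"
  shows "(\<integral>w. K w * b (w (1, 1)) \<partial>\<Omega>k) = (\<integral>t. (hfun t + mean) * b t \<partial>Q (1, 1))"
proof -
  have [measurable]: "(\<lambda>w. b (w (1, 1))) \<in> borel_measurable \<Omega>k"
    by (rule measurable_compose[OF measurable_component_singleton[of "(1, 1)" "pairs k" Q, OF one_in] b])
  have int: "integrable \<Omega>k (\<lambda>w. K w * b (w (1, 1)))"
    by (rule integrable_bounded_mult[OF K_int _ bnd]) measurable
  have "(\<integral>w. K w * b (w (1, 1)) \<partial>\<Omega>k) = (\<integral>t. (\<integral>w. K (w((1, 1) := t)) * b t \<partial>\<Omega>k) \<partial>Q (1, 1))"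
    using Nk.integrable_resample(3)[OF one_in int] by simp
  also have "\<dots> = (\<integral>t. (hfun t + mean) * b t \<partial>Q (1, 1))"
    by (simp add: hfun_def)
  finally show ?thesis .
qed

locale gen_U_sample = prob_space M
  for M :: "'w measure" and \<X> :: "'x measure" and \<Y> :: "'y measure"
    and X :: "nat \<Rightarrow> 'w \<Rightarrow> 'x" and Y :: "nat \<times> nat \<Rightarrow> 'w \<Rightarrow> 'y"
    and f :: "(nat \<Rightarrow> 'x) \<times> (nat \<times> nat \<Rightarrow> 'y) \<Rightarrow> real" and k n :: nat +
  assumes k_ge: "1 \<le> k" and k_le: "k \<le> n"
    and iid_X: "iid_family M \<X> X {1..n}"
    and iid_Y: "iid_family M \<Y> Y (upper_pairs n)"
    and indep_XY: "indep_rv_pair M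
           (PiM {1..n} (\<lambda>_. \<X>)) (\<lambda>\<omega>. \<lambda>i\<in>{1..n}. X i \<omega>)
           (PiM (upper_pairs n) (\<lambda>_. \<Y>)) (\<lambda>\<omega>. \<lambda>p\<in>upper_pairs n. Y p \<omega>)"
    and f_meas: "f \<in> borel_measurable (kernel_space k \<X> \<Y>)"
    and f_sym: "symmetric_kernel k \<X> \<Y> f"
    and F4: "integrable M (\<lambda>\<omega>. \<bar>kernel_at k f X Y (\<lambda>i. i) \<omega>\<bar> ^ 4)"
begin

section \<open>The sample as one independent family\<close>

lemma X_rv: "i \<in> {1..n} \<Longrightarrow> X i \<in> M \<rightarrow>\<^sub>M \<X>"
  using iid_X unfolding iid_family_def indep_vars_def by blast

lemma Y_rv: "p \<in> upper_pairs n \<Longrightarrow> Y p \<in> M \<rightarrow>\<^sub>M \<Y>"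
  using iid_Y unfolding iid_family_def indep_vars_def by blast

lemma finite_upper: "finite (upper_pairs m)"
  by (rule finite_subset[of _ "{1..m} \<times> {1..m}"]) (auto simp: upper_pairs_def)

lemma pairs_split: "pairs m = (\<lambda>i. (i, i)) ` {1..m} \<union> upper_pairs m"
proof (intro set_eqI iffI)
  fix p assume "p \<in> pairs m"
  then show "p \<in> (\<lambda>i. (i, i)) ` {1..m} \<union> upper_pairs m"
    by (cases p; cases "fst p = snd p") (auto simp: pairs_def upper_pairs_def)
qed (auto simp: pairs_def upper_pairs_def)

text \<open>All variables are embedded into the single value type \<open>'x \<times> 'y\<close>, with a dummy in the
  unused component, so that the sample becomes one independent family indexed by the pairs
  \<open>i \<le> j\<close>; the diagonal carries the \<open>X\<close> variables.\<close>
definition QX :: "('x \<times> 'y) measure" where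
  "QX = distr M (\<X> \<Otimes>\<^sub>M count_space UNIV) (\<lambda>\<omega>. (X 1 \<omega>, undefined))"

definition QY :: "('x \<times> 'y) measure" where
  "QY = distr M (count_space UNIV \<Otimes>\<^sub>M \<Y>) (\<lambda>\<omega>. (undefined, Y (1, 2) \<omega>))"

text \<open>Every index that is not an upper pair receives \<open>QX\<close>, also outside
  \<open>pairs n\<close>, so that each \<open>Q p\<close> is a probability measure.\<close>

definition Q :: "nat \<times> nat \<Rightarrow> ('x \<times> 'y) measure" where
  "Q p = (if p \<in> upper_pairs n then QY else QX)"

definition Z :: "nat \<times> nat \<Rightarrow> 'w \<Rightarrow> 'x \<times> 'y" where
  "Z p \<omega> = (if p \<in> upper_pairs n then (undefined, Y p \<omega>) else (X (fst p) \<omega>, undefined))"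

definition Zv :: "'w \<Rightarrow> nat \<times> nat \<Rightarrow> 'x \<times> 'y" where
  "Zv \<omega> = (\<lambda>p\<in>pairs n. Z p \<omega>)"

definition K :: "(nat \<times> nat \<Rightarrow> 'x \<times> 'y) \<Rightarrow> real" where
  "K z = f (\<lambda>i\<in>{1..k}. fst (z (i, i)), \<lambda>p\<in>upper_pairs k. snd (z p))"

lemma one_in_n: "1 \<in> {1..n}" using k_ge k_le by simp

text \<open>An upper pair exists only if n \<ge> 2, and then Y (1, 2) is a genuine member of the
  family; for n = 1 the measure \<open>QY\<close> is never a value of \<open>Q\<close>.\<close>

lemma upper_12: "p \<in> upper_pairs n \<Longrightarrow> (1, 2) \<in> upper_pairs n"
  by (auto simp: upper_pairs_def)

lemma diag_not_upper: "(i, i) \<notin> upper_pairs m" by (simp add: upper_pairs_def)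

lemma Q_diag: "Q (i, i) = QX" by (simp add: Q_def diag_not_upper)

lemma Q_upper: "p \<in> upper_pairs n \<Longrightarrow> Q p = QY" by (simp add: Q_def)

lemma prob_space_Q: "prob_space (Q p)"
proof (cases "p \<in> upper_pairs n")
  case True
  note Y_rv[OF upper_12[OF True], measurable]
  show ?thesis unfolding Q_upper[OF True] QY_def by (rule prob_space_distr) measurable
next
  case False
  note X_rv[OF one_in_n, measurable]
  have "Q p = QX" using False by (simp add: Q_def)
  then show ?thesis unfolding QX_def by (simp only:) (rule prob_space_distr, measurable)
qed

lemma Z_rv: "p \<in> pairs n \<Longrightarrow> Z p \<in> M \<rightarrow>\<^sub>M Q p"
proof -
  assume p: "p \<in> pairs n"
  show ?thesis
  proof (cases "p \<in> upper_pairs n")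
    case True
    note Y_rv[OF True, measurable]
    have "Z p = (\<lambda>\<omega>. (undefined, Y p \<omega>))" using True by (simp add: Z_def[abs_def])
    then show ?thesis unfolding Q_upper[OF True] QY_def by simp
  next
    case False
    with p obtain i where i: "i \<in> {1..n}" "p = (i, i)" unfolding pairs_split by blast
    note X_rv[OF i(1), measurable]
    have "Z p = (\<lambda>\<omega>. (X i \<omega>, undefined))" using False i by (simp add: Z_def[abs_def])
    then show ?thesis unfolding i(2) Q_diag QX_def by simp
  qed
qed

lemma Zv_rv: "Zv \<in> M \<rightarrow>\<^sub>M PiM (pairs n) Q"
  unfolding Zv_def[abs_def] by (intro measurable_restrict Z_rv)

text \<open>An event about the embedded variable is one about the variable itself, so its
  probability depends on the common law alone and may be computed with the representative
  V0.\<close>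

lemma prob_embed:
  assumes V: "V \<in> M \<rightarrow>\<^sub>M N" "V0 \<in> M \<rightarrow>\<^sub>M N" and eq: "distr M N V = distr M N V0"
    and e: "e \<in> N \<rightarrow>\<^sub>M L" and A: "A \<in> sets L"
  shows "{\<omega> \<in> space M. e (V \<omega>) \<in> A} = V -` (e -` A \<inter> space N) \<inter> space M"
    and "e -` A \<inter> space N \<in> sets N"
    and "prob (V -` (e -` A \<inter> space N) \<inter> space M) = measure (distr M L (\<lambda>\<omega>. e (V0 \<omega>))) A"
proof -
  let ?B = "e -` A \<inter> space N"
  have sub: "{\<omega> \<in> space M. e (T \<omega>) \<in> A} = T -` ?B \<inter> space M" if "T \<in> M \<rightarrow>\<^sub>M N" for T
    using measurable_space[OF that] by blast
  show "{\<omega> \<in> space M. e (V \<omega>) \<in> A} = V -` ?B \<inter> space M" by (rule sub[OF V(1)])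
  show B: "?B \<in> sets N" by (rule measurable_sets[OF e A])
  have "prob (V -` ?B \<inter> space M) = prob (V0 -` ?B \<inter> space M)"
    using measure_distr[OF V(1) B] measure_distr[OF V(2) B] eq by simp
  also have "V0 -` ?B \<inter> space M = (\<lambda>\<omega>. e (V0 \<omega>)) -` A \<inter> space M"
    using sub[OF V(2)] by blast
  also have "prob \<dots> = measure (distr M L (\<lambda>\<omega>. e (V0 \<omega>))) A"
    by (rule measure_distr[OF measurable_compose[OF V(2) e] A, symmetric])
  finally show "prob (V -` ?B \<inter> space M) = measure (distr M L (\<lambda>\<omega>. e (V0 \<omega>))) A" .
qed

lemma prob_X:
  assumes i: "i \<in> {1..n}" and A: "A \<in> sets QX"
  defines "B \<equiv> (\<lambda>x. (x, undefined)) -` A \<inter> space \<X>"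
  shows "{\<omega> \<in> space M. (X i \<omega>, undefined) \<in> A} = X i -` B \<inter> space M" "B \<in> sets \<X>"
    "prob (X i -` B \<inter> space M) = measure QX A"
proof -
  have "distr M \<X> (X i) = distr M \<X> (X 1)"
    using iid_X i one_in_n unfolding iid_family_def by blast
  moreover have "(\<lambda>x. (x, undefined)) \<in> \<X> \<rightarrow>\<^sub>M \<X> \<Otimes>\<^sub>M count_space UNIV" by measurable
  moreover have "A \<in> sets (\<X> \<Otimes>\<^sub>M count_space UNIV)" using A by (simp add: QX_def)
  ultimately show "{\<omega> \<in> space M. (X i \<omega>, undefined) \<in> A} = X i -` B \<inter> space M" "B \<in> sets \<X>"
    "prob (X i -` B \<inter> space M) = measure QX A"
    unfolding B_def QX_def by (rule prob_embed[OF X_rv[OF i] X_rv[OF one_in_n]])+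
qed

lemma prob_Y:
  assumes p: "p \<in> upper_pairs n" and A: "A \<in> sets QY"
  defines "B \<equiv> (\<lambda>y. (undefined, y)) -` A \<inter> space \<Y>"
  shows "{\<omega> \<in> space M. (undefined, Y p \<omega>) \<in> A} = Y p -` B \<inter> space M" "B \<in> sets \<Y>"
    "prob (Y p -` B \<inter> space M) = measure QY A"
proof -
  have "distr M \<Y> (Y p) = distr M \<Y> (Y (1, 2))"
    using iid_Y p upper_12[OF p] unfolding iid_family_def by blast
  moreover have "(\<lambda>y. (undefined, y)) \<in> \<Y> \<rightarrow>\<^sub>M count_space UNIV \<Otimes>\<^sub>M \<Y>" by measurable
  moreover have "A \<in> sets (count_space UNIV \<Otimes>\<^sub>M \<Y>)" using A by (simp add: QY_def)
  ultimately show "{\<omega> \<in> space M. (undefined, Y p \<omega>) \<in> A} = Y p -` B \<inter> space M" "B \<in> sets \<Y>"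
    "prob (Y p -` B \<inter> space M) = measure QY A"
    unfolding B_def QY_def by (rule prob_embed[OF Y_rv[OF p] Y_rv[OF upper_12[OF p]]])+
qed

lemma finite_product_prob_space_Q: "finite I \<Longrightarrow> finite_product_prob_space Q I"
proof -
  assume "finite I"
  interpret q: prob_space "Q p" for p by (rule prob_space_Q)
  show ?thesis by standard fact
qed

text \<open>Checked on rectangles: such an event is the intersection of an X event and a Y event.
  Independence of the two families splits it in two, independence within each family splits it into
  coordinates.\<close>

lemma distr_Zv: "distr M (PiM (pairs n) Q) Zv = PiM (pairs n) Q"
proof -
  interpret P: finite_product_prob_space Q "pairs n"
    by (rule finite_product_prob_space_Q[OF finite_pairs])
  show ?thesis
  proof (rule P.PiM_eqI[OF finite_pairs])
    fix A assume A: "\<And>p. p \<in> pairs n \<Longrightarrow> A p \<in> sets (Q p)"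
    have AX: "A (i, i) \<in> sets QX" if "i \<in> {1..n}" for i
      using A[of "(i, i)"] that unfolding Q_diag by (auto simp: pairs_def)
    have AY: "A p \<in> sets QY" if "p \<in> upper_pairs n" for p
      using A[of p] that unfolding pairs_split by (simp add: Q_upper)
    define BX where "BX i = (\<lambda>x. (x, undefined)) -` A (i, i) \<inter> space \<X>" for i
    define BY where "BY p = (\<lambda>y. (undefined, y)) -` A p \<inter> space \<Y>" for p
    define evX where "evX = (\<lambda>\<omega>. \<lambda>i\<in>{1..n}. X i \<omega>) -` PiE {1..n} BX \<inter> space M"
    define evY where "evY = (\<lambda>\<omega>. \<lambda>p\<in>upper_pairs n. Y p \<omega>) -` PiE (upper_pairs n) BY \<inter> space M"
    note pX = prob_X[OF _ AX, folded BX_def] and pY = prob_Y[OF _ AY, folded BY_def]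
    have evX: "evX = {\<omega> \<in> space M. \<forall>i\<in>{1..n}. X i \<omega> \<in> BX i}"
      by (auto simp: evX_def PiE_iff)
    have evY: "evY = {\<omega> \<in> space M. \<forall>p\<in>upper_pairs n. Y p \<omega> \<in> BY p}"
      by (auto simp: evY_def PiE_iff)
    have "PiE {1..n} BX \<in> sets (PiM {1..n} (\<lambda>_. \<X>))"
      by (intro sets_PiM_I_finite) (auto intro: pX(2))
    moreover have "PiE (upper_pairs n) BY \<in> sets (PiM (upper_pairs n) (\<lambda>_. \<Y>))"
      by (intro sets_PiM_I_finite finite_upper) (auto intro: pY(2))
    ultimately have indep: "prob (evX \<inter> evY) = prob evX * prob evY"
      using indep_XY unfolding indep_rv_pair_def evX_def evY_def
      by (blast intro: indep_setD in_vimage_algebra)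
    have probX: "prob evX = (\<Prod>i\<in>{1..n}. measure QX (A (i, i)))"
    proof -
      have "evX = (\<Inter>i\<in>{1..n}. X i -` BX i \<inter> space M)" using one_in_n by (auto simp: evX)
      also have "prob \<dots> = (\<Prod>i\<in>{1..n}. prob (X i -` BX i \<inter> space M))"
        using iid_X one_in_n pX(2) unfolding iid_family_def by (intro indep_varsD_finite[of "\<lambda>_. \<X>"]) auto
      also have "\<dots> = (\<Prod>i\<in>{1..n}. measure QX (A (i, i)))"
        by (intro prod.cong refl pX(3))
      finally show ?thesis .
    qed
    have probY: "prob evY = (\<Prod>p\<in>upper_pairs n. measure QY (A p))"
    \<comment> \<open>The product rule for independent families takes a nonempty index set; for n =
      1 the Y event is the whole space.\<close>
    proof (cases "upper_pairs n = {}")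
      case True
      then show ?thesis by (simp add: evY prob_space)
    next
      case False
      have "evY = (\<Inter>p\<in>upper_pairs n. Y p -` BY p \<inter> space M)" using False by (auto simp: evY)
      also have "prob \<dots> = (\<Prod>p\<in>upper_pairs n. prob (Y p -` BY p \<inter> space M))"
        using iid_Y False finite_upper pY(2) unfolding iid_family_def
        by (intro indep_varsD_finite[of "\<lambda>_. \<Y>"]) auto
      also have "\<dots> = (\<Prod>p\<in>upper_pairs n. measure QY (A p))"
        by (intro prod.cong refl pY(3))
      finally show ?thesis .
    qed
    have "Zv -` PiE (pairs n) A \<inter> space M = evX \<inter> evY"
    proof (intro set_eqI iffI)
      fix \<omega> assume \<omega>: "\<omega> \<in> Zv -` PiE (pairs n) A \<inter> space M"
      then have Z: "Z p \<omega> \<in> A p" if "p \<in> pairs n" for p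
        using that by (auto simp: Zv_def PiE_iff)
      have "X i \<omega> \<in> BX i" if i: "i \<in> {1..n}" for i
        using Z[of "(i, i)"] i pX(1)[OF i i] \<omega> by (auto simp: Z_def diag_not_upper pairs_def)
      moreover have "Y p \<omega> \<in> BY p" if p: "p \<in> upper_pairs n" for p
        using Z[of p] p pY(1)[OF p p] \<omega> unfolding pairs_split by (auto simp: Z_def)
      ultimately show "\<omega> \<in> evX \<inter> evY" using \<omega> by (simp add: evX evY)
    next
      fix \<omega> assume \<omega>: "\<omega> \<in> evX \<inter> evY"
      have "Z p \<omega> \<in> A p" if "p \<in> pairs n" for p
      proof (cases "p \<in> upper_pairs n")
        case True
        then show ?thesis using \<omega> by (simp add: evY BY_def Z_def)
      next
        case False
        with that obtain i where i: "i \<in> {1..n}" "p = (i, i)" unfolding pairs_split by blast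
        then show ?thesis using \<omega> by (simp add: evX BX_def Z_def diag_not_upper)
      qed
      then show "\<omega> \<in> Zv -` PiE (pairs n) A \<inter> space M"
        using \<omega> by (simp add: Zv_def PiE_iff evX)
    qed
    moreover have "PiE (pairs n) A \<in> sets (PiM (pairs n) Q)"
      by (intro sets_PiM_I_finite finite_pairs A)
    ultimately have "emeasure (distr M (PiM (pairs n) Q) Zv) (PiE (pairs n) A) = emeasure M (evX \<inter> evY)"
      using emeasure_distr[OF Zv_rv] by simp
    also have "\<dots> = ennreal ((\<Prod>i\<in>{1..n}. measure QX (A (i, i))) * (\<Prod>p\<in>upper_pairs n. measure QY (A p)))"
      by (simp only: emeasure_eq_measure indep probX probY)
    also have "(\<Prod>i\<in>{1..n}. measure QX (A (i, i))) * (\<Prod>p\<in>upper_pairs n. measure QY (A p))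
        = (\<Prod>p\<in>pairs n. measure (Q p) (A p))"
    proof -
      have "(\<Prod>p\<in>pairs n. measure (Q p) (A p))
        = (\<Prod>p\<in>(\<lambda>i. (i, i)) ` {1..n}. measure (Q p) (A p)) * (\<Prod>p\<in>upper_pairs n. measure (Q p) (A p))"
        unfolding pairs_split by (rule prod.union_disjoint) (auto simp: finite_upper diag_not_upper)
      also have "(\<Prod>p\<in>upper_pairs n. measure (Q p) (A p)) = (\<Prod>p\<in>upper_pairs n. measure QY (A p))"
        by (rule prod.cong) (simp_all only: Q_upper)
      also have "(\<Prod>p\<in>(\<lambda>i. (i, i)) ` {1..n}. measure (Q p) (A p)) = (\<Prod>i\<in>{1..n}. measure QX (A (i, i)))"
        by (subst prod.reindex) (simp_all add: inj_on_def Q_diag)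
      finally show ?thesis ..
    qed
    also have "ennreal (\<Prod>p\<in>pairs n. measure (Q p) (A p)) = (\<Prod>p\<in>pairs n. emeasure (Q p) (A p))"
      by (simp add: prod_ennreal P.M.emeasure_eq_measure)
    finally show "emeasure (distr M (PiM (pairs n) Q) Zv) (PiE (pairs n) A) = (\<Prod>p\<in>pairs n. emeasure (Q p) (A p))" .
  qed simp
qed

section \<open>The kernel as a function of the embedded sample\<close>

lemma pairs_mono: "pairs k \<subseteq> pairs n" using k_le by (auto simp: pairs_def)

lemma upper_mono: "upper_pairs k \<subseteq> upper_pairs n" using k_le by (auto simp: upper_pairs_def)

definition Zk :: "'w \<Rightarrow> nat \<times> nat \<Rightarrow> 'x \<times> 'y" where
  "Zk \<omega> = restrict (Zv \<omega>) (pairs k)"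

lemma Zk_rv: "Zk \<in> M \<rightarrow>\<^sub>M PiM (pairs k) Q"
  unfolding Zk_def[abs_def]
  by (rule measurable_compose[OF Zv_rv measurable_restrict_subset[OF pairs_mono]])

lemma distr_Zk: "distr M (PiM (pairs k) Q) Zk = PiM (pairs k) Q"
proof -
  interpret P: finite_product_prob_space Q "pairs n"
    by (rule finite_product_prob_space_Q[OF finite_pairs])
  have "distr M (PiM (pairs k) Q) Zk = distr (distr M (PiM (pairs n) Q) Zv) (PiM (pairs k) Q) (\<lambda>w. restrict w (pairs k))"
    by (subst distr_distr[OF measurable_restrict_subset[OF pairs_mono] Zv_rv]) (simp add: Zk_def[abs_def] comp_def)
  also have "\<dots> = PiM (pairs k) Q"
    unfolding distr_Zv by (rule P.distr_PiM_restrict_finite[OF finite_pairs pairs_mono])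
  finally show ?thesis .
qed

lemma to_kernel_space:
  "(\<lambda>z. (\<lambda>i\<in>{1..k}. fst (z (i, i)), \<lambda>p\<in>upper_pairs k. snd (z p))) \<in> PiM (pairs k) Q \<rightarrow>\<^sub>M kernel_space k \<X> \<Y>"
  unfolding kernel_space_def
proof (intro measurable_Pair measurable_restrict)
  fix i assume "i \<in> {1..k}"
  then have "(i, i) \<in> pairs k" by (auto simp: pairs_def)
  then have "(\<lambda>z. z (i, i)) \<in> PiM (pairs k) Q \<rightarrow>\<^sub>M \<X> \<Otimes>\<^sub>M count_space UNIV"
    using measurable_component_singleton[of "(i, i)" "pairs k" Q] by (simp add: Q_diag QX_def)
  then show "(\<lambda>z. fst (z (i, i))) \<in> PiM (pairs k) Q \<rightarrow>\<^sub>M \<X>" by measurable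
next
  fix p assume p: "p \<in> upper_pairs k"
  then have "p \<in> pairs k" unfolding pairs_split by blast
  moreover have "Q p = QY" using p upper_mono by (intro Q_upper) blast
  ultimately have "(\<lambda>z. z p) \<in> PiM (pairs k) Q \<rightarrow>\<^sub>M count_space UNIV \<Otimes>\<^sub>M \<Y>"
    using measurable_component_singleton[of p "pairs k" Q] by (simp add: QY_def)
  then show "(\<lambda>z. snd (z p)) \<in> PiM (pairs k) Q \<rightarrow>\<^sub>M \<Y>" by measurable
qed

lemma K_meas: "K \<in> borel_measurable (PiM (pairs k) Q)"
  unfolding K_def[abs_def] by (rule measurable_compose[OF to_kernel_space f_meas])

text \<open>A permutation keeps upper pairs upper after sorting, so \<open>pull\<close> on the
  embedded block is the min-max relabelling in \<open>symmetric_kernel\<close>.\<close>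

lemma K_sym:
  assumes \<pi>: "\<pi> permutes {1..k}" and z: "z \<in> space (PiM (pairs k) Q)"
  shows "K (pull k \<pi> z) = K z"
proof -
  let ?x = "\<lambda>i\<in>{1..k}. fst (z (i, i))" and ?y = "\<lambda>p\<in>upper_pairs k. snd (z p)"
  have xy: "(?x, ?y) \<in> space (kernel_space k \<X> \<Y>)" by (rule measurable_space[OF to_kernel_space z])
  have \<pi>_mem: "\<pi> \<in> {1..k} \<rightarrow> {1..k}" using permutes_in_image[OF \<pi>] by blast
  have up: "sort_pair \<pi> p \<in> upper_pairs k" if p: "p \<in> upper_pairs k" for p
  proof -
    have mem: "fst p \<in> {1..k}" "snd p \<in> {1..k}" and ne: "fst p \<noteq> snd p"
      using p by (auto simp: upper_pairs_def)
    have "\<pi> (fst p) \<in> {1..k}" "\<pi> (snd p) \<in> {1..k}" using mem \<pi>_mem by blast+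
    moreover have "\<pi> (fst p) \<noteq> \<pi> (snd p)" using permutes_inj[OF \<pi>] ne by (simp add: inj_eq)
    ultimately show ?thesis
      by (auto simp: sort_pair_def upper_pairs_def min_def max_def)
  qed
  have 1: "(\<lambda>i\<in>{1..k}. fst (pull k \<pi> z (i, i))) = (\<lambda>i\<in>{1..k}. ?x (\<pi> i))"
  proof (rule restrict_ext)
    fix i assume i: "i \<in> {1..k}"
    then have "(i, i) \<in> pairs k" "\<pi> i \<in> {1..k}" using \<pi>_mem by (auto simp: pairs_def)
    then show "fst (pull k \<pi> z (i, i)) = ?x (\<pi> i)" by (simp add: pull_def sort_pair_def)
  qed
  have 2: "(\<lambda>p\<in>upper_pairs k. snd (pull k \<pi> z p))
      = (\<lambda>p\<in>upper_pairs k. ?y (min (\<pi> (fst p)) (\<pi> (snd p)), max (\<pi> (fst p)) (\<pi> (snd p))))"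
  proof (rule restrict_ext)
    fix p assume p: "p \<in> upper_pairs k"
    then have "p \<in> pairs k" unfolding pairs_split by blast
    then show "snd (pull k \<pi> z p) = ?y (min (\<pi> (fst p)) (\<pi> (snd p)), max (\<pi> (fst p)) (\<pi> (snd p)))"
      using up[OF p] by (simp add: pull_def sort_pair_def)
  qed
  have "\<forall>(x, y)\<in>space (kernel_space k \<X> \<Y>).
      f (\<lambda>i\<in>{1..k}. x (\<pi> i),
         \<lambda>p\<in>upper_pairs k. y (min (\<pi> (fst p)) (\<pi> (snd p)), max (\<pi> (fst p)) (\<pi> (snd p)))) = f (x, y)"
    using f_sym \<pi> unfolding symmetric_kernel_def by blast
  from bspec[OF this xy] show ?thesis unfolding K_def 1 2 by simp
qed

text \<open>An increasing tuple sends upper pairs to sorted pairs, so the sorting inside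
  \<open>pull\<close> acts as the identity and the Y variables match.\<close>

lemma kernel_at_eq:
  assumes a: "strict_mono_on {1..k} a" "a \<in> {1..k} \<rightarrow> {1..n}"
  shows "kernel_at k f X Y a \<omega> = K (pull k a (Zv \<omega>))"
proof -
  have 1: "(\<lambda>i\<in>{1..k}. fst (pull k a (Zv \<omega>) (i, i))) = (\<lambda>i\<in>{1..k}. X (a i) \<omega>)"
  proof (rule restrict_ext)
    fix i assume i: "i \<in> {1..k}"
    then have "(i, i) \<in> pairs k" "a i \<in> {1..n}" using a(2) by (auto simp: pairs_def)
    moreover from this(2) have "(a i, a i) \<in> pairs n" by (simp add: pairs_def)
    ultimately show "fst (pull k a (Zv \<omega>) (i, i)) = X (a i) \<omega>"
      by (simp add: pull_def sort_pair_def Zv_def Z_def diag_not_upper)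
  qed
  have 2: "(\<lambda>p\<in>upper_pairs k. snd (pull k a (Zv \<omega>) p)) = (\<lambda>p\<in>upper_pairs k. Y (a (fst p), a (snd p)) \<omega>)"
  proof (rule restrict_ext)
    fix p assume p: "p \<in> upper_pairs k"
    then have pk: "p \<in> pairs k" unfolding pairs_split by blast
    have mem: "fst p \<in> {1..k}" "snd p \<in> {1..k}" "fst p < snd p" using p by (auto simp: upper_pairs_def)
    have lt: "a (fst p) < a (snd p)" by (rule strict_mono_onD[OF a(1) mem])
    have an: "a (fst p) \<in> {1..n}" "a (snd p) \<in> {1..n}" using mem a(2) by blast+
    have up: "(a (fst p), a (snd p)) \<in> upper_pairs n" using lt an by (simp add: upper_pairs_def)
    then have "(a (fst p), a (snd p)) \<in> pairs n" unfolding pairs_split by blast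
    then show "snd (pull k a (Zv \<omega>) p) = Y (a (fst p), a (snd p)) \<omega>"
      using pk lt up by (simp add: pull_def sort_pair_def Zv_def Z_def min_def max_def)
  qed
  show ?thesis unfolding kernel_at_def K_def 1 2 ..
qed

lemma F_eq: "kernel_at k f X Y (\<lambda>i. i) \<omega> = K (Zk \<omega>)"
proof -
  have "pull k (\<lambda>i. i) (Zv \<omega>) = Zk \<omega>"
  proof
    show "pull k (\<lambda>i. i) (Zv \<omega>) p = Zk \<omega> p" for p
      by (cases p) (auto simp: pull_def Zk_def sort_pair_def pairs_def min_def max_def)
  qed
  moreover have "kernel_at k f X Y (\<lambda>i. i) \<omega> = K (pull k (\<lambda>i. i) (Zv \<omega>))"
    using k_le by (intro kernel_at_eq) (auto simp: strict_mono_on_def monotone_on_def)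
  ultimately show ?thesis by simp
qed

lemma K4: "integrable (PiM (pairs k) Q) (\<lambda>w. K w ^ 4)"
proof -
  have "integrable M (\<lambda>\<omega>. K (Zk \<omega>) ^ 4)" using F4 by (simp add: F_eq)
  then have "integrable (distr M (PiM (pairs k) Q) Zk) (\<lambda>w. K w ^ 4)"
    using K_meas by (subst integrable_distr_eq[OF Zk_rv]) auto
  then show ?thesis unfolding distr_Zk .
qed

sublocale P: ustat_product n k Q K
proof (rule ustat_product.intro)
  show "1 \<le> k" "k \<le> n" by (rule k_ge, rule k_le)
  show "Q (i, j) = Q (1, 2)" if "1 \<le> i" "i < j" "j \<le> n" for i j
  proof -
    have "(i, j) \<in> upper_pairs n" using that by (simp add: upper_pairs_def)
    then show ?thesis using upper_12[OF \<open>(i, j) \<in> upper_pairs n\<close>] by (simp only: Q_upper)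
  qed
  show "prob_space (Q p)" for p by (rule prob_space_Q)
  show "Q (i, i) = Q (1, 1)" if "i \<in> {1..n}" for i by (simp only: Q_diag)
  show "K \<in> borel_measurable (PiM (pairs k) Q)" by (rule K_meas)
  show "integrable (PiM (pairs k) Q) (\<lambda>w. K w ^ 4)" by (rule K4)
  show "K (pull k \<pi> w) = K w" if "\<pi> permutes {1..k}" "w \<in> space (PiM (pairs k) Q)" for \<pi> w
    using that by (rule K_sym)
qed

section \<open>Moments, regression function and law carried back to the sample\<close>

lemma F_int: "integral\<^sup>L M (kernel_at k f X Y (\<lambda>i. i)) = P.mean"
  and F_integrable: "integrable M (kernel_at k f X Y (\<lambda>i. i))"
  and F_power4: "(\<integral>\<omega>. \<bar>kernel_at k f X Y (\<lambda>i. i) \<omega>\<bar> ^ 4 \<partial>M) = (\<integral>w. K w ^ 4 \<partial>PiM (pairs k) Q)"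
proof -
  note [measurable] = K_meas
  have eq: "kernel_at k f X Y (\<lambda>i. i) = (\<lambda>\<omega>. K (Zk \<omega>))" by (rule ext) (rule F_eq)
  show "integral\<^sup>L M (kernel_at k f X Y (\<lambda>i. i)) = P.mean"
    unfolding eq P.mean_def using integral_distr[OF Zk_rv K_meas] by (simp only: distr_Zk)
  show "integrable M (kernel_at k f X Y (\<lambda>i. i))"
    unfolding eq using integrable_distr_eq[OF Zk_rv K_meas] P.K_int by (simp only: distr_Zk)
  have "(\<lambda>w. K w ^ 4) \<in> borel_measurable (PiM (pairs k) Q)" by measurable
  from integral_distr[OF Zk_rv this]
  have "(\<integral>\<omega>. K (Zk \<omega>) ^ 4 \<partial>M) = (\<integral>w. K w ^ 4 \<partial>PiM (pairs k) Q)" by (simp only: distr_Zk)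
  then show "(\<integral>\<omega>. \<bar>kernel_at k f X Y (\<lambda>i. i) \<omega>\<bar> ^ 4 \<partial>M) = (\<integral>w. K w ^ 4 \<partial>PiM (pairs k) Q)"
    unfolding eq by simp
qed

lemma S_eq: "gen_U_stat n k f X Y \<omega> = P.stat (Zv \<omega>)"
  unfolding gen_U_stat_def P.stat_def P.incr_def
proof (rule sum.cong[OF refl])
  fix a assume "a \<in> {a \<in> {1..k} \<rightarrow>\<^sub>E {1..n}. strict_mono_on {1..k} a}"
  then show "kernel_at k f X Y a \<omega> = K (pull k a (Zv \<omega>))"
    by (intro kernel_at_eq) (auto simp: PiE_def)
qed

lemma stat_meas: "P.stat \<in> borel_measurable (PiM (pairs n) Q)"
proof -
  have "sq_integrable (PiM (pairs n) Q) P.stat"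
    unfolding P.stat_def[abs_def] by (rule sq_integrable_sum) (rule P.K_pull_sq)
  then show ?thesis by auto
qed

lemma expectation_Zv:
  fixes F :: "_ \<Rightarrow> real"
  assumes "F \<in> borel_measurable (PiM (pairs n) Q)"
  shows "expectation (\<lambda>\<omega>. F (Zv \<omega>)) = integral\<^sup>L (PiM (pairs n) Q) F"
  using integral_distr[OF Zv_rv assms] by (simp only: distr_Zv)

lemma S_law:
  "prob {\<omega> \<in> space M. (gen_U_stat n k f X Y \<omega> - expectation (gen_U_stat n k f X Y)) / sqrt (variance (gen_U_stat n k f X Y)) \<le> z}
   = measure (PiM (pairs n) Q) {w \<in> space (PiM (pairs n) Q).
       (P.stat w - P.N.P.expectation P.stat) / sqrt (P.N.P.variance P.stat) \<le> z}"
proof -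
  note [measurable] = stat_meas
  have eq: "gen_U_stat n k f X Y = (\<lambda>\<omega>. P.stat (Zv \<omega>))" by (rule ext) (rule S_eq)
  have E: "expectation (gen_U_stat n k f X Y) = P.N.P.expectation P.stat"
    unfolding eq by (rule expectation_Zv[OF stat_meas])
  have "(\<lambda>w. (P.stat w - P.N.P.expectation P.stat)\<^sup>2) \<in> borel_measurable (PiM (pairs n) Q)" by measurable
  from expectation_Zv[OF this]
  have V: "expectation (\<lambda>\<omega>. (gen_U_stat n k f X Y \<omega> - P.N.P.expectation P.stat)\<^sup>2) = P.N.P.variance P.stat"
    unfolding eq .
  let ?A = "{w \<in> space (PiM (pairs n) Q). (P.stat w - P.N.P.expectation P.stat) / sqrt (P.N.P.variance P.stat) \<le> z}"
  have "?A \<in> sets (PiM (pairs n) Q)" by measurable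
  from measure_distr[OF Zv_rv this]
  have "measure (PiM (pairs n) Q) ?A = prob (Zv -` ?A \<inter> space M)" by (simp only: distr_Zv)
  also have "Zv -` ?A \<inter> space M = {\<omega> \<in> space M. (P.stat (Zv \<omega>) - P.N.P.expectation P.stat) / sqrt (P.N.P.variance P.stat) \<le> z}"
    using measurable_space[OF Zv_rv] by blast
  \<comment> \<open>The expectation is rewritten first, since V is stated with the expectation on
    the product space.\<close>
  finally show ?thesis unfolding E unfolding V unfolding S_eq by simp
qed

text \<open>An event of the sigma-algebra of X 1 is the preimage of some B, so the defining
  integrals of the conditional expectation are instances of \<open>P.regression\<close> with the
  indicator of B. Any version g therefore agrees with \<open>hfun\<close> plus the mean almost
  surely.\<close>

lemma regression_fun:
  assumes g: "is_cond_exp_given M \<X> (X 1) (kernel_at k f X Y (\<lambda>i. i)) g"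
  shows "AE \<omega> in M. g (X 1 \<omega>) = P.hfun (X 1 \<omega>, undefined) + P.mean"
proof -
  let ?F = "kernel_at k f X Y (\<lambda>i. i)" and ?V = "vimage_algebra (space M) (X 1) \<X>"
  let ?e = "\<lambda>x. P.hfun (x, undefined) + P.mean"
  note X1 = X_rv[OF one_in_n]
  have X1_fun: "X 1 \<in> space M \<rightarrow> space \<X>" using measurable_space[OF X1] by blast
  have h: "P.hfun \<in> borel_measurable (\<X> \<Otimes>\<^sub>M count_space UNIV)"
    using P.hfun_meas by (simp add: Q_diag QX_def)
  have e [measurable]: "?e \<in> borel_measurable \<X>"
    using measurable_compose[OF measurable_Pair2'[of undefined "count_space UNIV"] h] by simp
  have "subalgebra M ?V"
    unfolding subalgebra_def using sets_image_in_sets[of M "space M" "X 1" \<X>] X1 by simp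
  then interpret V: finite_measure_subalgebra M ?V by unfold_locales
  have eV: "(\<lambda>\<omega>. ?e (X 1 \<omega>)) \<in> borel_measurable ?V"
    by (rule measurable_compose[OF measurable_vimage_algebra1[OF X1_fun] e])
  have dist: "distr M QX (\<lambda>\<omega>. (X 1 \<omega>, undefined)) = QX"
    unfolding QX_def by (rule distr_cong) simp_all
  have QX_rv: "(\<lambda>\<omega>. (X 1 \<omega>, undefined)) \<in> M \<rightarrow>\<^sub>M QX"
    using X1 unfolding QX_def by simp
  have eint: "integrable M (\<lambda>\<omega>. ?e (X 1 \<omega>))"
  proof -
    have "integrable QX P.hfun" using P.hfun_int by (simp add: Q_diag)
    then have "integrable (distr M QX (\<lambda>\<omega>. (X 1 \<omega>, undefined))) P.hfun" unfolding dist .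
    then have "integrable M (\<lambda>\<omega>. P.hfun (X 1 \<omega>, undefined))"
      by (rule integrable_distr[OF QX_rv])
    then show ?thesis by simp
  qed
  have "AE \<omega> in M. real_cond_exp M ?V ?F \<omega> = ?e (X 1 \<omega>)"
  proof (rule V.real_cond_exp_charact[OF _ F_integrable eint eV])
    fix A assume "A \<in> sets ?V"
    then obtain B where B: "B \<in> sets \<X>" "A = X 1 -` B \<inter> space M"
      using sets_vimage_algebra2[OF X1_fun] by blast
    let ?b = "\<lambda>t :: 'x \<times> 'y. indicator B (fst t) :: real"
    have "?b \<in> borel_measurable (\<X> \<Otimes>\<^sub>M count_space UNIV)" using B(1) by measurable
    then have b: "?b \<in> borel_measurable QX" by (simp add: QX_def)
    have "(1, 1) \<in> pairs n" using pairs_mono P.one_in by blast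
    then have Z1: "Zk \<omega> (1, 1) = (X 1 \<omega>, undefined)" for \<omega>
      using P.one_in diag_not_upper[of 1] by (simp add: Zk_def Zv_def Z_def)
    have ind: "indicator A \<omega> = ?b (X 1 \<omega>, undefined)" if "\<omega> \<in> space M" for \<omega>
      using that unfolding B(2) indicator_def by simp
    have Kb: "(\<lambda>w. K w * ?b (w (1, 1))) \<in> borel_measurable (PiM (pairs k) Q)"
      using K_meas measurable_compose[OF measurable_component_singleton[of "(1, 1)" "pairs k" Q, OF P.one_in], of ?b borel] b
      by (simp add: Q_diag)
    have hb: "(\<lambda>t. (P.hfun t + P.mean) * ?b t) \<in> borel_measurable QX"
      using P.hfun_meas b by (simp add: Q_diag)
    have "(\<integral>\<omega>\<in>A. ?F \<omega> \<partial>M) = (\<integral>\<omega>. K (Zk \<omega>) * ?b (Zk \<omega> (1, 1)) \<partial>M)"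
      unfolding set_lebesgue_integral_def
      by (rule Bochner_Integration.integral_cong[OF refl]) (simp add: F_eq Z1 ind del: One_nat_def)
    also have "\<dots> = (\<integral>w. K w * ?b (w (1, 1)) \<partial>PiM (pairs k) Q)"
      using integral_distr[OF Zk_rv Kb] by (simp only: distr_Zk)
    also have "\<dots> = (\<integral>t. (P.hfun t + P.mean) * ?b t \<partial>Q (1, 1))"
      using b by (intro P.regression) (simp_all add: Q_diag indicator_def)
    also have "\<dots> = (\<integral>\<omega>. (P.hfun (X 1 \<omega>, undefined) + P.mean) * ?b (X 1 \<omega>, undefined) \<partial>M)"
      using integral_distr[OF QX_rv hb] unfolding Q_diag dist .
    also have "\<dots> = (\<integral>\<omega>\<in>A. ?e (X 1 \<omega>) \<partial>M)"
      unfolding set_lebesgue_integral_def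
      by (rule Bochner_Integration.integral_cong[OF refl]) (simp add: ind)
    finally show "(\<integral>\<omega>\<in>A. ?F \<omega> \<partial>M) = (\<integral>\<omega>\<in>A. ?e (X 1 \<omega>) \<partial>M)" .
  qed
  moreover have "AE \<omega> in M. g (X 1 \<omega>) = real_cond_exp M ?V ?F \<omega>"
    using g unfolding is_cond_exp_given_def by blast
  ultimately show ?thesis by eventually_elim simp
qed

text \<open>The integral is insensitive to the null set on which the version g may differ from
  \<open>hfun\<close> plus the mean.\<close>

lemma s1sq_eq:
  assumes g: "is_cond_exp_given M \<X> (X 1) (kernel_at k f X Y (\<lambda>i. i)) g"
  shows "(\<integral>\<omega>. \<bar>g (X 1 \<omega>) - expectation (kernel_at k f X Y (\<lambda>i. i))\<bar>\<^sup>2 \<partial>M) = P.s1sq"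
proof -
  note X1 [measurable] = X_rv[OF one_in_n]
  have [measurable]: "g \<in> borel_measurable \<X>" using g unfolding is_cond_exp_given_def by blast
  have h: "P.hfun \<in> borel_measurable QX" using P.hfun_meas by (simp add: Q_diag)
  have QX_rv: "(\<lambda>\<omega>. (X 1 \<omega>, undefined)) \<in> M \<rightarrow>\<^sub>M QX"
    using X1 unfolding QX_def by simp
  have [measurable]: "(\<lambda>\<omega>. P.hfun (X 1 \<omega>, undefined)) \<in> borel_measurable M"
    by (rule measurable_compose[OF QX_rv h])
  have dist: "distr M QX (\<lambda>\<omega>. (X 1 \<omega>, undefined)) = QX"
    unfolding QX_def by (rule distr_cong) simp_all
  have "(\<integral>\<omega>. \<bar>g (X 1 \<omega>) - expectation (kernel_at k f X Y (\<lambda>i. i))\<bar>\<^sup>2 \<partial>M)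
      = (\<integral>\<omega>. (P.hfun (X 1 \<omega>, undefined))\<^sup>2 \<partial>M)"
    unfolding F_int
  proof (rule integral_cong_AE)
    show "AE \<omega> in M. \<bar>g (X 1 \<omega>) - P.mean\<bar>\<^sup>2 = (P.hfun (X 1 \<omega>, undefined))\<^sup>2"
      using regression_fun[OF g] by eventually_elim simp
  qed measurable
  also have "\<dots> = (\<integral>t. (P.hfun t)\<^sup>2 \<partial>QX)"
  proof -
    have "(\<lambda>t. (P.hfun t)\<^sup>2) \<in> borel_measurable QX" using h by measurable
    from integral_distr[OF QX_rv this] show ?thesis unfolding dist by simp
  qed
  finally show ?thesis by (simp add: P.s1sq_def Q_diag)
qed

end

lemma root_4_power2: "0 \<le> x \<Longrightarrow> (root 4 x)\<^sup>2 = sqrt x"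
proof -
  assume x: "0 \<le> x"
  have "((root 4 x)\<^sup>2)\<^sup>2 = root 4 x ^ 4" by simp
  also have "\<dots> = x" using x by simp
  finally show ?thesis by (intro real_sqrt_unique[symmetric]) auto
qed

theorem theorem2p1:
  fixes M :: "'w measure" and \<X> :: "'x measure" and \<Y> :: "'y measure"
    and X :: "nat \<Rightarrow> 'w \<Rightarrow> 'x" and Y :: "nat \<times> nat \<Rightarrow> 'w \<Rightarrow> 'y"
    and f :: "(nat \<Rightarrow> 'x) \<times> (nat \<times> nat \<Rightarrow> 'y) \<Rightarrow> real"
    and g f1 :: "'x \<Rightarrow> real" and F S :: "'w \<Rightarrow> real"
    and k n :: nat and \<sigma>1 :: real
  defines "F \<equiv> kernel_at k f X Y (\<lambda>i. i)"
    and "S \<equiv> gen_U_stat n k f X Y"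
    and "f1 \<equiv> (\<lambda>x. g x - prob_space.expectation M F)"
    and "\<sigma>1 \<equiv> Lp_norm M 2 (\<lambda>\<omega>. f1 (X 1 \<omega>))"
  assumes "prob_space M"
    and "1 \<le> k" and "k \<le> n"
    and "iid_family M \<X> X {1..n}"
    and "iid_family M \<Y> Y (upper_pairs n)"
    and "indep_rv_pair M
           (PiM {1..n} (\<lambda>_. \<X>)) (\<lambda>\<omega>. \<lambda>i\<in>{1..n}. X i \<omega>)
           (PiM (upper_pairs n) (\<lambda>_. \<Y>)) (\<lambda>\<omega>. \<lambda>p\<in>upper_pairs n. Y p \<omega>)"
    and "f \<in> borel_measurable (kernel_space k \<X> \<Y>)"
    and "symmetric_kernel k \<X> \<Y> f"
    and "integrable M (\<lambda>\<omega>. \<bar>F \<omega>\<bar> ^ 4)"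
    and "is_cond_exp_given M \<X> (X 1) F g"
    and "\<sigma>1 > 0"
  shows "(SUP z::real.
            \<bar>prob_space.prob M {\<omega> \<in> space M.
                (S \<omega> - prob_space.expectation M S) / sqrt (prob_space.variance M S) \<le> z}
             - cdf std_normal_distribution z\<bar>)
         \<le> 12 * real k * (Lp_norm M 4 F)\<^sup>2 / (sqrt (real n) * \<sigma>1\<^sup>2)"
proof -
  interpret gen_U_sample M \<X> \<Y> X Y f k n
    unfolding gen_U_sample_def gen_U_sample_axioms_def using assms(5-13) unfolding F_def by blast
  note g = assms(14)[unfolded F_def]
  have \<sigma>: "\<sigma>1\<^sup>2 = P.s1sq"
  proof -
    have "\<sigma>1 = sqrt P.s1sq"
      unfolding \<sigma>1_def Lp_norm_def f1_def F_def s1sq_eq[OF g] by (simp add: sqrt_def)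
    then show ?thesis using P.s1sq_nonneg by simp
  qed
  have s1: "0 < P.s1sq"
    using \<open>\<sigma>1 > 0\<close> unfolding \<sigma>[symmetric] by (rule zero_less_power)
  have L4: "(Lp_norm M 4 F)\<^sup>2 = sqrt (\<integral>w. K w ^ 4 \<partial>PiM (pairs k) Q)"
    unfolding Lp_norm_def F_def F_power4 by (rule root_4_power2) simp
  show ?thesis
    \<comment> \<open>The bound is uniform in z, so it passes to the supremum over the nonempty set
      of reals.\<close>
    unfolding S_def \<sigma> L4 S_law by (rule cSUP_least) (simp, rule P.ustat_berry_esseen[OF s1])
qed

end
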